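(* Let $\mathscr{A}$ be a nonlinear irreducible BK-tuple of finite sets in a lattice $M$. Then the $\mathscr{A}$-discriminant $D_{\mathscr{A}}$ is a hypersurface in the space of polynomial systems $\mathbb{C}_{\mathscr{A}}$.
   Context: Let $M\simeq\mathbb{Z}^n$ and let $T\simeq(\mathbb{C}^\times)^n$ be the algebraic torus with character lattice $M$. For a finite nonempty set $A\subset M$, $\mathbb{C}_A$ is the vector space of Laurent polynomials $\sum_{a\in A}c_a x^a$; for a tuple $\mathscr{A}=(A_1,\ldots,A_k)$, $\mathbb{C}_{\mathscr{A}}=\mathbb{C}_{A_1}\oplus\cdots\oplus\mathbb{C}_{A_k}$. Subtuples correspond to subsets $I\subseteq\{1,\ldots,k\}$. The linear span $\langle\mathscr{A}\rangle$ is the sublattice of $M$ generated by all differences $a-a'$ with $a,a'\in A_i$, $i=1,\ldots,k$. Standing assumption: $\langle\mathscr{A}\rangle=M$. The defect of a (sub)tuple $\mathscr{B}$ with $|I|$ sets is $\delta(\mathscr{B})=\dim\langle\mathscr{B}\rangle-|I|$. A tuple is independent if all its subtuples have non-negative defect; a BK-tuple is an independent tuple of zero defect; an independent tuple is irreducible if all its nonempty proper subtuples have positive defect. A BK-tuple $\mathscr{A}=(A_1,\ldots,A_n)$ is linear if there are translations of the sets $A_i$ and a lattice isomorphism $M=\langle\mathscr{A}\rangle\to\mathbb{Z}^n$ mapping every translated set $A_i$ into the standard simplex $\{0,e_1,\ldots,e_n\}$; otherwise it is nonlinear. The $\mathscr{A}$-discriminant $D_{\mathscr{A}}$ is the Zariski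 closure in $\mathbb{C}_{\mathscr{A}}$ of the set of systems $(f_1,\ldots,f_k)$ having a degenerate root, i.e. a point $x\in T$ with $f_1(x)=\cdots=f_k(x)=0$ and $df_1\wedge\cdots\wedge df_k(x)=0$. A hypersurface is an irreducible algebraic set of codimension one. *)

theory Defs
  imports
    "HOL-Analysis.Analysis"
    "HOL-Library.Poly_Mapping"
    "HOL-Computational_Algebra.Group_Closure"
begin

text \<open>
  A lattice of rank \<open>n\<close> is identified with \<open>int ^ 'n\<close>, where \<open>n = CARD('n)\<close>; its torus is then
  \<open>(\<complex> - {0})\<^sup>n\<close>, sitting inside \<open>complex ^ 'n\<close>. A tuple of \<open>k = CARD('k)\<close> sets is a family indexed
  by a finite type \<open>'k\<close>, and its subtuples are given by the subsets of \<open>'k\<close>.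
\<close>

subsection \<open>Tuples of finite sets in a lattice\<close>

definition tuple_span :: "('k \<Rightarrow> (int ^ 'n) set) \<Rightarrow> 'k set \<Rightarrow> (int ^ 'n) set" where
  "tuple_span \<A> I = group_closure {a - a' | a a' i. i \<in> I \<and> a \<in> \<A> i \<and> a' \<in> \<A> i}"

text \<open>
  The rank of a sublattice \<open>L\<close> of \<open>\<int>\<^sup>n\<close> is the dimension of the real subspace it spans in \<open>\<real>\<^sup>n\<close>
  (the library function \<^const>\<open>dim\<close> is the dimension of the linear span of a set).
\<close>

definition lattice_rank :: "(int ^ 'n) set \<Rightarrow> nat" where
  "lattice_rank L = dim ((\<lambda>a. (\<chi> j. real_of_int (a $ j)) :: real ^ 'n) ` L)"

definition defect :: "('k \<Rightarrow> (int ^ 'n) set) \<Rightarrow> 'k set \<Rightarrow> int" where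
  "defect \<A> I = int (lattice_rank (tuple_span \<A> I)) - int (card I)"

definition independent_tuple :: "('k::finite \<Rightarrow> (int ^ 'n) set) \<Rightarrow> bool" where
  "independent_tuple \<A> \<longleftrightarrow> (\<forall>I. defect \<A> I \<ge> 0)"

definition BK_tuple :: "('k::finite \<Rightarrow> (int ^ 'n) set) \<Rightarrow> bool" where
  "BK_tuple \<A> \<longleftrightarrow> independent_tuple \<A> \<and> defect \<A> UNIV = 0"

definition irreducible_tuple :: "('k::finite \<Rightarrow> (int ^ 'n) set) \<Rightarrow> bool" where
  "irreducible_tuple \<A> \<longleftrightarrow>
     independent_tuple \<A> \<and> (\<forall>I. I \<noteq> {} \<and> I \<noteq> UNIV \<longrightarrow> defect \<A> I > 0)"

text \<open>
  Linearity is meant for tuples spanning the whole lattice, so that \<open>\<phi>\<close> is an automorphism of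
  \<open>\<int>\<^sup>n\<close>; \<open>axis j 1\<close> is the standard basis vector \<open>e\<^sub>j\<close>.
\<close>

definition linear_tuple :: "('k::finite \<Rightarrow> (int ^ 'n) set) \<Rightarrow> bool" where
  "linear_tuple \<A> \<longleftrightarrow>
     (\<exists>(t :: 'k \<Rightarrow> int ^ 'n) (\<phi> :: int ^ 'n \<Rightarrow> int ^ 'n).
        Modules.additive \<phi> \<and> bij \<phi> \<and>
        (\<forall>i. \<phi> ` ((+) (t i) ` \<A> i) \<subseteq> insert 0 (range (\<lambda>j. axis j 1))))"

subsection \<open>Systems of Laurent polynomials\<close>

type_synonym 'n laurent = "(int ^ 'n) \<Rightarrow>\<^sub>0 complex"

definition laurent_eval :: "'n::finite laurent \<Rightarrow> complex ^ 'n \<Rightarrow> complex" where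
  "laurent_eval f x =
     (\<Sum>a\<in>Poly_Mapping.keys f. Poly_Mapping.lookup f a * (\<Prod>j\<in>UNIV. (x $ j) powi (a $ j)))"

definition torus :: "(complex ^ 'n) set" where
  "torus = {x. \<forall>j. x $ j \<noteq> 0}"

definition system_space :: "('k \<Rightarrow> (int ^ 'n) set) \<Rightarrow> ('k \<Rightarrow> 'n::finite laurent) set" where
  "system_space \<A> = {f. \<forall>i. Poly_Mapping.keys (f i) \<subseteq> \<A> i}"

text \<open>The wedge product of a family of covectors, as an alternating multilinear form.\<close>

definition wedge :: "('k::finite \<Rightarrow> 'v \<Rightarrow> complex) \<Rightarrow> ('k \<Rightarrow> 'v) \<Rightarrow> complex" where
  "wedge \<omega> v = det (\<chi> i j. \<omega> i (v j))"

text \<open>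
  On the torus Laurent polynomials are holomorphic, so their real Frechet derivative is the
  complex-linear differential.
\<close>

definition degenerate_root :: "('k::finite \<Rightarrow> 'n::finite laurent) \<Rightarrow> complex ^ 'n \<Rightarrow> bool" where
  "degenerate_root f x \<longleftrightarrow>
     x \<in> torus \<and> (\<forall>i. laurent_eval (f i) x = 0) \<and>
     wedge (\<lambda>i. frechet_derivative (laurent_eval (f i)) (at x)) = (\<lambda>_. 0)"

lemma laurent_eval_differentiable:
  assumes "x \<in> torus"
  shows "laurent_eval f differentiable (at x)"
proof -
  have "(\<lambda>y :: complex ^ 'a. \<Prod>j\<in>UNIV. (y $ j) powi (a $ j)) differentiable (at x)" for a :: "int ^ 'a"
  proof -
    have "\<exists>D. ((\<lambda>y :: complex ^ 'a. (y $ j) powi (a $ j)) has_derivative D) (at x)" for j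
      using assms has_derivative_power_int[OF _ bounded_linear.has_derivative
          [OF bounded_linear_vec_nth has_derivative_ident]]
      by (fastforce simp: torus_def)
    then obtain D where
      "\<And>j. ((\<lambda>y :: complex ^ 'a. (y $ j) powi (a $ j)) has_derivative D j) (at x)"
      by metis
    then show ?thesis
      unfolding differentiable_def by (intro exI) (rule has_derivative_prod)
  qed
  then show ?thesis
    unfolding laurent_eval_def[abs_def] by (intro differentiable_sum differentiable_mult) auto
qed

subsection \<open>Zariski topology on the space of systems\<close>

text \<open>
  Polynomials in variables from \<open>'v\<close> are finitely supported functions on exponent vectors. The
  coordinates on the space of systems are the coefficients, indexed by pairs \<open>(i, a)\<close>; those with
  \<open>a \<notin> \<A> i\<close> vanish identically there.
\<close>

type_synonym 'v mpolynomial = "('v \<Rightarrow>\<^sub>0 nat) \<Rightarrow>\<^sub>0 complex"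

definition mpoly_eval :: "'v mpolynomial \<Rightarrow> ('v \<Rightarrow> complex) \<Rightarrow> complex" where
  "mpoly_eval p c =
     (\<Sum>m\<in>Poly_Mapping.keys p. Poly_Mapping.lookup p m *
        (\<Prod>v\<in>Poly_Mapping.keys m. c v ^ Poly_Mapping.lookup m v))"

definition coefficients :: "('k \<Rightarrow> 'n::finite laurent) \<Rightarrow> 'k \<times> (int ^ 'n) \<Rightarrow> complex" where
  "coefficients f = (\<lambda>(i, a). Poly_Mapping.lookup (f i) a)"

definition algebraic_set ::
    "('k \<Rightarrow> (int ^ 'n) set) \<Rightarrow> ('k \<Rightarrow> 'n::finite laurent) set \<Rightarrow> bool" where
  "algebraic_set \<A> Z \<longleftrightarrow>
     (\<exists>P :: ('k \<times> (int ^ 'n)) mpolynomial set.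
        Z = {f \<in> system_space \<A>. \<forall>p\<in>P. mpoly_eval p (coefficients f) = 0})"

definition zariski_closure ::
    "('k \<Rightarrow> (int ^ 'n) set) \<Rightarrow> ('k \<Rightarrow> 'n::finite laurent) set \<Rightarrow> ('k \<Rightarrow> 'n laurent) set" where
  "zariski_closure \<A> S = algebraic_set \<A> hull S"

definition irreducible_algebraic_set ::
    "('k \<Rightarrow> (int ^ 'n) set) \<Rightarrow> ('k \<Rightarrow> 'n::finite laurent) set \<Rightarrow> bool" where
  "irreducible_algebraic_set \<A> Z \<longleftrightarrow>
     algebraic_set \<A> Z \<and> Z \<noteq> {} \<and>
     (\<forall>Z1 Z2. algebraic_set \<A> Z1 \<and> algebraic_set \<A> Z2 \<and> Z = Z1 \<union> Z2 \<longrightarrow> Z = Z1 \<or> Z = Z2)"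

text \<open>
  The codimension of an irreducible \<open>Z\<close> is the supremum of the lengths \<open>l\<close> of chains
  \<open>Z = C\<^sub>0 \<subset> C\<^sub>1 \<subset> \<dots> \<subset> C\<^sub>l\<close> of irreducible algebraic subsets of the space of systems.
\<close>

definition codimension ::
    "('k \<Rightarrow> (int ^ 'n) set) \<Rightarrow> ('k \<Rightarrow> 'n::finite laurent) set \<Rightarrow> enat" where
  "codimension \<A> Z =
     Sup {enat l | l. \<exists>C. C 0 = Z \<and> (\<forall>j\<le>l. irreducible_algebraic_set \<A> (C j)) \<and>
                         (\<forall>j<l. C j \<subset> C (Suc j))}"

definition hypersurface ::
    "('k \<Rightarrow> (int ^ 'n) set) \<Rightarrow> ('k \<Rightarrow> 'n::finite laurent) set \<Rightarrow> bool" where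
  "hypersurface \<A> Z \<longleftrightarrow> irreducible_algebraic_set \<A> Z \<and> codimension \<A> Z = 1"

definition discriminant ::
    "('k::finite \<Rightarrow> (int ^ 'n) set) \<Rightarrow> ('k \<Rightarrow> 'n::finite laurent) set" where
  "discriminant \<A> = zariski_closure \<A> {f \<in> system_space \<A>. \<exists>x. degenerate_root f x}"

end

theory Submission
  imports
    Defs
    "HOL-Computational_Algebra.Fundamental_Theorem_Algebra"
    "HOL-Library.Function_Algebras"
begin

text \<open>
  Torus translations move a degenerate root to \<open>(1, \<dots>, 1)\<close>, where it is described by linear
  conditions on the coefficients and the vanishing of the determinant whose rows are arbitrary vectors
  of the spans \<open>L\<^sub>i\<close> of the differences of \<open>A\<^sub>i\<close>. Counting parameters, the systems whose rows satisfy a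
  linear relation with a vanishing coefficient have codimension at least two because all proper
  subtuples have positive defect. Hence, up to closure, degenerate systems are rescalings of elements
  of one linear space \<open>S\<close>, which makes the discriminant irreducible; another count shows that it is not
  everything.

  It has codimension one as soon as the Hessian of some \<open>\<Sum> f\<^sub>i\<close> with \<open>f \<in> S\<close> is nonzero on the kernel
  of the Jacobian: then one coefficient can be eliminated by the open mapping theorem. If the Hessian
  vanishes identically, each \<open>s \<in> S\<close> has a nonconstant function \<open>r\<close> on the support, affine on
  every \<open>A\<^sub>i\<close> with common linear part, such that \<open>r s \<in> S\<close>. Differentiating along \<open>S\<close> shows that all powers
  of \<open>r\<close>, and so the indicators of its level sets, are again affine in this sense. For generic
  \<open>s\<close> these indicators are the barycentric coordinates of a unimodular simplex that contains translates
  of all \<open>A\<^sub>i\<close>, so the tuple is linear.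
\<close>

section \<open>Polynomial functions and dimension counts\<close>

text \<open>Why the Hessian decides: torus translations and rescalings of the n equations form a
  group of dimension 2n, which sweeps out the discriminant, up to closure, from S, a space of
  codimension 2n. Common scalars preserve S, so codimension one is the least possible. It is
  attained unless at every s a further infinitesimal group element, multiplication of s(i, a) by
  r(i, a) = <a, u> - m_i, leads back into S. Vanishing of all equations at the unit point puts u
  into the kernel of the Jacobian; where this kernel is a line, the remaining conditions can be
  solved for the m_i exactly if the Hessian vanishes at u. On the other hand, the functions affine
  on every A_i with common linear part are just the annihilator of S. This double role of r makes
  differentiation along S productive.

  Codimension is defined by chains, so it is controlled through ideals: there must be a nonzero
  equation, but none that omits one chosen coefficient. Polynomials are handled as functions of the
  coefficients, for which composition and restriction to curves are simple inductions.\<close>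

inductive polyfun :: "'v set \<Rightarrow> (('v \<Rightarrow> complex) \<Rightarrow> complex) \<Rightarrow> bool" for X :: "'v set" where
  const: "polyfun X (\<lambda>_. k)"
| var: "x \<in> X \<Longrightarrow> polyfun X (\<lambda>c. c x)"
| add: "polyfun X P \<Longrightarrow> polyfun X Q \<Longrightarrow> polyfun X (\<lambda>c. P c + Q c)"
| mult: "polyfun X P \<Longrightarrow> polyfun X Q \<Longrightarrow> polyfun X (\<lambda>c. P c * Q c)"

lemma polyfun_sum: "(\<And>i. i \<in> I \<Longrightarrow> polyfun X (P i)) \<Longrightarrow> polyfun X (\<lambda>c. \<Sum>i\<in>I. P i c)"
  by (induction I rule: infinite_finite_induct) (auto intro: polyfun.intros)

lemma polyfun_prod: "(\<And>i. i \<in> I \<Longrightarrow> polyfun X (P i)) \<Longrightarrow> polyfun X (\<lambda>c. \<Prod>i\<in>I. P i c)"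
  by (induction I rule: infinite_finite_induct) (auto intro: polyfun.intros)

lemma polyfun_power: "polyfun X P \<Longrightarrow> polyfun X (\<lambda>c. P c ^ k)"
  by (induction k) (auto intro: polyfun.intros)

lemma polyfun_uminus: "polyfun X P \<Longrightarrow> polyfun X (\<lambda>c. - P c)"
  using polyfun.mult[OF polyfun.const[of X "-1"], of P] by simp

lemma polyfun_minus: "polyfun X P \<Longrightarrow> polyfun X Q \<Longrightarrow> polyfun X (\<lambda>c. P c - Q c)"
  using polyfun.add[OF _ polyfun_uminus, of X P Q] by simp

lemmas polyfun_intros = polyfun.intros polyfun_sum polyfun_prod polyfun_power polyfun_uminus polyfun_minus

lemma polyfun_cong:
  assumes "polyfun X P" "\<And>x. x \<in> X \<Longrightarrow> c x = c' x"
  shows "P c = P c'"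
  using assms by (induction rule: polyfun.induct) auto

lemma polyfun_compose:
  assumes "polyfun Y P" "\<And>y. y \<in> Y \<Longrightarrow> polyfun X (g y)"
  shows "polyfun X (\<lambda>z. P (\<lambda>y. g y z))"
  using assms by (induction rule: polyfun.induct) (auto intro: polyfun.intros)

lemma polyfun_mono: "polyfun X P \<Longrightarrow> X \<subseteq> Y \<Longrightarrow> polyfun Y P"
  by (induction rule: polyfun.induct) (auto intro: polyfun.intros)

text \<open>Restriction to polynomial curves turns questions in many variables into questions about
  univariate polynomials, where infinitely many zeros force the zero polynomial.\<close>

lemma polyfun_curve:
  assumes "polyfun X P"
  shows "\<exists>p. \<forall>t. P (\<lambda>x. poly (q x) t) = poly p t"
  using assms
proof (induction rule: polyfun.induct)
  case (const k)
  show ?case by (rule exI[of _ "[:k:]"]) simp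
next
  case (add P Q)
  then show ?case by (metis poly_add)
next
  case (mult P Q)
  then show ?case by (metis poly_mult)
qed auto

lemma polyfun_line:
  assumes "polyfun X P"
  shows "\<exists>p. \<forall>t. P (\<lambda>x. c x + t * d x) = poly p t"
  using polyfun_curve[OF assms, of "\<lambda>x. [:c x, d x:]"] by simp

lemma polyfun_tendsto:
  assumes "polyfun X P" "\<And>x. x \<in> X \<Longrightarrow> ((\<lambda>n. C n x) \<longlongrightarrow> c x) F"
  shows "((\<lambda>n. P (C n)) \<longlongrightarrow> P c) F"
  using assms by (induction rule: polyfun.induct) (auto intro: tendsto_intros)

text \<open>On the line from \<open>c\<^sub>1\<close> to \<open>c\<close> both factors are
  univariate polynomials with zero product; the first is nonzero at time 0, so the second vanishes
  identically, in particular at time 1.\<close>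

lemma polyfun_mult_eq_0:
  assumes "polyfun X P" "polyfun X Q" "\<And>c. P c * Q c = 0" "P c\<^sub>1 \<noteq> 0"
  shows "Q c = 0"
proof (rule ccontr)
  assume Q: "Q c \<noteq> 0"
  obtain p q where p: "\<And>t. P (\<lambda>x. c\<^sub>1 x + t * (c x - c\<^sub>1 x)) = poly p t"
    and q: "\<And>t. Q (\<lambda>x. c\<^sub>1 x + t * (c x - c\<^sub>1 x)) = poly q t"
    using polyfun_line[OF assms(1), of c\<^sub>1 "\<lambda>x. c x - c\<^sub>1 x"] polyfun_line[OF assms(2), of c\<^sub>1 "\<lambda>x. c x - c\<^sub>1 x"] by auto
  have "poly (p * q) t = 0" for t
    using assms(3)[of "\<lambda>x. c\<^sub>1 x + t * (c x - c\<^sub>1 x)"] by (simp add: p q)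
  then have "p * q = 0" using poly_all_0_iff_0 by blast
  moreover have "poly p 0 \<noteq> 0" "poly q 1 \<noteq> 0"
    using assms(4) Q by (auto simp: p[symmetric] q[symmetric])
  ultimately show False by auto
qed

lemma polyfun_mult_nonzero:
  assumes "polyfun X P" "polyfun X Q" "P c\<^sub>1 \<noteq> 0" "Q c\<^sub>2 \<noteq> 0"
  shows "\<exists>c. P c * Q c \<noteq> 0"
  using polyfun_mult_eq_0[of X P Q c\<^sub>1 c\<^sub>2] assms by blast

lemma polyfun_prod_nonzero:
  assumes "finite I" "\<And>i. i \<in> I \<Longrightarrow> polyfun X (P i) \<and> (\<exists>c. P i c \<noteq> 0)"
  shows "\<exists>c. (\<Prod>i\<in>I. P i c) \<noteq> 0"
  using assms
proof (induction rule: finite_induct)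
  case (insert i I)
  then obtain c\<^sub>1 c\<^sub>2 where "P i c\<^sub>1 \<noteq> 0" "(\<Prod>i\<in>I. P i c\<^sub>2) \<noteq> 0" by blast
  moreover have "polyfun X (P i)" "polyfun X (\<lambda>c. \<Prod>i\<in>I. P i c)"
    using insert by (auto intro: polyfun_intros)
  ultimately have "\<exists>c. P i c * (\<Prod>i\<in>I. P i c) \<noteq> 0"
    using polyfun_mult_nonzero[of X "P i" "\<lambda>c. \<Prod>i\<in>I. P i c"] by blast
  then show ?case using insert by simp
qed auto

section \<open>Spaces of polynomials of bounded degree\<close>

interpretation fs: vector_space "\<lambda>(k::complex) (f :: 'a \<Rightarrow> complex) x. k * f x"
  by unfold_locales (auto simp: algebra_simps fun_eq_iff)

text \<open>The degree is bounded in each variable separately: the spanning set then has at most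
  \<open>(D + 1) ^ card X\<close> elements, and the bounds add under products.\<close>

definition monom_funs :: "'v set \<Rightarrow> nat \<Rightarrow> (('v \<Rightarrow> complex) \<Rightarrow> complex) set" where
  "monom_funs X D = (\<lambda>\<alpha> c. \<Prod>x\<in>X. c x ^ \<alpha> x) ` (X \<rightarrow>\<^sub>E {..D})"

lemma finite_monom_funs: "finite X \<Longrightarrow> finite (monom_funs X D)"
  unfolding monom_funs_def by (intro finite_imageI finite_PiE) auto

lemma card_monom_funs: "finite X \<Longrightarrow> card (monom_funs X D) \<le> (D + 1) ^ card X"
  unfolding monom_funs_def
  by (rule order.trans[OF card_image_le]) (auto intro: finite_PiE simp: card_PiE)

lemma monom_funsI:
  assumes "\<And>x. x \<in> X \<Longrightarrow> \<alpha> x \<le> D"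
  shows "(\<lambda>c. \<Prod>x\<in>X. c x ^ \<alpha> x) \<in> monom_funs X D"
  unfolding monom_funs_def
  by (rule image_eqI[of _ _ "restrict \<alpha> X"]) (use assms in \<open>auto simp: fun_eq_iff\<close>)

lemma monom_funs_mult:
  assumes "f \<in> monom_funs X D" "g \<in> monom_funs X E"
  shows "(\<lambda>c. f c * g c) \<in> monom_funs X (D + E)"
proof -
  obtain \<alpha> \<beta> where "\<alpha> \<in> X \<rightarrow>\<^sub>E {..D}" "f = (\<lambda>c. \<Prod>x\<in>X. c x ^ \<alpha> x)"
    "\<beta> \<in> X \<rightarrow>\<^sub>E {..E}" "g = (\<lambda>c. \<Prod>x\<in>X. c x ^ \<beta> x)"
    using assms unfolding monom_funs_def by auto
  then show ?thesis
    using monom_funsI[of X "\<lambda>x. \<alpha> x + \<beta> x" "D + E"]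
    by (auto simp: prod.distrib power_add PiE_iff intro: add_mono)
qed

lemma monom_funs_mono: "D \<le> E \<Longrightarrow> monom_funs X D \<subseteq> monom_funs X E"
  unfolding monom_funs_def by (intro image_mono PiE_mono) auto

lemma span_monom_funs_mult:
  assumes "f \<in> fs.span (monom_funs X D)" "g \<in> fs.span (monom_funs X E)"
  shows "(\<lambda>c. f c * g c) \<in> fs.span (monom_funs X (D + E))"
proof -
  have 1: "(\<lambda>c. m c * g c) \<in> fs.span (monom_funs X (D + E))" if m: "m \<in> monom_funs X D" for m
    using assms(2)
  proof (induction rule: fs.span_induct_alt)
    case base
    show ?case using fs.span_zero by (simp add: zero_fun_def)
  next
    case (step k b y)
    have "(\<lambda>c. k * (m c * b c)) \<in> fs.span (monom_funs X (D + E))"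
      by (rule fs.span_scale[of "\<lambda>c. m c * b c"], rule fs.span_base, rule monom_funs_mult[OF m step(1)])
    from fs.span_add[OF this step(2)] show ?case
      by (simp add: algebra_simps plus_fun_def)
  qed
  show ?thesis
    using assms(1)
  proof (induction rule: fs.span_induct_alt)
    case base
    show ?case using fs.span_zero by (simp add: zero_fun_def)
  next
    case (step k b y)
    have "(\<lambda>c. k * (b c * g c)) \<in> fs.span (monom_funs X (D + E))"
      by (rule fs.span_scale[of "\<lambda>c. b c * g c"], rule 1[OF step(1)])
    from fs.span_add[OF this step(2)] show ?case
      by (simp add: algebra_simps plus_fun_def)
  qed
qed

lemma const_in_span_monom_funs: "(\<lambda>_. k) \<in> fs.span (monom_funs X D)"
  using fs.span_scale[OF fs.span_base[OF monom_funsI[of X "\<lambda>_. 0" D]], of k] by simp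

lemma polyfun_in_span_monom_funs:
  assumes "finite X" "polyfun X P"
  shows "\<exists>D. P \<in> fs.span (monom_funs X D)"
  using assms(2)
proof (induction rule: polyfun.induct)
  case (const k)
  show ?case using const_in_span_monom_funs by blast
next
  case (var x)
  have "(\<lambda>c. \<Prod>y\<in>X. c y ^ (if y = x then 1 else 0)) \<in> monom_funs X 1"
    by (rule monom_funsI) auto
  moreover have "(\<lambda>c. \<Prod>y\<in>X. c y ^ (if y = x then 1 else 0)) = (\<lambda>c. c x :: complex)"
    using var assms(1) by (simp add: fun_eq_iff if_distrib[of "\<lambda>k. _ ^ k"] cong: if_cong)
  ultimately show ?case using fs.span_base by metis
next
  case (add P Q)
  then obtain D E where "P \<in> fs.span (monom_funs X D)" "Q \<in> fs.span (monom_funs X E)" by blast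
  then have "P \<in> fs.span (monom_funs X (max D E))" "Q \<in> fs.span (monom_funs X (max D E))"
    using fs.span_mono[OF monom_funs_mono[of D "max D E" X]]
      fs.span_mono[OF monom_funs_mono[of E "max D E" X]] by auto
  then have "P + Q \<in> fs.span (monom_funs X (max D E))" by (rule fs.span_add)
  then show ?case by (auto simp: plus_fun_def)
next
  case (mult P Q)
  then show ?case using span_monom_funs_mult by blast
qed

lemma span_monom_funs_prod:
  assumes "\<And>i. i \<in> I \<Longrightarrow> f i \<in> fs.span (monom_funs X D)"
  shows "(\<lambda>c. \<Prod>i\<in>I. f i c) \<in> fs.span (monom_funs X (D * card I))"
  using assms
proof (induction I rule: infinite_finite_induct)
  case (insert i I)
  then have "(\<lambda>c. f i c * (\<Prod>i\<in>I. f i c)) \<in> fs.span (monom_funs X (D + D * card I))"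
    by (intro span_monom_funs_mult) auto
  with insert show ?case by simp
qed (auto simp: const_in_span_monom_funs)

lemma fun_sum_apply: "(\<Sum>v\<in>A. f v) z = (\<Sum>v\<in>A. f v z :: complex)"
  by (induction A rule: infinite_finite_induct) auto

text \<open>A family rather than a set, because different polynomials may have the same pullback: a
  repetition yields the coefficients 1 and -1, and otherwise the exchange lemma applies to the
  image.\<close>

lemma fs_dependent_family:
  assumes "finite E" "finite B" "card B < card E" "\<And>e. e \<in> E \<Longrightarrow> h e \<in> fs.span B"
  shows "\<exists>k. (\<exists>e\<in>E. k e \<noteq> (0::complex)) \<and> (\<forall>z. (\<Sum>e\<in>E. k e * h e z) = 0)"
proof (cases "inj_on h E")
  case False
  then obtain e e' where e: "e \<in> E" "e' \<in> E" "e \<noteq> e'" "h e = h e'" unfolding inj_on_def by auto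
  define k :: "'a \<Rightarrow> complex" where "k = (\<lambda>x. if x = e then 1 else if x = e' then -1 else 0)"
  have "(\<Sum>x\<in>E. k x * h x z) = 0" for z
  proof -
    have "(\<Sum>x\<in>E. k x * h x z) = (\<Sum>x\<in>{e,e'}. k x * h x z)"
      by (rule sum.mono_neutral_right) (use e assms in \<open>auto simp: k_def\<close>)
    also have "\<dots> = 0" using e by (simp add: k_def)
    finally show ?thesis .
  qed
  moreover have "k e \<noteq> 0" by (simp add: k_def)
  ultimately show ?thesis using e by blast
next
  case True
  have "fs.dependent (h ` E)"
  proof (rule ccontr)
    assume "fs.independent (h ` E)"
    from fs.independent_span_bound[OF assms(2) this] assms(4) have "card (h ` E) \<le> card B" by auto
    with True assms(3) show False by (simp add: card_image)
  qed
  then obtain k where k: "(\<exists>v\<in>h ` E. k v \<noteq> 0)" "(\<Sum>v\<in>h ` E. (\<lambda>x. k v * v x)) = 0"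
    using fs.dependent_finite[of "h ` E"] assms(1) by auto
  have "(\<Sum>e\<in>E. k (h e) * h e z) = 0" for z
  proof -
    have "(\<Sum>v\<in>h ` E. (\<lambda>x. k v * v x)) z = (\<Sum>v\<in>h ` E. k v * v z)"
      by (rule fun_sum_apply)
    then show ?thesis using k(2) True by (simp add: sum.reindex)
  qed
  then show ?thesis using k(1) by (intro exI[of _ "k \<circ> h"]) auto
qed

text \<open>
  With more target than source variables, the polynomials of degree at most \<open>e\<close> in each target
  variable outgrow the space their pullbacks live in, so some nonzero one pulls back to zero. The
  polynomials \<open>\<delta> \<gamma>\<close> are Lagrange basis polynomials of the grid \<open>{0..e}\<^sup>Y\<close>, so that linear
  independence is seen by evaluation.
\<close>

lemma polynomial_map_not_dominant:
  assumes "finite X" "finite Y" "card X < card Y" "\<And>y. y \<in> Y \<Longrightarrow> polyfun X (g y)"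
  shows "\<exists>P. polyfun Y P \<and> (\<exists>c. P c \<noteq> 0) \<and> (\<forall>z. P (\<lambda>y. g y z) = 0)"
proof -
  have "\<exists>D. \<forall>y\<in>Y. g y \<in> fs.span (monom_funs X D)"
    using assms(2,4)
  proof (induction Y rule: finite_induct)
    case (insert y Y)
    then obtain D E where "\<forall>y\<in>Y. g y \<in> fs.span (monom_funs X D)" "g y \<in> fs.span (monom_funs X E)"
      using polyfun_in_span_monom_funs[OF assms(1)] by (metis insertI1 insertI2)
    then have "\<forall>x\<in>insert y Y. g x \<in> fs.span (monom_funs X (max D E))"
      using fs.span_mono[OF monom_funs_mono[of D "max D E" X]] fs.span_mono[OF monom_funs_mono[of E "max D E" X]]
      by auto
    then show ?case by blast
  qed auto
  then obtain D where D: "\<And>y. y \<in> Y \<Longrightarrow> g y \<in> fs.span (monom_funs X D)" by blast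
  define N where "N = card Y"
  \<comment> \<open>This grid size makes the count strict: \<open>(D e N + 1)^|X| <= (D N + 1)^|X|
    (e + 1)^|X| = e (e + 1)^|X| < (e + 1)^(|X| + 1)\<close>, which is at most the number of grid
    points.\<close>
  define e where "e = (D * N + 1) ^ card X"
  define G where "G = (Y \<rightarrow>\<^sub>E {..e})"
  define \<delta> :: "('b \<Rightarrow> nat) \<Rightarrow> ('b \<Rightarrow> complex) \<Rightarrow> complex" where
    "\<delta> = (\<lambda>\<gamma> c. \<Prod>y\<in>Y. \<Prod>j\<in>{..e} - {\<gamma> y}. c y - of_nat j)"
  have finG: "finite G" and cardG: "card G = (e + 1) ^ N"
    using assms(2) by (auto simp: G_def N_def card_PiE intro: finite_PiE)
  have pd: "polyfun Y (\<delta> \<gamma>)" for \<gamma>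
    unfolding \<delta>_def by (intro polyfun_intros)
  have h: "(\<lambda>z. \<delta> \<gamma> (\<lambda>y. g y z)) \<in> fs.span (monom_funs X (D * e * N))" if "\<gamma> \<in> G" for \<gamma>
  proof -
    have 1: "(\<lambda>z. g y z - of_nat j) \<in> fs.span (monom_funs X D)" if "y \<in> Y" for y j
      using fs.span_diff[OF D[OF that] const_in_span_monom_funs[of "of_nat j" X D]]
      by (simp add: fun_diff_def)
    have 2: "card ({..e} - {\<gamma> y}) = e" if "y \<in> Y" for y
      using \<open>\<gamma> \<in> G\<close> that by (auto simp: G_def PiE_iff)
    have "(\<lambda>z. \<Prod>j\<in>{..e} - {\<gamma> y}. g y z - of_nat j) \<in> fs.span (monom_funs X (D * e))" if "y \<in> Y" for y
      using span_monom_funs_prod[of "{..e} - {\<gamma> y}" "\<lambda>j z. g y z - of_nat j" X D] 1[OF that] 2[OF that] by simp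
    from span_monom_funs_prod[OF this] show ?thesis by (simp add: \<delta>_def N_def)
  qed
  have "card (monom_funs X (D * e * N)) < card G"
  proof -
    have "card (monom_funs X (D * e * N)) \<le> (D * e * N + 1) ^ card X"
      by (rule card_monom_funs[OF assms(1)])
    also have "\<dots> \<le> ((D * N + 1) * (e + 1)) ^ card X"
      by (rule power_mono) (auto simp: algebra_simps)
    also have "\<dots> = e * (e + 1) ^ card X"
      by (simp only: power_mult_distrib e_def[symmetric])
    also have "\<dots> < (e + 1) ^ Suc (card X)" by simp
    also have "\<dots> \<le> (e + 1) ^ N"
      by (rule power_increasing) (use assms(3) in \<open>auto simp: N_def\<close>)
    finally show ?thesis by (simp add: cardG)
  qed
  from fs_dependent_family[OF finG finite_monom_funs[OF assms(1)] this, of "\<lambda>\<gamma> z. \<delta> \<gamma> (\<lambda>y. g y z)"] h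
  have "\<exists>k. (\<exists>\<gamma>\<in>G. k \<gamma> \<noteq> 0) \<and> (\<forall>z. (\<Sum>\<gamma>\<in>G. k \<gamma> * \<delta> \<gamma> (\<lambda>y. g y z)) = 0)" by simp
  then obtain k \<gamma>\<^sub>0 where k: "\<gamma>\<^sub>0 \<in> G" "k \<gamma>\<^sub>0 \<noteq> 0" "\<And>z. (\<Sum>\<gamma>\<in>G. k \<gamma> * \<delta> \<gamma> (\<lambda>y. g y z)) = 0"
    by (elim exE conjE bexE) auto
  have "(\<Sum>\<gamma>\<in>G. k \<gamma> * \<delta> \<gamma> (\<lambda>y. of_nat (\<gamma>\<^sub>0 y))) = (\<Sum>\<gamma>\<in>{\<gamma>\<^sub>0}. k \<gamma> * \<delta> \<gamma> (\<lambda>y. of_nat (\<gamma>\<^sub>0 y)))"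
  proof (rule sum.mono_neutral_right)
    show "\<forall>\<gamma>\<in>G - {\<gamma>\<^sub>0}. k \<gamma> * \<delta> \<gamma> (\<lambda>y. of_nat (\<gamma>\<^sub>0 y)) = 0"
    proof
      fix \<gamma> assume "\<gamma> \<in> G - {\<gamma>\<^sub>0}"
      then have "\<not> (\<forall>y\<in>Y. \<gamma> y = \<gamma>\<^sub>0 y)" using k(1) PiE_ext[of \<gamma> Y "\<lambda>_. {..e}" \<gamma>\<^sub>0] unfolding G_def by blast
      then obtain y where y: "y \<in> Y" "\<gamma> y \<noteq> \<gamma>\<^sub>0 y" by blast
      then have "\<gamma>\<^sub>0 y \<in> {..e} - {\<gamma> y}" using k(1) by (auto simp: G_def PiE_iff)
      then have "(\<Prod>j\<in>{..e} - {\<gamma> y}. (of_nat (\<gamma>\<^sub>0 y) - of_nat j :: complex)) = 0"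
        by (intro prod_zero) auto
      then have "\<delta> \<gamma> (\<lambda>y. of_nat (\<gamma>\<^sub>0 y)) = 0"
        unfolding \<delta>_def using y(1) assms(2) by (intro prod_zero) auto
      then show "k \<gamma> * \<delta> \<gamma> (\<lambda>y. of_nat (\<gamma>\<^sub>0 y)) = 0" by simp
    qed
  qed (use finG k(1) in auto)
  moreover have "\<delta> \<gamma>\<^sub>0 (\<lambda>y. of_nat (\<gamma>\<^sub>0 y)) \<noteq> 0"
    unfolding \<delta>_def using assms(2) by auto
  ultimately have "(\<Sum>\<gamma>\<in>G. k \<gamma> * \<delta> \<gamma> (\<lambda>y. of_nat (\<gamma>\<^sub>0 y))) \<noteq> 0" using k(2) by simp
  moreover have "polyfun Y (\<lambda>c. \<Sum>\<gamma>\<in>G. k \<gamma> * \<delta> \<gamma> c)"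
    by (intro polyfun_intros pd)
  ultimately show ?thesis using k(3) by (intro exI[of _ "\<lambda>c. \<Sum>\<gamma>\<in>G. k \<gamma> * \<delta> \<gamma> c"]) auto
qed

text \<open>Composition with the projection along \<open>w\<close> onto the hyperplane where the
  coordinate \<open>y\<^sub>0\<close> is zero: the target loses one dimension, which the stronger
  cardinality assumption affords. If \<open>w\<close> vanishes on \<open>Y\<close>, invariance is
  automatic.\<close>

lemma polynomial_map_not_dominant_mod_line:
  fixes w :: "'v \<Rightarrow> complex"
  assumes "finite X" "finite Y" "card X + 1 < card Y" "\<And>y. y \<in> Y \<Longrightarrow> polyfun X (g y)"
  shows "\<exists>P. polyfun Y P \<and> (\<exists>c. P c \<noteq> 0) \<and> (\<forall>z. P (\<lambda>y. g y z) = 0) \<and>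
             (\<forall>c t. P (\<lambda>y. c y + t * w y) = P c)"
proof (cases "\<exists>y\<in>Y. w y \<noteq> 0")
  case False
  have "\<exists>P. polyfun Y P \<and> (\<exists>c. P c \<noteq> 0) \<and> (\<forall>z. P (\<lambda>y. g y z) = 0)"
    by (rule polynomial_map_not_dominant[OF assms(1,2)]) (use assms in auto)
  then obtain P where "polyfun Y P \<and> (\<exists>c. P c \<noteq> 0) \<and> (\<forall>z. P (\<lambda>y. g y z) = 0)" ..
  then have P: "polyfun Y P" "\<exists>c. P c \<noteq> 0" "\<forall>z. P (\<lambda>y. g y z) = 0" by simp_all
  moreover have "P (\<lambda>y. c y + t * w y) = P c" for c t
    by (rule polyfun_cong[OF P(1)]) (use False in auto)
  ultimately show ?thesis by (intro exI[of _ P]) auto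
next
  case True
  then obtain y\<^sub>0 where y0: "y\<^sub>0 \<in> Y" "w y\<^sub>0 \<noteq> 0" by blast
  define q where "q = (\<lambda>y. w y / w y\<^sub>0)"
  define pr :: "('v \<Rightarrow> complex) \<Rightarrow> 'v \<Rightarrow> complex" where "pr = (\<lambda>c y. c y - c y\<^sub>0 * q y)"
  have "card X < card (Y - {y\<^sub>0})" using assms y0 by auto
  moreover have "polyfun X (\<lambda>z. g y z - g y\<^sub>0 z * q y)" if "y \<in> Y - {y\<^sub>0}" for y
    using that y0 by (intro polyfun_intros assms(4)) auto
  ultimately have "\<exists>P. polyfun (Y - {y\<^sub>0}) P \<and> (\<exists>c. P c \<noteq> 0) \<and> (\<forall>z. P (\<lambda>y. g y z - g y\<^sub>0 z * q y) = 0)"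
    by (intro polynomial_map_not_dominant[OF assms(1)]) (use assms in auto)
  then obtain P where "polyfun (Y - {y\<^sub>0}) P \<and> (\<exists>c. P c \<noteq> 0) \<and> (\<forall>z. P (\<lambda>y. g y z - g y\<^sub>0 z * q y) = 0)" ..
  then have P: "polyfun (Y - {y\<^sub>0}) P" "\<exists>c. P c \<noteq> 0" "\<And>z. P (\<lambda>y. g y z - g y\<^sub>0 z * q y) = 0" by simp_all
  then obtain c where c: "P c \<noteq> 0" by blast
  have "polyfun Y (\<lambda>c. c y - c y\<^sub>0 * q y)" if "y \<in> Y - {y\<^sub>0}" for y
    using that y0 by (intro polyfun_intros) auto
  then have "polyfun Y (\<lambda>c. P (pr c))"
    unfolding pr_def by (rule polyfun_compose[OF P(1)])
  moreover have "P (pr (c(y\<^sub>0 := 0))) = P c"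
    by (rule polyfun_cong[OF P(1)]) (auto simp: pr_def)
  moreover have "pr (\<lambda>y. c y + t * w y) = pr c" for c t
    using y0(2) by (auto simp: pr_def q_def fun_eq_iff field_simps)
  moreover have "P (pr (\<lambda>y. g y z)) = 0" for z
    using P(3)[of z] by (simp add: pr_def)
  ultimately show ?thesis
    using c by (intro exI[of _ "\<lambda>c. P (pr c)"] conjI exI[of _ "c(y\<^sub>0 := 0)"]) auto
qed

section \<open>A criterion for hypersurfaces\<close>

definition support_set :: "('k \<Rightarrow> (int ^ 'n) set) \<Rightarrow> ('k \<times> (int ^ 'n)) set" where
  "support_set \<A> = (SIGMA i:UNIV. \<A> i)"

lemma mem_support_set [simp]: "(i, a) \<in> support_set \<A> \<longleftrightarrow> a \<in> \<A> i"
  by (simp add: support_set_def)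

lemma coefficients_eq_0: "f \<in> system_space \<A> \<Longrightarrow> v \<notin> support_set \<A> \<Longrightarrow> coefficients f v = 0"
  by (cases v) (auto simp: coefficients_def system_space_def subset_iff in_keys_iff)

definition system_of ::
    "('k \<Rightarrow> (int ^ 'n) set) \<Rightarrow> ('k \<times> (int ^ 'n) \<Rightarrow> complex) \<Rightarrow> 'k \<Rightarrow> 'n::finite laurent" where
  "system_of \<A> c i = Abs_poly_mapping (\<lambda>a. if a \<in> \<A> i then c (i, a) else 0)"

lemma lookup_system_of:
  assumes "finite (\<A> i)"
  shows "Poly_Mapping.lookup (system_of \<A> c i) a = (if a \<in> \<A> i then c (i, a) else 0)"
proof -
  have "finite {a. (if a \<in> \<A> i then c (i, a) else 0) \<noteq> 0}"
    by (rule finite_subset[OF _ assms]) auto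
  then show ?thesis by (simp add: system_of_def)
qed

lemma system_of_in_space: "(\<And>i. finite (\<A> i)) \<Longrightarrow> system_of \<A> c \<in> system_space \<A>"
  by (auto simp: system_space_def in_keys_iff lookup_system_of split: if_splits)

lemma coefficients_system_of:
  "(\<And>i. finite (\<A> i)) \<Longrightarrow> v \<in> support_set \<A> \<Longrightarrow> coefficients (system_of \<A> c) v = c v"
  by (cases v) (auto simp: coefficients_def lookup_system_of)

lemma mpoly_eval_polyfun: "polyfun UNIV (mpoly_eval p)"
proof -
  have "polyfun UNIV (\<lambda>c. mpoly_eval p c)"
    unfolding mpoly_eval_def by (intro polyfun_intros) auto
  then show ?thesis by simp
qed

lemma mpoly_eval_superset:
  assumes "finite K" "Poly_Mapping.keys p \<subseteq> K"
  shows "mpoly_eval p c = (\<Sum>m\<in>K. Poly_Mapping.lookup p m *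
           (\<Prod>v\<in>Poly_Mapping.keys m. c v ^ Poly_Mapping.lookup m v))"
  unfolding mpoly_eval_def
  by (rule sum.mono_neutral_left) (use assms in \<open>auto simp: in_keys_iff\<close>)

lemma mpoly_eval_add: "mpoly_eval (p + q) c = mpoly_eval p c + mpoly_eval q c"
proof -
  let ?K = "Poly_Mapping.keys p \<union> Poly_Mapping.keys q"
  have "Poly_Mapping.keys (p + q) \<subseteq> ?K" by (rule Poly_Mapping.keys_add)
  then show ?thesis
    using mpoly_eval_superset[of ?K "p + q" c] mpoly_eval_superset[of ?K p c] mpoly_eval_superset[of ?K q c]
    by (simp add: lookup_add ring_distribs sum.distrib)
qed

lemma mpoly_eval_single:
  "mpoly_eval (Poly_Mapping.single m k) c = k * (\<Prod>v\<in>Poly_Mapping.keys m. c v ^ Poly_Mapping.lookup m v)"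
  using mpoly_eval_superset[of "{m}" "Poly_Mapping.single m k" c] by simp

lemma mpoly_of_polyfun:
  assumes "finite X" "polyfun X P"
  shows "\<exists>p. P = mpoly_eval p"
proof -
  obtain D where "P \<in> fs.span (monom_funs X D)"
    using polyfun_in_span_monom_funs[OF assms] by blast
  then show ?thesis
  proof (induction rule: fs.span_induct_alt)
    case base
    show ?case by (rule exI[of _ 0]) (simp add: fun_eq_iff mpoly_eval_def)
  next
    case (step k b y)
    obtain \<alpha> where b: "b = (\<lambda>c. \<Prod>x\<in>X. c x ^ \<alpha> x)"
      using step(1) by (auto simp: monom_funs_def)
    obtain q where q: "y = mpoly_eval q" using step(2) by blast
    define m where "m = Abs_poly_mapping (\<lambda>x. if x \<in> X then \<alpha> x else 0)"
    have "finite {x. (if x \<in> X then \<alpha> x else 0) \<noteq> 0}"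
      by (rule finite_subset[OF _ assms(1)]) auto
    then have m: "Poly_Mapping.lookup m x = (if x \<in> X then \<alpha> x else 0)" for x
      by (simp add: m_def)
    have "(\<Prod>v\<in>Poly_Mapping.keys m. c v ^ Poly_Mapping.lookup m v) = b c" for c
      unfolding b by (rule prod.mono_neutral_cong_left) (use assms(1) in \<open>auto simp: in_keys_iff m split: if_splits\<close>)
    then have "(\<lambda>x. k * b x) + y = mpoly_eval (Poly_Mapping.single m k + q)"
      by (simp add: fun_eq_iff mpoly_eval_add mpoly_eval_single q)
    then show ?case by blast
  qed
qed

text \<open>Coordinates outside the support are zero on the space of systems, so substituting 0 for
  them changes no value there and leaves a polynomial in the support variables.\<close>

lemma polyfun_of_mpoly:
  "\<exists>P. polyfun (support_set \<A>) P \<and>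
       (\<forall>f\<in>system_space \<A>. mpoly_eval p (coefficients f) = P (coefficients f))"
proof -
  let ?r = "\<lambda>c v. if v \<in> support_set \<A> then c v else 0"
  have "polyfun (support_set \<A>) (\<lambda>c. mpoly_eval p (?r c))"
  proof (rule polyfun_compose[OF mpoly_eval_polyfun])
    show "polyfun (support_set \<A>) (\<lambda>c. ?r c v)" for v
      by (cases "v \<in> support_set \<A>") (simp_all add: polyfun.const polyfun.var del: split_paired_All)
  qed
  moreover have "?r (coefficients f) = coefficients f" if "f \<in> system_space \<A>" for f
    using coefficients_eq_0[OF that] by (auto simp: fun_eq_iff)
  ultimately show ?thesis by (intro exI[of _ "\<lambda>c. mpoly_eval p (?r c)"]) auto
qed

section \<open>Zero loci, vanishing ideals and irreducibility\<close>

definition vanishing_ideal ::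
    "('k \<Rightarrow> (int ^ 'n) set) \<Rightarrow> ('k \<Rightarrow> 'n::finite laurent) set \<Rightarrow> (('k \<times> (int ^ 'n) \<Rightarrow> complex) \<Rightarrow> complex) set" where
  "vanishing_ideal \<A> Z = {P. polyfun (support_set \<A>) P \<and> (\<forall>f\<in>Z. P (coefficients f) = 0)}"

definition zero_locus ::
    "('k \<Rightarrow> (int ^ 'n) set) \<Rightarrow> (('k \<times> (int ^ 'n) \<Rightarrow> complex) \<Rightarrow> complex) set \<Rightarrow> ('k \<Rightarrow> 'n::finite laurent) set" where
  "zero_locus \<A> I = {f \<in> system_space \<A>. \<forall>P\<in>I. P (coefficients f) = 0}"

lemma algebraic_set_zero_locus:
  fixes \<A> :: "'k::finite \<Rightarrow> (int ^ 'n::finite) set"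
  assumes "\<And>i. finite (\<A> i)" "\<And>P. P \<in> I \<Longrightarrow> polyfun (support_set \<A>) P"
  shows "algebraic_set \<A> (zero_locus \<A> I)"
proof -
  have "finite (support_set \<A>)" using assms(1) by (simp add: support_set_def)
  then have "\<exists>p. P = mpoly_eval p" if "P \<in> I" for P
    using mpoly_of_polyfun assms(2)[OF that] by blast
  then obtain p where p: "\<And>P. P \<in> I \<Longrightarrow> P = mpoly_eval (p P)" by metis
  show ?thesis unfolding algebraic_set_def
  proof (rule exI[of _ "p ` I"])
    show "zero_locus \<A> I = {f \<in> system_space \<A>. \<forall>q\<in>p ` I. mpoly_eval q (coefficients f) = 0}"
      unfolding zero_locus_def using p by (auto simp: fun_eq_iff)
  qed
qed

lemma algebraic_set_eq_zero_locus:
  assumes "algebraic_set \<A> Z"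
  shows "Z = zero_locus \<A> (vanishing_ideal \<A> Z)"
proof
  obtain P where P: "Z = {f \<in> system_space \<A>. \<forall>p\<in>P. mpoly_eval p (coefficients f) = 0}"
    using assms unfolding algebraic_set_def by blast
  then show "Z \<subseteq> zero_locus \<A> (vanishing_ideal \<A> Z)"
    by (auto simp: zero_locus_def vanishing_ideal_def)
  show "zero_locus \<A> (vanishing_ideal \<A> Z) \<subseteq> Z"
  proof
    fix f assume f: "f \<in> zero_locus \<A> (vanishing_ideal \<A> Z)"
    then have fV: "f \<in> system_space \<A>" by (simp add: zero_locus_def)
    have "mpoly_eval p (coefficients f) = 0" if "p \<in> P" for p
    proof -
      obtain Q where Q: "polyfun (support_set \<A>) Q"
        "\<forall>f\<in>system_space \<A>. mpoly_eval p (coefficients f) = Q (coefficients f)"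
        using polyfun_of_mpoly by blast
      have "Q \<in> vanishing_ideal \<A> Z"
        using Q that by (auto simp: vanishing_ideal_def P)
      with f Q fV show ?thesis by (auto simp: zero_locus_def)
    qed
    with fV show "f \<in> Z" by (simp add: P)
  qed
qed

lemma zariski_closure_eq:
  fixes \<A> :: "'k::finite \<Rightarrow> (int ^ 'n::finite) set"
  assumes "\<And>i. finite (\<A> i)" "S \<subseteq> system_space \<A>"
  shows "zariski_closure \<A> S = zero_locus \<A> (vanishing_ideal \<A> S)"
  unfolding zariski_closure_def
proof (rule hull_unique)
  show "S \<subseteq> zero_locus \<A> (vanishing_ideal \<A> S)"
    using assms(2) by (auto simp: zero_locus_def vanishing_ideal_def)
  show "algebraic_set \<A> (zero_locus \<A> (vanishing_ideal \<A> S))"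
    by (rule algebraic_set_zero_locus[OF assms(1)]) (auto simp: vanishing_ideal_def)
  show "zero_locus \<A> (vanishing_ideal \<A> S) \<subseteq> T" if "S \<subseteq> T" "algebraic_set \<A> T" for T
  proof -
    have "vanishing_ideal \<A> T \<subseteq> vanishing_ideal \<A> S"
      using that(1) by (auto simp: vanishing_ideal_def)
    then show ?thesis
      using algebraic_set_eq_zero_locus[OF that(2)] by (auto simp: zero_locus_def)
  qed
qed

lemma vanishing_ideal_zero_locus:
  assumes "S \<subseteq> system_space \<A>"
  shows "vanishing_ideal \<A> (zero_locus \<A> (vanishing_ideal \<A> S)) = vanishing_ideal \<A> S"
  using assms by (auto simp: vanishing_ideal_def zero_locus_def)

text \<open>If the closure were a union of two proper closed parts, an equation \<open>P\<close> of
  \<open>Z1\<close> and an equation \<open>Q\<close> of \<open>Z2\<close>, each failing somewhere on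
  the closure, would have a product vanishing on \<open>S\<close>. Primeness thus has to be tested
  on \<open>S\<close> only.\<close>

lemma irreducible_zero_locus:
  fixes \<A> :: "'k::finite \<Rightarrow> (int ^ 'n::finite) set"
  assumes fin: "\<And>i. finite (\<A> i)" and S: "S \<subseteq> system_space \<A>" "S \<noteq> {}"
    and prime: "\<And>P Q. polyfun (support_set \<A>) P \<Longrightarrow> polyfun (support_set \<A>) Q \<Longrightarrow>
      (\<forall>f\<in>S. P (coefficients f) * Q (coefficients f) = 0) \<Longrightarrow>
      (\<forall>f\<in>S. P (coefficients f) = 0) \<or> (\<forall>f\<in>S. Q (coefficients f) = 0)"
  shows "irreducible_algebraic_set \<A> (zero_locus \<A> (vanishing_ideal \<A> S))" (is "irreducible_algebraic_set \<A> ?D")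
  unfolding irreducible_algebraic_set_def
proof (intro conjI allI impI)
  show "algebraic_set \<A> ?D"
    by (rule algebraic_set_zero_locus[OF fin]) (auto simp: vanishing_ideal_def)
  have SD: "S \<subseteq> ?D" using S by (auto simp: zero_locus_def vanishing_ideal_def)
  then show "?D \<noteq> {}" using S by auto
  fix Z1 Z2 assume Z: "algebraic_set \<A> Z1 \<and> algebraic_set \<A> Z2 \<and> ?D = Z1 \<union> Z2"
  show "?D = Z1 \<or> ?D = Z2"
  proof (rule ccontr)
    assume "\<not> ?thesis"
    then obtain f g where f: "f \<in> ?D" "f \<notin> Z1" and g: "g \<in> ?D" "g \<notin> Z2" using Z by blast
    obtain P where P: "P \<in> vanishing_ideal \<A> Z1" "P (coefficients f) \<noteq> 0"
      using algebraic_set_eq_zero_locus[of \<A> Z1] Z f unfolding zero_locus_def by blast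
    obtain Q where Q: "Q \<in> vanishing_ideal \<A> Z2" "Q (coefficients g) \<noteq> 0"
      using algebraic_set_eq_zero_locus[of \<A> Z2] Z g unfolding zero_locus_def by blast
    have "\<forall>f\<in>S. P (coefficients f) * Q (coefficients f) = 0"
      using SD Z P Q by (auto simp: vanishing_ideal_def)
    with prime[of P Q] P Q have "P \<in> vanishing_ideal \<A> S \<or> Q \<in> vanishing_ideal \<A> S"
      by (auto simp: vanishing_ideal_def)
    with f g P Q show False by (auto simp: zero_locus_def)
  qed
qed

text \<open>The intersections of \<open>Z\<close> with the zeros of \<open>P\<close> and with the
  zeros of \<open>Q\<close> cover \<open>Z\<close>, so one of them is all of
  \<open>Z\<close>.\<close>

lemma irreducible_imp_prime:
  fixes \<A> :: "'k::finite \<Rightarrow> (int ^ 'n::finite) set"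
  assumes fin: "\<And>i. finite (\<A> i)" and Z: "irreducible_algebraic_set \<A> Z"
    and P: "polyfun (support_set \<A>) P" and Q: "polyfun (support_set \<A>) Q"
    and PQ: "(\<lambda>c. P c * Q c) \<in> vanishing_ideal \<A> Z"
  shows "P \<in> vanishing_ideal \<A> Z \<or> Q \<in> vanishing_ideal \<A> Z"
proof -
  let ?Z = "\<lambda>P. zero_locus \<A> (insert P (vanishing_ideal \<A> Z))"
  have eq: "Z = zero_locus \<A> (vanishing_ideal \<A> Z)"
    using Z algebraic_set_eq_zero_locus unfolding irreducible_algebraic_set_def by blast
  have "algebraic_set \<A> (?Z P)" "algebraic_set \<A> (?Z Q)"
    by (rule algebraic_set_zero_locus[OF fin]; use P Q in \<open>auto simp: vanishing_ideal_def\<close>)+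
  moreover have "Z = ?Z P \<union> ?Z Q"
    by (subst eq) (use PQ eq in \<open>auto simp: zero_locus_def vanishing_ideal_def\<close>)
  ultimately have "Z = ?Z P \<or> Z = ?Z Q"
    using Z unfolding irreducible_algebraic_set_def by blast
  then show ?thesis using P Q by (auto simp: zero_locus_def vanishing_ideal_def)
qed

lemma irreducible_system_space:
  fixes \<A> :: "'k::finite \<Rightarrow> (int ^ 'n::finite) set"
  assumes fin: "\<And>i. finite (\<A> i)"
  shows "irreducible_algebraic_set \<A> (system_space \<A>)"
proof -
  have 1: "(\<forall>f\<in>system_space \<A>. P (coefficients f) = 0) \<longleftrightarrow> (\<forall>c. P c = 0)"
    if "polyfun (support_set \<A>) P" for P
  proof (intro iffI allI)
    fix c assume "\<forall>f\<in>system_space \<A>. P (coefficients f) = 0"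
    then have "P (coefficients (system_of \<A> c)) = 0" using system_of_in_space[of \<A>] fin by blast
    then show "P c = 0"
      using polyfun_cong[OF that, of "coefficients (system_of \<A> c)" c] coefficients_system_of[of \<A>] fin by simp
  qed auto
  have "irreducible_algebraic_set \<A> (zero_locus \<A> (vanishing_ideal \<A> (system_space \<A>)))"
  proof (rule irreducible_zero_locus[OF fin])
    show "system_space \<A> \<noteq> {}" using system_of_in_space[of \<A>] fin by blast
    fix P Q assume PQ: "polyfun (support_set \<A>) P" "polyfun (support_set \<A>) Q"
      "\<forall>f\<in>system_space \<A>. P (coefficients f) * Q (coefficients f) = 0"
    have "\<forall>c. P c * Q c = 0"
      using 1[of "\<lambda>c. P c * Q c"] PQ by (auto intro: polyfun.mult)
    then show "(\<forall>f\<in>system_space \<A>. P (coefficients f) = 0) \<or> (\<forall>f\<in>system_space \<A>. Q (coefficients f) = 0)"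
      using 1 PQ polyfun_mult_eq_0[OF PQ(1,2)] by blast
  qed auto
  moreover have "zero_locus \<A> (vanishing_ideal \<A> (system_space \<A>)) = system_space \<A>"
    by (auto simp: zero_locus_def vanishing_ideal_def)
  ultimately show ?thesis by simp
qed

section \<open>Degree in one variable, pseudo-division and chains of irreducible sets\<close>

definition vdeg :: "'v set \<Rightarrow> 'v \<Rightarrow> nat \<Rightarrow> (('v \<Rightarrow> complex) \<Rightarrow> complex) \<Rightarrow> bool" where
  "vdeg X v d P \<longleftrightarrow> (\<exists>h. (\<forall>k. polyfun (X - {v}) (h k)) \<and> P = (\<lambda>c. \<Sum>k\<le>d. h k c * c v ^ k))"

lemma vdeg_mono:
  assumes "vdeg X v d P" "d \<le> e"
  shows "vdeg X v e P"
proof -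
  obtain h where h: "\<And>k. polyfun (X - {v}) (h k)" "P = (\<lambda>c. \<Sum>k\<le>d. h k c * c v ^ k)"
    using assms(1) unfolding vdeg_def by blast
  have "(\<Sum>k\<le>e. (if k \<le> d then h k c else 0) * c v ^ k) = (\<Sum>k\<le>d. h k c * c v ^ k)" for c
    by (rule sum.mono_neutral_cong_right) (use assms(2) in auto)
  moreover have "polyfun (X - {v}) (\<lambda>c. if k \<le> d then h k c else 0)" for k
    by (cases "k \<le> d") (auto intro: polyfun_intros h)
  ultimately show ?thesis
    unfolding vdeg_def h(2) by (intro exI[of _ "\<lambda>k c. if k \<le> d then h k c else 0"]) auto
qed

lemma vdeg_0: "polyfun (X - {v}) P \<Longrightarrow> vdeg X v 0 P"
  unfolding vdeg_def by (intro exI[of _ "\<lambda>_. P"]) auto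

lemma vdeg_add:
  assumes "vdeg X v d P" "vdeg X v d Q"
  shows "vdeg X v d (\<lambda>c. P c + Q c)"
proof -
  obtain g h where "\<And>k. polyfun (X - {v}) (g k)" "P = (\<lambda>c. \<Sum>k\<le>d. g k c * c v ^ k)"
    "\<And>k. polyfun (X - {v}) (h k)" "Q = (\<lambda>c. \<Sum>k\<le>d. h k c * c v ^ k)"
    using assms unfolding vdeg_def by blast
  then show ?thesis unfolding vdeg_def
    by (intro exI[of _ "\<lambda>k c. g k c + h k c"]) (auto simp: ring_distribs sum.distrib intro: polyfun.add)
qed

lemma vdeg_sum:
  "(\<And>i. i \<in> I \<Longrightarrow> vdeg X v d (P i)) \<Longrightarrow> vdeg X v d (\<lambda>c. \<Sum>i\<in>I. P i c)"
proof (induction I rule: infinite_finite_induct)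
  case (insert i I)
  then show ?case using vdeg_add[of X v d "P i" "\<lambda>c. \<Sum>i\<in>I. P i c"] by simp
qed (auto intro!: vdeg_mono[OF vdeg_0] polyfun.const)

lemma vdeg_mult_monom:
  assumes "vdeg X v d P" "polyfun (X - {v}) q"
  shows "vdeg X v (d + e) (\<lambda>c. q c * c v ^ e * P c)"
proof -
  obtain h where h: "\<And>k. polyfun (X - {v}) (h k)" "P = (\<lambda>c. \<Sum>k\<le>d. h k c * c v ^ k)"
    using assms(1) unfolding vdeg_def by blast
  let ?h = "\<lambda>k c. if e \<le> k then q c * h (k - e) c else 0"
  have "(\<Sum>k\<le>d + e. ?h k c * c v ^ k) = q c * c v ^ e * P c" for c
  proof -
    have "(\<Sum>k\<le>d + e. ?h k c * c v ^ k) = (\<Sum>k\<in>{0 + e..d + e}. ?h k c * c v ^ k)"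
      by (rule sum.mono_neutral_right) auto
    also have "\<dots> = (\<Sum>k=0..d. ?h (k + e) c * c v ^ (k + e))" by (rule sum.shift_bounds_cl_nat_ivl)
    also have "\<dots> = q c * c v ^ e * P c"
      by (simp add: h(2) sum_distrib_left power_add atMost_atLeast0 mult_ac)
    finally show ?thesis .
  qed
  moreover have "polyfun (X - {v}) (?h k)" for k
    by (cases "e \<le> k") (auto intro: polyfun_intros h assms)
  ultimately show ?thesis unfolding vdeg_def by (intro exI[of _ ?h]) auto
qed

lemma vdeg_mult:
  assumes "vdeg X v d P" "vdeg X v e Q"
  shows "vdeg X v (d + e) (\<lambda>c. P c * Q c)"
proof -
  obtain h where h: "\<And>k. polyfun (X - {v}) (h k)" "Q = (\<lambda>c. \<Sum>k\<le>e. h k c * c v ^ k)"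
    using assms(2) unfolding vdeg_def by blast
  have "vdeg X v (d + e) (\<lambda>c. \<Sum>k\<le>e. h k c * c v ^ k * P c)"
    by (rule vdeg_sum) (auto intro!: vdeg_mono[OF vdeg_mult_monom[OF assms(1) h(1)]])
  moreover have "(\<lambda>c. \<Sum>k\<le>e. h k c * c v ^ k * P c) = (\<lambda>c. P c * Q c)"
    by (simp add: h(2) sum_distrib_left mult_ac)
  ultimately show ?thesis by simp
qed

lemma polyfun_vdeg:
  assumes "polyfun X P" "v \<in> X"
  shows "\<exists>d. vdeg X v d P"
  using assms(1)
proof (induction rule: polyfun.induct)
  case (const k)
  show ?case by (rule exI[of _ 0], rule vdeg_0, rule polyfun.const)
next
  case (var x)
  show ?case
  proof (cases "x = v")
    case True
    have "vdeg X v (0 + 1) (\<lambda>c. 1 * c v ^ 1 * 1)"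
      by (rule vdeg_mult_monom) (auto intro: vdeg_0 polyfun.const)
    with True show ?thesis by auto
  next
    case False
    with var have "polyfun (X - {v}) (\<lambda>c. c x)" by (intro polyfun.var) auto
    then show ?thesis using vdeg_0[of X v "\<lambda>c. c x"] by blast
  qed
next
  case (add P Q)
  then obtain d e where "vdeg X v d P" "vdeg X v e Q" by blast
  then show ?case using vdeg_add vdeg_mono by (metis max.cobounded1 max.cobounded2)
next
  case (mult P Q)
  then obtain d e where "vdeg X v d P" "vdeg X v e Q" by blast
  from vdeg_mult[OF this] show ?case by blast
qed

lemma vdeg_polyfun: "vdeg X v d P \<Longrightarrow> v \<in> X \<Longrightarrow> polyfun X P"
  unfolding vdeg_def by (auto intro!: polyfun_intros intro: polyfun_mono)

lemma vdeg_split_top: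
  assumes "vdeg X v (Suc d) P"
  shows "\<exists>l. polyfun (X - {v}) l \<and> vdeg X v d (\<lambda>c. P c - l c * c v ^ Suc d)"
proof -
  obtain h where h: "\<And>k. polyfun (X - {v}) (h k)" "P = (\<lambda>c. \<Sum>k\<le>Suc d. h k c * c v ^ k)"
    using assms unfolding vdeg_def by blast
  have "(\<lambda>c. P c - h (Suc d) c * c v ^ Suc d) = (\<lambda>c. \<Sum>k\<le>d. h k c * c v ^ k)"
    by (simp add: h(2) fun_eq_iff)
  then have "vdeg X v d (\<lambda>c. P c - h (Suc d) c * c v ^ Suc d)"
    unfolding vdeg_def using h(1) by (intro exI[of _ h]) simp
  then show ?thesis using h(1) by blast
qed

lemma vdeg_uminus: "vdeg X v d P \<Longrightarrow> vdeg X v d (\<lambda>c. - P c)"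
  using vdeg_mult_monom[of X v d P "\<lambda>_. -1" 0] by (simp add: polyfun.const)

text \<open>Instead of dividing by the top coefficient \<open>l\<close> of \<open>H\<close>, each
  round multiplies \<open>G\<close> by it, so that a multiple of \<open>H\<close> cancels the top
  term. The subtraction in the degree bound truncates only where the construction takes
  \<open>s\<close> to be zero.\<close>

lemma pseudo_division:
  assumes "vdeg X v e G" "v \<in> X" "polyfun (X - {v}) l"
    and low: "vdeg X v d (\<lambda>c. H c - l c * c v ^ Suc d)"
  shows "\<exists>k s r. (\<forall>c. l c ^ k * G c = s c * H c + r c) \<and> vdeg X v (e - Suc d) s \<and> vdeg X v d r"
  using assms(1)
proof (induction e arbitrary: G)
  case 0
  then show ?case
    by (intro exI[of _ 0] exI[of _ "\<lambda>_. 0"] exI[of _ G]) (auto intro: vdeg_mono vdeg_0 polyfun.const)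
next
  case (Suc e)
  show ?case
  proof (cases "e < d")
    case True
    with Suc.prems show ?thesis
      by (intro exI[of _ 0] exI[of _ "\<lambda>_. 0"] exI[of _ G]) (auto intro: vdeg_mono vdeg_0 polyfun.const)
  next
    case False
    obtain g where g: "polyfun (X - {v}) g" "vdeg X v e (\<lambda>c. G c - g c * c v ^ Suc e)"
      using vdeg_split_top[OF Suc.prems] by blast
    have e: "Suc e = Suc d + (e - d)" using False by simp
    have "vdeg X v (e + 0) (\<lambda>c. l c * c v ^ 0 * (G c - g c * c v ^ Suc e))"
      by (rule vdeg_mult_monom[OF g(2) assms(3)])
    moreover have "vdeg X v (d + (e - d)) (\<lambda>c. g c * c v ^ (e - d) * (H c - l c * c v ^ Suc d))"
      by (rule vdeg_mult_monom[OF low g(1)])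
    ultimately have "vdeg X v e (\<lambda>c. l c * (G c - g c * c v ^ Suc e)
        + - (g c * c v ^ (e - d) * (H c - l c * c v ^ Suc d)))"
      using False by (intro vdeg_add vdeg_uminus) auto
    also have "(\<lambda>c. l c * (G c - g c * c v ^ Suc e) + - (g c * c v ^ (e - d) * (H c - l c * c v ^ Suc d)))
        = (\<lambda>c. l c * G c - g c * c v ^ (e - d) * H c)"
      unfolding e power_add by (simp add: fun_eq_iff algebra_simps)
    finally obtain k s r where ksr: "\<And>c. l c ^ k * (l c * G c - g c * c v ^ (e - d) * H c) = s c * H c + r c"
      "vdeg X v (e - Suc d) s" "vdeg X v d r"
      using Suc.IH by blast
    have "polyfun (X - {v}) (\<lambda>c. l c ^ k * g c)" by (intro polyfun_intros assms(3) g(1))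
    then have "vdeg X v (0 + (e - d)) (\<lambda>c. (l c ^ k * g c) * c v ^ (e - d) * 1)"
      by (intro vdeg_mult_monom vdeg_0 polyfun.const)
    then have "vdeg X v (Suc e - Suc d) (\<lambda>c. s c + (l c ^ k * g c) * c v ^ (e - d) * 1)"
      using ksr(2) by (intro vdeg_add) (auto intro: vdeg_mono)
    moreover have "l c ^ Suc k * G c = (s c + (l c ^ k * g c) * c v ^ (e - d) * 1) * H c + r c" for c
      using ksr(1)[of c] by (simp add: algebra_simps)
    ultimately show ?thesis using ksr(3)
      by (intro exI[of _ "Suc k"] exI[of _ "\<lambda>c. s c + (l c ^ k * g c) * c v ^ (e - d) * 1"] exI[of _ r]) auto
  qed
qed

lemma ex_min_vdeg:
  assumes "v \<in> X" "P \<in> I" "P \<noteq> (\<lambda>_. 0)" "\<And>P. P \<in> I \<Longrightarrow> polyfun X P"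
  obtains d H where "H \<in> I" "H \<noteq> (\<lambda>_. 0)" "vdeg X v d H"
    "\<And>G e. G \<in> I \<Longrightarrow> G \<noteq> (\<lambda>_. 0) \<Longrightarrow> vdeg X v e G \<Longrightarrow> d \<le> e"
proof -
  define S where "S = {d. \<exists>H\<in>I. H \<noteq> (\<lambda>_. 0) \<and> vdeg X v d H}"
  have "\<exists>d. d \<in> S" using polyfun_vdeg[OF assms(4)[OF assms(2)] assms(1)] assms(2,3) by (auto simp: S_def)
  then have "(LEAST d. d \<in> S) \<in> S" by (rule LeastI_ex)
  moreover have "(LEAST d. d \<in> S) \<le> e" if "e \<in> S" for e using that by (rule Least_le)
  ultimately show ?thesis using that unfolding S_def by blast
qed

text \<open>
  Pseudo-division by an element of the ideal of \<open>D\<close> of minimal degree in \<open>v\<close> shows that the ideals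
  of \<open>D\<close> and \<open>Z\<close> coincide.
\<close>

lemma no_irreducible_strictly_between:
  fixes \<A> :: "'k::finite \<Rightarrow> (int ^ 'n::finite) set"
  assumes fin: "\<And>i. finite (\<A> i)" and v: "v \<in> support_set \<A>"
    and D: "irreducible_algebraic_set \<A> D" and Z: "irreducible_algebraic_set \<A> Z"
    and DZ: "D \<subseteq> Z" and ZV: "Z \<noteq> system_space \<A>"
    and proj: "\<And>P. polyfun (support_set \<A> - {v}) P \<Longrightarrow> P \<in> vanishing_ideal \<A> D \<Longrightarrow> P = (\<lambda>_. 0)"
  shows "D = Z"
proof -
  let ?X = "support_set \<A>" and ?ID = "vanishing_ideal \<A> D" and ?IZ = "vanishing_ideal \<A> Z"
  have sub: "?IZ \<subseteq> ?ID" using DZ by (auto simp: vanishing_ideal_def)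
  have pf: "polyfun ?X P" if "P \<in> ?ID" for P using that by (simp add: vanishing_ideal_def)
  have eqZ: "Z = zero_locus \<A> ?IZ" and eqD: "D = zero_locus \<A> ?ID"
    by (rule algebraic_set_eq_zero_locus; use D Z in \<open>simp add: irreducible_algebraic_set_def\<close>)+
  have "\<exists>P\<in>?IZ. P \<noteq> (\<lambda>_. 0)"
  proof (rule ccontr)
    assume "\<not> ?thesis"
    then have "zero_locus \<A> ?IZ = system_space \<A>" by (auto simp: zero_locus_def)
    with ZV eqZ show False by simp
  qed
  then obtain Q where Q: "Q \<in> ?IZ" "Q \<noteq> (\<lambda>_. 0)" by blast
  obtain d H where H: "H \<in> ?ID" "H \<noteq> (\<lambda>_. 0)" "vdeg ?X v d H"
    and minH: "\<And>G e. G \<in> ?ID \<Longrightarrow> G \<noteq> (\<lambda>_. 0) \<Longrightarrow> vdeg ?X v e G \<Longrightarrow> d \<le> e"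
    by (rule ex_min_vdeg[OF v, of Q ?ID], use Q sub in blast, rule Q(2), erule pf, rule that)
  \<comment> \<open>A nonzero element of degree 0 would omit the variable \<open>v\<close>, which
    \<open>proj\<close> forbids.\<close>
  have "d \<noteq> 0"
  proof
    assume "d = 0"
    then have "polyfun (?X - {v}) H" using H(3) by (auto simp: vdeg_def)
    with proj H show False by blast
  qed
  then obtain d' where d': "d = Suc d'" by (cases d) auto
  obtain l where l: "polyfun (?X - {v}) l" "vdeg ?X v d' (\<lambda>c. H c - l c * c v ^ Suc d')"
    using vdeg_split_top[OF H(3)[unfolded d']] by blast
  have lX: "polyfun ?X l" using polyfun_mono[OF l(1)] by blast
  have l0: "l \<noteq> (\<lambda>_. 0)"
  proof
    assume "l = (\<lambda>_. 0)"
    then have "vdeg ?X v d' H" using l(2) by simp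
    with minH H(1,2) have "d \<le> d'" by blast
    with d' show False by simp
  qed
  then have lID: "l \<notin> ?ID" using proj l(1) by blast
  then have lIZ: "l \<notin> ?IZ" using sub by blast
  \<comment> \<open>For exponent 0 this is the nonemptiness of \<open>Z\<close>; other powers vanish
    only where \<open>l\<close> does.\<close>
  have lpow: "(\<lambda>c. l c ^ k) \<notin> ?IZ" for k
    using lIZ lX Z unfolding irreducible_algebraic_set_def
    by (cases "k = 0") (auto simp: vanishing_ideal_def)
  have div: "\<exists>k s. (\<forall>c. l c ^ k * G c = s c * H c) \<and> vdeg ?X v (e - d) s"
    if G: "G \<in> ?ID" "vdeg ?X v e G" for G e
  proof -
    obtain k s r where ksr: "\<And>c. l c ^ k * G c = s c * H c + r c" "vdeg ?X v (e - d) s" "vdeg ?X v d' r"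
      using pseudo_division[OF G(2) v l] unfolding d' by blast
    have "r = (\<lambda>c. l c ^ k * G c - s c * H c)" using ksr(1) by (simp add: fun_eq_iff)
    moreover have "polyfun ?X r" by (rule vdeg_polyfun[OF ksr(3) v])
    ultimately have "r \<in> ?ID" using G(1) H(1) by (simp add: vanishing_ideal_def)
    \<comment> \<open>The remainder lies in the ideal of \<open>D\<close> and has degree below the
      minimum, so it is zero.\<close>
    with minH ksr(3) d' have "r = (\<lambda>_. 0)" by (metis Suc_n_not_le_n)
    with ksr show ?thesis by auto
  qed
  \<comment> \<open>Pseudo-division by \<open>H\<close> of an element \<open>R\<close> of minimal
    degree in the ideal of \<open>Z\<close> puts \<open>s H\<close> into this prime ideal. As
    \<open>s\<close> has smaller degree than \<open>R\<close>, it is \<open>H\<close> that belongs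
    to the ideal.\<close>
  have HIZ: "H \<in> ?IZ"
  proof -
    obtain e R where R: "R \<in> ?IZ" "R \<noteq> (\<lambda>_. 0)" "vdeg ?X v e R"
      and minR: "\<And>G e'. G \<in> ?IZ \<Longrightarrow> G \<noteq> (\<lambda>_. 0) \<Longrightarrow> vdeg ?X v e' G \<Longrightarrow> e \<le> e'"
      by (rule ex_min_vdeg[OF v, of Q ?IZ], rule Q(1), rule Q(2), rule pf, use sub in blast, rule that)
    obtain k s where ks: "\<And>c. l c ^ k * R c = s c * H c" "vdeg ?X v (e - d) s"
      using div[of R e] R sub by blast
    have sX: "polyfun ?X s" by (rule vdeg_polyfun[OF ks(2) v])
    have "(\<lambda>c. s c * H c) = (\<lambda>c. l c ^ k * R c)" using ks(1) by simp
    also have "\<dots> \<in> ?IZ"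
      using R(1) lX by (auto simp: vanishing_ideal_def intro: polyfun_intros)
    finally have "s \<in> ?IZ \<or> H \<in> ?IZ"
      using irreducible_imp_prime[OF fin Z sX pf[OF H(1)]] by blast
    moreover have "s \<notin> ?IZ"
    proof
      assume s: "s \<in> ?IZ"
      have "s \<noteq> (\<lambda>_. 0)"
      proof
        assume "s = (\<lambda>_. 0)"
        then have "l c ^ k * R c = 0" for c using ks(1)[of c] by simp
        moreover obtain c\<^sub>1 where "l c\<^sub>1 \<noteq> 0" using l0 by auto
        ultimately have "R c = 0" for c
          using polyfun_mult_eq_0[of ?X "\<lambda>c. l c ^ k" R c\<^sub>1 c] lX pf R(1) sub
          by (auto intro: polyfun_intros)
        with R(2) show False by auto
      qed
      with s minR ks(2) have "e \<le> e - d" by blast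
      moreover have "d \<le> e" using minH R sub by blast
      ultimately show False using \<open>d \<noteq> 0\<close> by simp
    qed
    ultimately show ?thesis by blast
  qed
  have "?ID \<subseteq> ?IZ"
  proof
    fix G assume G: "G \<in> ?ID"
    obtain e where "vdeg ?X v e G" using polyfun_vdeg[OF pf[OF G] v] by blast
    then obtain k s where ks: "\<And>c. l c ^ k * G c = s c * H c" "vdeg ?X v (e - d) s"
      using div[OF G] by blast
    have "polyfun ?X s" by (rule vdeg_polyfun[OF ks(2) v])
    then have "(\<lambda>c. s c * H c) \<in> ?IZ"
      using HIZ by (auto simp: vanishing_ideal_def intro: polyfun_intros)
    then have "(\<lambda>c. l c ^ k * G c) \<in> ?IZ" using ks(1) by simp
    then show "G \<in> ?IZ"
      using irreducible_imp_prime[OF fin Z polyfun_power[OF lX] pf[OF G]] lpow by blast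
  qed
  with sub eqD eqZ show ?thesis by simp
qed

text \<open>Hypothesis \<open>proj\<close> says that forgetting the coordinate \<open>v\<close> maps
  \<open>S\<close> densely to the remaining coordinate space, which excludes irreducible sets
  strictly between the closure and the whole space. \<open>P\<^sub>0\<close> separates these two, so
  together they form a longest chain.\<close>

lemma hypersurface_criterion:
  fixes \<A> :: "'k::finite \<Rightarrow> (int ^ 'n::finite) set"
  assumes fin: "\<And>i. finite (\<A> i)" and S: "S \<subseteq> system_space \<A>" "S \<noteq> {}"
    and prime: "\<And>P Q. polyfun (support_set \<A>) P \<Longrightarrow> polyfun (support_set \<A>) Q \<Longrightarrow>
      (\<forall>f\<in>S. P (coefficients f) * Q (coefficients f) = 0) \<Longrightarrow>
      (\<forall>f\<in>S. P (coefficients f) = 0) \<or> (\<forall>f\<in>S. Q (coefficients f) = 0)"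
    and proper: "polyfun (support_set \<A>) P\<^sub>0" "P\<^sub>0 c\<^sub>0 \<noteq> 0" "\<And>f. f \<in> S \<Longrightarrow> P\<^sub>0 (coefficients f) = 0"
    and v: "v \<in> support_set \<A>"
    and proj: "\<And>P c. polyfun (support_set \<A> - {v}) P \<Longrightarrow> (\<forall>f\<in>S. P (coefficients f) = 0) \<Longrightarrow> P c = 0"
  shows "hypersurface \<A> (zariski_closure \<A> S)"
proof -
  define D where "D = zero_locus \<A> (vanishing_ideal \<A> S)"
  have D: "irreducible_algebraic_set \<A> D"
    unfolding D_def by (rule irreducible_zero_locus[OF fin S prime])
  have V: "irreducible_algebraic_set \<A> (system_space \<A>)" by (rule irreducible_system_space[OF fin])
  have ID: "vanishing_ideal \<A> D = vanishing_ideal \<A> S"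
    unfolding D_def by (rule vanishing_ideal_zero_locus[OF S(1)])
  have "system_of \<A> c\<^sub>0 \<notin> D"
  proof
    assume "system_of \<A> c\<^sub>0 \<in> D"
    moreover have "P\<^sub>0 \<in> vanishing_ideal \<A> S" using proper by (simp add: vanishing_ideal_def)
    ultimately have "P\<^sub>0 (coefficients (system_of \<A> c\<^sub>0)) = 0" by (auto simp: D_def zero_locus_def)
    moreover have "P\<^sub>0 (coefficients (system_of \<A> c\<^sub>0)) = P\<^sub>0 c\<^sub>0"
      by (rule polyfun_cong[OF proper(1)]) (use fin in \<open>auto intro: coefficients_system_of\<close>)
    ultimately show False using proper(2) by simp
  qed
  then have DV: "D \<subset> system_space \<A>"
    using system_of_in_space[of \<A> c\<^sub>0] fin by (auto simp: D_def zero_locus_def)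
  have sub: "Z \<subseteq> system_space \<A>" if "irreducible_algebraic_set \<A> Z" for Z
    using that by (auto simp: irreducible_algebraic_set_def algebraic_set_def)
  have proj': "P = (\<lambda>_. 0)" if "polyfun (support_set \<A> - {v}) P" "P \<in> vanishing_ideal \<A> D" for P
    using proj[OF that(1)] that(2) unfolding ID by (auto simp: vanishing_ideal_def)
  have "codimension \<A> D = 1"
    unfolding codimension_def
  proof (rule antisym)
    show "Sup {enat l |l. \<exists>C. C 0 = D \<and> (\<forall>j\<le>l. irreducible_algebraic_set \<A> (C j)) \<and>
        (\<forall>j<l. C j \<subset> C (Suc j))} \<le> 1"
    proof (rule Sup_least, clarify)
      fix l C assume C: "\<forall>j\<le>l. irreducible_algebraic_set \<A> (C j)" "\<forall>j<l. C j \<subset> C (Suc j)" "D = C (0::nat)"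
      have "\<not> 2 \<le> l"
      proof
        assume l: "2 \<le> l"
        have *: "C 0 \<subset> C 1" "C 1 \<subset> C 2" using C(2) l by (auto simp: numeral_2_eq_2)
        moreover have "irreducible_algebraic_set \<A> (C 1)" "irreducible_algebraic_set \<A> (C 2)"
          using C(1) l by auto
        ultimately have "D = C 1"
          using no_irreducible_strictly_between[OF fin v D, of "C 1"] proj' sub[of "C 2"] C(3) by blast
        with * C(3) show False by simp
      qed
      then show "enat l \<le> 1" by (simp add: one_enat_def)
    qed
    have "\<exists>C. C 0 = D \<and> (\<forall>j\<le>1. irreducible_algebraic_set \<A> (C j)) \<and> (\<forall>j<1. C j \<subset> C (Suc j))"
      by (rule exI[of _ "\<lambda>j::nat. if j = 0 then D else system_space \<A>"]) (use D V DV in auto)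
    then show "1 \<le> Sup {enat l |l. \<exists>C. C 0 = D \<and> (\<forall>j\<le>l. irreducible_algebraic_set \<A> (C j)) \<and>
        (\<forall>j<l. C j \<subset> C (Suc j))}"
      unfolding one_enat_def by (intro Sup_upper) blast
  qed
  then show ?thesis
    using D zariski_closure_eq[OF fin S(1)] by (simp add: hypersurface_def D_def)
qed

section \<open>Degenerate roots\<close>

text \<open>The logarithmic derivative of the monomial with exponent \<open>a\<close> in direction
  \<open>u\<close>, that is, the complex bilinear duality between characters and the Lie algebra of
  the torus.\<close>

definition pairing :: "int ^ 'n \<Rightarrow> complex ^ 'n::finite \<Rightarrow> complex" where
  "pairing a u = (\<Sum>j\<in>UNIV. of_int (a $ j) * u $ j)"

definition monomial :: "complex ^ 'n::finite \<Rightarrow> int ^ 'n \<Rightarrow> complex" where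
  "monomial x a = (\<Prod>j\<in>UNIV. (x $ j) powi (a $ j))"

lemma pairing_add_left: "pairing (a + b) u = pairing a u + pairing b u"
  by (simp add: pairing_def ring_distribs sum.distrib)

lemma pairing_diff_left: "pairing (a - b) u = pairing a u - pairing b u"
  by (simp add: pairing_def ring_distribs sum_subtractf)

lemma pairing_add: "pairing a (u + v) = pairing a u + pairing a v"
  by (simp add: pairing_def ring_distribs sum.distrib)

lemma pairing_diff: "pairing a (u - v) = pairing a u - pairing a v"
  by (simp add: pairing_def ring_distribs sum_subtractf)

lemma pairing_scale: "pairing a (k *s u) = k * pairing a u"
  by (simp add: pairing_def sum_distrib_left mult_ac)

lemma pairing_sum: "pairing a (\<Sum>i\<in>I. f i) = (\<Sum>i\<in>I. pairing a (f i))"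
  unfolding pairing_def by (subst sum.swap) (simp add: sum_component sum_distrib_left)

lemma pairing_0 [simp]: "pairing 0 u = 0" "pairing a 0 = 0"
  by (simp_all add: pairing_def)

lemma laurent_eval_alt:
  assumes "finite A" "Poly_Mapping.keys f \<subseteq> A"
  shows "laurent_eval f x = (\<Sum>a\<in>A. Poly_Mapping.lookup f a * monomial x a)"
  unfolding laurent_eval_def monomial_def
  by (rule sum.mono_neutral_left) (use assms in \<open>auto simp: in_keys_iff\<close>)

lemma monomial_has_derivative:
  assumes "x \<in> torus"
  shows "((\<lambda>x. monomial x a) has_derivative (\<lambda>\<xi>. monomial x a * pairing a (\<chi> j. \<xi> $ j / x $ j))) (at x)"
proof -
  have x: "x $ j \<noteq> 0" for j using assms by (simp add: torus_def)
  have "((\<lambda>x. \<Prod>j\<in>UNIV. (x $ j) powi (a $ j)) has_derivative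
      (\<lambda>\<xi>. \<Sum>j\<in>UNIV. (\<xi> $ j * (of_int (a $ j) * (x $ j) powi (a $ j - 1))) *
            (\<Prod>l\<in>UNIV - {j}. (x $ l) powi (a $ l)))) (at x)"
    by (rule has_derivative_prod, rule has_derivative_power_int[where f = "\<lambda>x. x $ _"], rule x)
      (rule bounded_linear.has_derivative[OF bounded_linear_vec_nth has_derivative_ident])
  moreover have "(\<xi> $ j * (of_int (a $ j) * (x $ j) powi (a $ j - 1))) * (\<Prod>l\<in>UNIV - {j}. (x $ l) powi (a $ l))
      = monomial x a * (of_int (a $ j) * (\<xi> $ j / x $ j))" for \<xi> j
  proof -
    have "monomial x a = (x $ j) powi (a $ j) * (\<Prod>l\<in>UNIV - {j}. (x $ l) powi (a $ l))"
      unfolding monomial_def by (rule prod.remove) auto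
    then show ?thesis using x[of j] by (simp add: power_int_diff)
  qed
  ultimately show ?thesis
    by (simp add: monomial_def pairing_def sum_distrib_left)
qed

lemma laurent_eval_has_derivative:
  assumes "finite A" "Poly_Mapping.keys f \<subseteq> A" "x \<in> torus"
  shows "(laurent_eval f has_derivative
     (\<lambda>\<xi>. \<Sum>a\<in>A. Poly_Mapping.lookup f a * (monomial x a * pairing a (\<chi> j. \<xi> $ j / x $ j)))) (at x)"
proof -
  have "((\<lambda>x. \<Sum>a\<in>A. Poly_Mapping.lookup f a * monomial x a) has_derivative
     (\<lambda>\<xi>. \<Sum>a\<in>A. Poly_Mapping.lookup f a * (monomial x a * pairing a (\<chi> j. \<xi> $ j / x $ j)))) (at x)"
    by (intro has_derivative_sum has_derivative_mult_right monomial_has_derivative assms)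
  moreover have "laurent_eval f = (\<lambda>x. \<Sum>a\<in>A. Poly_Mapping.lookup f a * monomial x a)"
    using laurent_eval_alt[OF assms(1,2)] by blast
  ultimately show ?thesis by simp
qed

text \<open>Rows and columns are indexed by different types of equal size, so invertibility is
  expressed by dimensions rather than by a determinant.\<close>

lemma inj_iff_surj_CARD:
  fixes W :: "complex ^ 'n::finite ^ 'k::finite"
  assumes "CARD('k) = CARD('n)"
  shows "(\<forall>u. W *v u = 0 \<longrightarrow> u = 0) \<longleftrightarrow> surj ((*v) W)"
proof -
  have "(\<forall>u. W *v u = 0 \<longrightarrow> u = 0) \<longleftrightarrow> inj ((*v) W)"
  proof
    assume *: "\<forall>u. W *v u = 0 \<longrightarrow> u = 0"
    show "inj ((*v) W)"
    proof (rule injI)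
      fix x y assume "W *v x = W *v y"
      then have "W *v (x - y) = 0" by (simp add: matrix_vector_mult_diff_distrib)
      with * have "x - y = 0" by blast
      then show "x = y" by simp
    qed
  next
    assume "inj ((*v) W)"
    then show "\<forall>u. W *v u = 0 \<longrightarrow> u = 0"
      using matrix_vector_mult_0_right[of W] by (metis injD)
  qed
  moreover have "vec.dim (UNIV :: (complex ^ 'k) set) = vec.dim (UNIV :: (complex ^ 'n) set)"
    using assms by (simp add: vec_dim_card del: vec.dim_UNIV)
  ultimately show ?thesis
    using vec.linear_injective_imp_surjective[OF matrix_vector_mul_linear_gen, of W]
      vec.linear_surjective_imp_injective[OF matrix_vector_mul_linear_gen, of W] by auto
qed

text \<open>If \<open>W\<close> is injective, hence onto, the wedge takes the value 1 on preimages
  of the unit vectors. Conversely, if \<open>W V\<close> were invertible for some \<open>V\<close>,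
  then \<open>V\<close> would be onto and reach the kernel vector \<open>u\<close>, a
  contradiction.\<close>

lemma wedge_eq_0_iff:
  fixes W :: "complex ^ 'n::finite ^ 'k::finite"
  assumes "CARD('k) = CARD('n)"
  shows "wedge (\<lambda>i \<xi>. (W *v \<xi>) $ i) = (\<lambda>_. 0) \<longleftrightarrow> (\<exists>u. u \<noteq> 0 \<and> W *v u = 0)"
proof
  assume w: "wedge (\<lambda>i \<xi>. (W *v \<xi>) $ i) = (\<lambda>_. 0)"
  show "\<exists>u. u \<noteq> 0 \<and> W *v u = 0"
  proof (rule ccontr)
    assume "\<not> ?thesis"
    then have "surj ((*v) W)" using inj_iff_surj_CARD[OF assms] by blast
    then have "\<exists>v. W *v v = axis j 1" for j by (metis surjD)
    then obtain v where v: "\<And>j. W *v v j = axis j 1" by metis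
    have "(\<chi> i j. (W *v v j) $ i) = mat 1"
      by (simp add: v vec_eq_iff axis_def mat_def)
    then have "wedge (\<lambda>i \<xi>. (W *v \<xi>) $ i) v = 1" by (simp add: wedge_def)
    with w show False by simp
  qed
next
  assume "\<exists>u. u \<noteq> 0 \<and> W *v u = 0"
  then obtain u where u: "u \<noteq> 0" "W *v u = 0" by blast
  show "wedge (\<lambda>i \<xi>. (W *v \<xi>) $ i) = (\<lambda>_. 0)"
  proof
    fix v :: "'k \<Rightarrow> complex ^ 'n"
    define V :: "complex ^ 'k ^ 'n" where "V = (\<chi> l j. v j $ l)"
    have WV: "(\<chi> i j. (W *v v j) $ i) = W ** V"
      by (simp add: V_def vec_eq_iff matrix_vector_mult_def matrix_matrix_mult_def)
    have "det (W ** V) = 0"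
    proof (rule ccontr)
      assume "det (W ** V) \<noteq> 0"
      then have "invertible (W ** V)" by (simp add: invertible_det_nz)
      then have inj: "(W ** V) *v y = 0 \<Longrightarrow> y = 0" for y
        by (metis invertible_left_inverse matrix_left_invertible_ker)
      then have "\<forall>y. V *v y = 0 \<longrightarrow> y = 0"
        by (metis matrix_vector_mul_assoc matrix_vector_mult_0_right)
      then have "surj ((*v) V)" using inj_iff_surj_CARD[of V] assms by simp
      then obtain y where y: "u = V *v y" by (metis surjD)
      with u(2) have "(W ** V) *v y = 0" by (simp add: matrix_vector_mul_assoc)
      with inj have "y = 0" by blast
      with y u(1) show False by simp
    qed
    then show "wedge (\<lambda>i \<xi>. (W *v \<xi>) $ i) v = 0" by (simp add: wedge_def WV)
  qed
qed

text \<open>On the torus the substitution \<open>u $ j = \<xi> $ j / x $ j\<close> is invertible and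
  turns the Jacobian into the logarithmic one.\<close>

lemma degenerate_root_iff:
  fixes \<A> :: "'k::finite \<Rightarrow> (int ^ 'n::finite) set"
  assumes "CARD('k) = CARD('n)" and fin: "\<And>i. finite (\<A> i)" and f: "f \<in> system_space \<A>"
  shows "degenerate_root f x \<longleftrightarrow> x \<in> torus \<and>
    (\<forall>i. (\<Sum>a\<in>\<A> i. coefficients f (i, a) * monomial x a) = 0) \<and>
    (\<exists>u. u \<noteq> 0 \<and> (\<forall>i. (\<Sum>a\<in>\<A> i. coefficients f (i, a) * monomial x a * pairing a u) = 0))"
proof (cases "x \<in> torus")
  case True
  then have x: "x $ j \<noteq> 0" for j by (simp add: torus_def)
  have keys: "Poly_Mapping.keys (f i) \<subseteq> \<A> i" for i using f by (simp add: system_space_def)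
  define W :: "complex ^ 'n ^ 'k" where
    "W = (\<chi> i j. \<Sum>a\<in>\<A> i. coefficients f (i, a) * monomial x a * of_int (a $ j) / x $ j)"
  have W: "(W *v \<xi>) $ i = (\<Sum>a\<in>\<A> i. coefficients f (i, a) * monomial x a * pairing a (\<chi> j. \<xi> $ j / x $ j))" for i \<xi>
    unfolding W_def pairing_def matrix_vector_mult_def
    by (simp add: sum_distrib_left sum_distrib_right mult_ac) (rule sum.swap)
  have "frechet_derivative (laurent_eval (f i)) (at x) = (\<lambda>\<xi>. (W *v \<xi>) $ i)" for i
    using frechet_derivative_at[OF laurent_eval_has_derivative[OF fin keys True]]
    by (simp add: W coefficients_def mult_ac)
  then have "wedge (\<lambda>i. frechet_derivative (laurent_eval (f i)) (at x)) = (\<lambda>_. 0) \<longleftrightarrow>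
      (\<exists>\<xi>. \<xi> \<noteq> 0 \<and> W *v \<xi> = 0)"
    using wedge_eq_0_iff[OF assms(1), of W] by simp
  also have "\<dots> \<longleftrightarrow> (\<exists>u. u \<noteq> 0 \<and> (\<forall>i. (\<Sum>a\<in>\<A> i. coefficients f (i, a) * monomial x a * pairing a u) = 0))"
  proof
    assume "\<exists>\<xi>. \<xi> \<noteq> 0 \<and> W *v \<xi> = 0"
    then obtain \<xi> where \<xi>: "\<xi> \<noteq> 0" "W *v \<xi> = 0" by blast
    then obtain j where "\<xi> $ j \<noteq> 0" by (auto simp: vec_eq_iff)
    then have "(\<chi> j. \<xi> $ j / x $ j) \<noteq> 0" using x by (auto simp: vec_eq_iff)
    moreover have "(\<Sum>a\<in>\<A> i. coefficients f (i, a) * monomial x a * pairing a (\<chi> j. \<xi> $ j / x $ j)) = 0" for i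
      using \<xi>(2) W[of \<xi> i] by simp
    ultimately show "\<exists>u. u \<noteq> 0 \<and> (\<forall>i. (\<Sum>a\<in>\<A> i. coefficients f (i, a) * monomial x a * pairing a u) = 0)"
      by blast
  next
    assume "\<exists>u. u \<noteq> 0 \<and> (\<forall>i. (\<Sum>a\<in>\<A> i. coefficients f (i, a) * monomial x a * pairing a u) = 0)"
    then obtain u where u: "u \<noteq> 0" "\<And>i. (\<Sum>a\<in>\<A> i. coefficients f (i, a) * monomial x a * pairing a u) = 0" by blast
    have "(\<chi> j. (\<chi> j. u $ j * x $ j) $ j / x $ j) = u" using x by (simp add: vec_eq_iff)
    then have "W *v (\<chi> j. u $ j * x $ j) = 0"
      using u(2) W[of "\<chi> j. u $ j * x $ j"] by (simp add: vec_eq_iff)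
    moreover obtain j where "u $ j \<noteq> 0" using u(1) by (auto simp: vec_eq_iff)
    then have "(\<chi> j. u $ j * x $ j) \<noteq> 0" using x by (auto simp: vec_eq_iff)
    ultimately show "\<exists>\<xi>. \<xi> \<noteq> 0 \<and> W *v \<xi> = 0" by blast
  qed
  finally show ?thesis
    unfolding degenerate_root_def using laurent_eval_alt[OF fin keys, of _ x] True
    by (simp add: coefficients_def)
qed (simp add: degenerate_root_def)

text \<open>The vector \<open>u\<close> lies in the kernel of the logarithmic Jacobian matrix.\<close>

definition degenerate_coeffs ::
    "('k \<Rightarrow> (int ^ 'n::finite) set) \<Rightarrow> ('k \<times> (int ^ 'n) \<Rightarrow> complex) \<Rightarrow> bool" where
  "degenerate_coeffs \<A> c \<longleftrightarrow> (\<exists>x\<in>torus. (\<forall>i. (\<Sum>a\<in>\<A> i. c (i, a) * monomial x a) = 0) \<and>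
     (\<exists>u. u \<noteq> 0 \<and> (\<forall>i. (\<Sum>a\<in>\<A> i. c (i, a) * monomial x a * pairing a u) = 0)))"

text \<open>Passes from systems to arbitrary coefficient functions; their values off the support are
  invisible to polynomials over \<open>X\<close>.\<close>

lemma vanishes_on_degenerate_iff:
  fixes \<A> :: "'k::finite \<Rightarrow> (int ^ 'n::finite) set"
  assumes "CARD('k) = CARD('n)" and fin: "\<And>i. finite (\<A> i)" and P: "polyfun X P" "X \<subseteq> support_set \<A>"
  shows "(\<forall>f\<in>{f \<in> system_space \<A>. \<exists>x. degenerate_root f x}. P (coefficients f) = 0) \<longleftrightarrow>
         (\<forall>c. degenerate_coeffs \<A> c \<longrightarrow> P c = 0)"
proof
  assume *: "\<forall>f\<in>{f \<in> system_space \<A>. \<exists>x. degenerate_root f x}. P (coefficients f) = 0"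
  show "\<forall>c. degenerate_coeffs \<A> c \<longrightarrow> P c = 0"
  proof (intro allI impI)
    fix c assume c: "degenerate_coeffs \<A> c"
    let ?f = "system_of \<A> c"
    have V: "?f \<in> system_space \<A>" using system_of_in_space[of \<A>] fin by blast
    have cf: "coefficients ?f v = c v" if "v \<in> support_set \<A>" for v
      using coefficients_system_of[of \<A>] fin that by blast
    have "\<exists>x. degenerate_root ?f x"
      using c unfolding degenerate_root_iff[OF assms(1) fin V] degenerate_coeffs_def by (simp add: cf Bex_def)
    then have "P (coefficients ?f) = 0" using * V by blast
    then show "P c = 0" using polyfun_cong[OF P(1), of "coefficients ?f" c] cf P(2) by auto
  qed
next
  assume "\<forall>c. degenerate_coeffs \<A> c \<longrightarrow> P c = 0"
  then show "\<forall>f\<in>{f \<in> system_space \<A>. \<exists>x. degenerate_root f x}. P (coefficients f) = 0"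
    using degenerate_root_iff[of \<A>, OF assms(1) fin] unfolding degenerate_coeffs_def by blast
qed

section \<open>Systems with a degenerate root at the unit of the torus\<close>

text \<open>
  The invariance under translation by \<open>w\<close> encodes that \<open>B\<close> has codimension at least two; it is void
  for \<open>w = 0\<close>.
\<close>

definition thin :: "'v set \<Rightarrow> ('v \<Rightarrow> complex) \<Rightarrow> ('v \<Rightarrow> complex) set \<Rightarrow> bool" where
  "thin Y w B \<longleftrightarrow> (\<exists>P. polyfun Y P \<and> (\<exists>c. P c \<noteq> 0) \<and> (\<forall>c\<in>B. P c = 0) \<and>
     (\<forall>c t. P (\<lambda>y. c y + t * w y) = P c))"

lemma thin_subset: "thin Y w B \<Longrightarrow> B' \<subseteq> B \<Longrightarrow> thin Y w B'"
  unfolding thin_def by (elim exE, rule_tac x = P in exI) blast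

lemma thin_UN:
  assumes "finite F" "\<And>i. i \<in> F \<Longrightarrow> thin Y w (B i)"
  shows "thin Y w (\<Union>i\<in>F. B i)"
proof -
  have "\<forall>i\<in>F. \<exists>P. polyfun Y P \<and> (\<exists>c. P c \<noteq> 0) \<and> (\<forall>c\<in>B i. P c = 0) \<and>
     (\<forall>c t. P (\<lambda>y. c y + t * w y) = P c)"
    using assms(2) by (simp add: thin_def)
  then obtain P where "\<forall>i\<in>F. polyfun Y (P i) \<and> (\<exists>c. P i c \<noteq> 0) \<and> (\<forall>c\<in>B i. P i c = 0) \<and>
     (\<forall>c t. P i (\<lambda>y. c y + t * w y) = P i c)"
    by (rule bchoice[THEN exE])
  then have P: "\<And>i. i \<in> F \<Longrightarrow> polyfun Y (P i)" "\<And>i. i \<in> F \<Longrightarrow> \<exists>c. P i c \<noteq> 0"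
    "\<And>i c. i \<in> F \<Longrightarrow> c \<in> B i \<Longrightarrow> P i c = 0"
    "\<And>i c t. i \<in> F \<Longrightarrow> P i (\<lambda>y. c y + t * w y) = P i c"
    by blast+
  have "polyfun Y (\<lambda>c. \<Prod>i\<in>F. P i c)" by (intro polyfun_prod P)
  moreover have "\<exists>c. (\<Prod>i\<in>F. P i c) \<noteq> 0"
    by (rule polyfun_prod_nonzero[OF assms(1)]) (use P in auto)
  moreover have "(\<Prod>i\<in>F. P i c) = 0" if "c \<in> (\<Union>i\<in>F. B i)" for c
    using that P(3) assms(1) by auto
  moreover have "(\<Prod>i\<in>F. P i (\<lambda>y. c y + t * w y)) = (\<Prod>i\<in>F. P i c)" for c t
    by (rule prod.cong) (use P(4) in auto)
  ultimately show ?thesis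
    unfolding thin_def by (intro exI[of _ "\<lambda>c. \<Prod>i\<in>F. P i c"]) auto
qed

lemma thin_image:
  assumes "finite X" "finite Y" "\<And>y. y \<in> Y \<Longrightarrow> polyfun X (g y)"
    "card X + 1 < card Y \<or> card X < card Y \<and> w = (\<lambda>_. 0)"
  shows "thin Y w {c. \<exists>z. \<forall>y\<in>Y. c y = g y z}"
proof -
  have "\<exists>P. polyfun Y P \<and> (\<exists>c. P c \<noteq> 0) \<and> (\<forall>z. P (\<lambda>y. g y z) = 0) \<and>
             (\<forall>c t. P (\<lambda>y. c y + t * w y) = P c)"
    using assms(4)
  proof
    assume "card X + 1 < card Y"
    then show ?thesis by (rule polynomial_map_not_dominant_mod_line[OF assms(1,2) _ assms(3)])
  next
    assume "card X < card Y \<and> w = (\<lambda>_. 0)"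
    then have w: "w = (\<lambda>_. 0)" and less: "card X < card Y" by simp_all
    obtain P where "polyfun Y P \<and> (\<exists>c. P c \<noteq> 0) \<and> (\<forall>z. P (\<lambda>y. g y z) = 0)"
      using polynomial_map_not_dominant[OF assms(1,2) less assms(3)] ..
    then show ?thesis by (intro exI[of _ P]) (simp add: w)
  qed
  then obtain P where "polyfun Y P \<and> (\<exists>c. P c \<noteq> 0) \<and> (\<forall>z. P (\<lambda>y. g y z) = 0) \<and>
             (\<forall>c t. P (\<lambda>y. c y + t * w y) = P c)" ..
  then have P: "polyfun Y P" "\<exists>c. P c \<noteq> 0" "\<And>z. P (\<lambda>y. g y z) = 0" "\<forall>c t. P (\<lambda>y. c y + t * w y) = P c"
    by simp_all
  have "P c = 0" if "\<forall>y\<in>Y. c y = g y z" for c z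
    using polyfun_cong[OF P(1), of c "\<lambda>y. g y z"] that P(3)[of z] by simp
  then have "\<forall>c\<in>{c. \<exists>z. \<forall>y\<in>Y. c y = g y z}. P c = 0" by blast
  with P(1,2,4) show ?thesis unfolding thin_def by (intro exI[of _ P] conjI)
qed

section \<open>Real ranks and complex kernel vectors\<close>

definition rvec :: "int ^ 'n \<Rightarrow> real ^ 'n::finite" where
  "rvec a = (\<chi> j. real_of_int (a $ j))"

lemma lattice_rank_rvec: "lattice_rank L = dim (rvec ` L)"
  by (simp add: lattice_rank_def rvec_def[abs_def])

text \<open>Ranks are dimensions over the reals while kernel vectors are complex, hence a pairing
  between real and complex vectors.\<close>

definition rpairing :: "real ^ 'n \<Rightarrow> complex ^ 'n::finite \<Rightarrow> complex" where
  "rpairing t u = (\<Sum>j\<in>UNIV. of_real (t $ j) * u $ j)"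

lemma pairing_eq_rpairing: "pairing a u = rpairing (rvec a) u"
  by (simp add: pairing_def rpairing_def rvec_def)

lemma rvec_diff: "rvec (a - b) = rvec a - rvec b"
  by (simp add: rvec_def vec_eq_iff)

lemma rvec_0 [simp]: "rvec 0 = 0"
  by (simp add: rvec_def vec_eq_iff)

lemma rvec_eq_0_iff [simp]: "rvec a = 0 \<longleftrightarrow> a = 0"
  by (simp add: rvec_def vec_eq_iff)

lemma rpairing_sum_scaleR: "rpairing (\<Sum>b\<in>B. m b *\<^sub>R f b) u = (\<Sum>b\<in>B. of_real (m b) * rpairing (f b) u)"
  unfolding rpairing_def
  by (simp add: sum_component sum_distrib_left sum_distrib_right mult.assoc) (rule sum.swap)

text \<open>Real vectors independent over the reals stay independent over \<complex>: real and
  imaginary parts of a relation are again relations.\<close>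

lemma independent_rpairing:
  assumes "finite B" "inj_on f B" "independent (f ` B)"
    "\<And>u. (\<Sum>b\<in>B. z b * rpairing (f b) u) = 0" "b \<in> B"
  shows "z b = 0"
proof -
  have "(\<Sum>b\<in>B. z b * of_real (f b $ j)) = 0" for j
    using assms(4)[of "axis j 1"] by (simp add: rpairing_def axis_def if_distrib cong: if_cong)
  then have j: "(\<Sum>b\<in>B. Re (z b) * (f b $ j)) = 0" "(\<Sum>b\<in>B. Im (z b) * (f b $ j)) = 0" for j
    by (auto simp: complex_eq_iff)
  then have *: "(\<Sum>b\<in>B. Re (z b) *\<^sub>R f b) = 0" "(\<Sum>b\<in>B. Im (z b) *\<^sub>R f b) = 0"
    by (simp_all add: vec_eq_iff sum_component)
  have **: "q b = 0" if "(\<Sum>b\<in>B. q b *\<^sub>R f b) = 0" for q :: "_ \<Rightarrow> real"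
  proof -
    have "(\<Sum>v\<in>f ` B. q (the_inv_into B f v) *\<^sub>R v) = (\<Sum>b\<in>B. q b *\<^sub>R f b)"
      by (simp add: sum.reindex[OF assms(2)] the_inv_into_f_f[OF assms(2)])
    then have "q (the_inv_into B f (f b)) = 0"
      using independentD[OF assms(3), of "f ` B" "\<lambda>v. q (the_inv_into B f v)" "f b"] that assms(1,5) by simp
    then show ?thesis using assms(2,5) by (simp add: the_inv_into_f_f)
  qed
  show ?thesis using **[OF *(1)] **[OF *(2)] by (simp add: complex_eq_iff)
qed

text \<open>Real and imaginary parts of an annihilating vector are orthogonal to \<open>T\<close>,
  so a real basis of the orthogonal complement generates the complex annihilator.\<close>

lemma annihilator_basis:
  fixes T :: "(real ^ 'n::finite) set"
  shows "\<exists>\<beta>. finite \<beta> \<and> card \<beta> + dim T = CARD('n) \<and>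
    (\<forall>u. (\<forall>t\<in>T. rpairing t u = 0) \<longrightarrow> (\<exists>\<kappa>. u = (\<chi> j. \<Sum>b\<in>\<beta>. \<kappa> b * of_real (b $ j))))"
proof -
  let ?N = "{y \<in> UNIV. \<forall>x\<in>span T. orthogonal x y}"
  have dim: "dim ?N + dim (span T) = dim (UNIV :: (real ^ 'n) set)"
    by (rule dim_subspace_orthogonal_to_vectors) auto
  obtain \<beta> where \<beta>: "\<beta> \<subseteq> ?N" "independent \<beta>" "?N \<subseteq> span \<beta>" "card \<beta> = dim ?N"
    using basis_exists by blast
  have fin: "finite \<beta>" using \<beta>(2) by (rule independent_imp_finite)
  have "\<exists>\<kappa>. u = (\<chi> j. \<Sum>b\<in>\<beta>. \<kappa> b * of_real (b $ j))" if u: "\<forall>t\<in>T. rpairing t u = 0" for u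
  proof -
    define p q :: "real ^ 'n" where "p = (\<chi> j. Re (u $ j))" and "q = (\<chi> j. Im (u $ j))"
    have "t \<bullet> p = 0 \<and> t \<bullet> q = 0" if "t \<in> T" for t
      using u that by (auto simp: rpairing_def complex_eq_iff inner_vec_def p_def q_def)
    then have pq: "orthogonal p t" "orthogonal q t" if "t \<in> T" for t
      using that by (auto simp: orthogonal_def inner_commute[of _ t])
    have "p \<in> ?N" "q \<in> ?N"
      using orthogonal_to_span[of _ T p] orthogonal_to_span[of _ T q] pq by (auto simp: orthogonal_commute)
    then have "p \<in> span \<beta>" "q \<in> span \<beta>" using \<beta>(3) by blast+
    then obtain m m' where "p = (\<Sum>b\<in>\<beta>. m b *\<^sub>R b)" "q = (\<Sum>b\<in>\<beta>. m' b *\<^sub>R b)"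
      using fin by (auto simp: span_finite)
    then have "Re (u $ j) = (\<Sum>b\<in>\<beta>. m b * b $ j)" "Im (u $ j) = (\<Sum>b\<in>\<beta>. m' b * b $ j)" for j
      by (auto simp: p_def q_def vec_eq_iff sum_component)
    then have "u = (\<chi> j. \<Sum>b\<in>\<beta>. Complex (m b) (m' b) * of_real (b $ j))"
      by (simp add: vec_eq_iff complex_eq_iff)
    then show ?thesis by (rule exI[of _ "\<lambda>b. Complex (m b) (m' b)"])
  qed
  with fin dim \<beta>(4) show ?thesis by (intro exI[of _ \<beta>]) (auto simp: add.commute)
qed

text \<open>The basis is selected among the indices, so that a relation between the vectors can be
  solved for the coefficients at \<open>B\<close>.\<close>

lemma ex_indexed_basis:
  fixes f :: "'a \<Rightarrow> real ^ 'n::finite"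
  assumes "finite Y"
  shows "\<exists>B M. B \<subseteq> Y \<and> inj_on f B \<and> independent (f ` B) \<and> card B = dim (f ` Y) \<and>
    (\<forall>y\<in>Y. f y = (\<Sum>b\<in>B. M y b *\<^sub>R f b))"
proof -
  obtain B' where B': "B' \<subseteq> f ` Y" "independent B'" "f ` Y \<subseteq> span B'" "card B' = dim (f ` Y)"
    using basis_exists by blast
  obtain B where B: "B \<subseteq> Y" "inj_on f B" "B' = f ` B"
    using B'(1) by (auto simp: subset_image_inj)
  have finB: "finite B" using B(1) assms finite_subset by blast
  have "\<exists>m. f y = (\<Sum>b\<in>B. m b *\<^sub>R f b)" if "y \<in> Y" for y
  proof -
    have "f y \<in> span (f ` B)" using B' B that by blast
    then obtain m where "f y = (\<Sum>v\<in>f ` B. m v *\<^sub>R v)"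
      using finB by (auto simp: span_finite)
    then show ?thesis by (intro exI[of _ "m \<circ> f"]) (simp add: sum.reindex[OF B(2)])
  qed
  then obtain M where "\<And>y. y \<in> Y \<Longrightarrow> f y = (\<Sum>b\<in>B. M y b *\<^sub>R f b)" by metis
  with B B' show ?thesis by (intro exI[of _ B] exI[of _ M]) (auto simp: card_image)
qed

text \<open>Indices of the free coefficients: vanishing at the unit point determines the coefficient
  at \<open>a\<^sub>0 i\<close>.\<close>

definition rel_index :: "('k \<Rightarrow> (int ^ 'n) set) \<Rightarrow> ('k \<Rightarrow> int ^ 'n) \<Rightarrow> 'k set \<Rightarrow> ('k \<times> (int ^ 'n)) set" where
  "rel_index \<A> a\<^sub>0 I = (SIGMA i:I. \<A> i - {a\<^sub>0 i})"

definition edge :: "('k \<Rightarrow> int ^ 'n) \<Rightarrow> 'k \<times> (int ^ 'n) \<Rightarrow> int ^ 'n" where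
  "edge a\<^sub>0 y = snd y - a\<^sub>0 (fst y)"

section \<open>Parameter counts for degenerate coefficients at the unit point\<close>

locale irreducible_BK =
  fixes \<A> :: "'k::finite \<Rightarrow> (int ^ 'n::finite) set" and a\<^sub>0 :: "'k \<Rightarrow> int ^ 'n"
  assumes fin: "\<And>i. finite (\<A> i)" and base: "\<And>i. a\<^sub>0 i \<in> \<A> i"
    and spanning: "tuple_span \<A> UNIV = UNIV"
    and BK: "BK_tuple \<A>" and irreducible: "irreducible_tuple \<A>"
begin

abbreviation "\<Omega> \<equiv> support_set \<A>"
abbreviation "Y \<equiv> rel_index \<A> a\<^sub>0"
abbreviation "E \<equiv> edge a\<^sub>0"

definition rank_of :: "'k set \<Rightarrow> nat" where
  "rank_of I = dim ((\<lambda>y. rvec (E y)) ` Y I)"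

text \<open>The \<open>i\<close>-th row of the logarithmic Jacobian at \<open>(1, \<dots>, 1)\<close>, paired with \<open>u\<close>.\<close>

definition row :: "('k \<times> (int ^ 'n) \<Rightarrow> complex) \<Rightarrow> 'k \<Rightarrow> complex ^ 'n \<Rightarrow> complex" where
  "row c i u = (\<Sum>a\<in>\<A> i - {a\<^sub>0 i}. c (i, a) * pairing (E (i, a)) u)"

lemma finite_Y [simp]: "finite (Y I)"
  by (auto simp: rel_index_def fin)

lemma Y_mono: "I \<subseteq> J \<Longrightarrow> Y I \<subseteq> Y J"
  by (auto simp: rel_index_def)

lemma finite_\<Omega> [simp]: "finite \<Omega>"
  by (auto simp: support_set_def fin)

lemma rank_of_eq: "lattice_rank (tuple_span \<A> I) = rank_of I"
proof -
  let ?G = "{a - a' | a a' i. i \<in> I \<and> a \<in> \<A> i \<and> a' \<in> \<A> i}"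
  let ?D = "(\<lambda>y. rvec (E y)) ` Y I"
  have D: "rvec (a - a\<^sub>0 i) \<in> span ?D" if "i \<in> I" "a \<in> \<A> i" for i a
  proof (cases "a = a\<^sub>0 i")
    case False
    then have "(i, a) \<in> Y I" using that by (simp add: rel_index_def)
    then have "rvec (E (i, a)) \<in> span ?D" by (intro span_base) blast
    then show ?thesis by (simp add: edge_def)
  qed (simp add: span_zero)
  have G: "rvec x \<in> span ?D" if "x \<in> ?G" for x
  proof -
    obtain a a' i where x: "x = a - a'" "i \<in> I" "a \<in> \<A> i" "a' \<in> \<A> i" using \<open>x \<in> ?G\<close> by blast
    have "rvec x = rvec (a - a\<^sub>0 i) - rvec (a' - a\<^sub>0 i)" by (simp add: x(1) rvec_diff)
    then show ?thesis using D[OF x(2,3)] D[OF x(2,4)] by (simp add: span_diff)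
  qed
  have "rvec x \<in> span ?D" if "x \<in> group_closure ?G" for x
    using that by (induction rule: group_closure.induct) (auto simp: rvec_diff span_zero span_diff intro: G)
  then have "span (rvec ` group_closure ?G) \<subseteq> span ?D" by (intro span_minimal) auto
  moreover have "?D \<subseteq> rvec ` group_closure ?G"
    using base by (force simp: rel_index_def edge_def intro!: imageI group_closure.base)
  then have "span ?D \<subseteq> span (rvec ` group_closure ?G)" by (rule span_mono)
  ultimately have "span (rvec ` group_closure ?G) = span ?D" by blast
  then have "dim (rvec ` group_closure ?G) = dim ?D" by (rule span_eq_dim)
  then show ?thesis
    unfolding lattice_rank_rvec tuple_span_def rank_of_def .
qed

lemma rank_of_UNIV: "rank_of UNIV = CARD('n)"
proof -
  have "axis j 1 \<in> range (rvec :: int ^ 'n \<Rightarrow> real ^ 'n)" for j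
    by (rule image_eqI[of _ _ "axis j 1"]) (auto simp: rvec_def axis_def vec_eq_iff)
  then have "(Basis :: (real ^ 'n) set) \<subseteq> range rvec"
    by (auto simp: Basis_vec_def)
  then have "span (Basis :: (real ^ 'n) set) \<subseteq> span (range rvec)" by (rule span_mono)
  then have "span (range rvec) = span (UNIV :: (real ^ 'n) set)" by auto
  then have "dim (range rvec :: (real ^ 'n) set) = CARD('n)"
    using span_eq_dim[of "range rvec" "UNIV :: (real ^ 'n) set"] by simp
  then show ?thesis
    using rank_of_eq[of UNIV] unfolding spanning lattice_rank_rvec by simp
qed

lemma CARD_eq: "CARD('k) = CARD('n)"
  using BK rank_of_eq[of UNIV] rank_of_UNIV by (simp add: BK_tuple_def defect_def)

lemma card_le_rank: "card I \<le> rank_of I"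
  using BK by (simp add: BK_tuple_def independent_tuple_def defect_def rank_of_eq)

lemma card_less_rank: "I \<noteq> {} \<Longrightarrow> I \<noteq> UNIV \<Longrightarrow> card I < rank_of I"
  using irreducible by (simp add: irreducible_tuple_def defect_def rank_of_eq)

lemma pairing_E_eq_0:
  assumes "\<And>y. y \<in> Y UNIV \<Longrightarrow> pairing (E y) u = 0"
  shows "u = 0"
proof -
  let ?T = "(\<lambda>y. rvec (E y)) ` Y UNIV"
  obtain \<beta> where \<beta>: "finite \<beta>" "card \<beta> + dim ?T = CARD('n)"
    "\<forall>u. (\<forall>t\<in>?T. rpairing t u = 0) \<longrightarrow> (\<exists>\<kappa>. u = (\<chi> j. \<Sum>b\<in>\<beta>. \<kappa> b * of_real (b $ j)))"
    using annihilator_basis[of ?T] by blast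
  have "\<forall>t\<in>?T. rpairing t u = 0" using assms by (simp add: pairing_eq_rpairing)
  then obtain \<kappa> where "u = (\<chi> j. \<Sum>b\<in>\<beta>. \<kappa> b * of_real (b $ j))" using \<beta>(3) by blast
  moreover have "\<beta> = {}" using \<beta>(1,2) rank_of_UNIV by (simp add: rank_of_def)
  ultimately show ?thesis by (simp add: vec_eq_iff)
qed

text \<open>A kernel vector normalised to have coefficient 1 at \<open>b1\<close> costs
  \<open>CARD('n) - dim T - 1\<close> parameters, and every row in \<open>J\<close> is solved for
  the coefficient at a point \<open>\<alpha> j\<close> whose edge does not annihilate
  \<open>u\<close>. The other coefficients of such a row are written as multiples of that nonzero
  pairing, which clears the denominator and keeps the map polynomial. \<open>F\<close> runs over the
  finitely many choices of \<open>\<alpha>\<close> and \<open>b1\<close>.\<close>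

lemma right_kernel_param:
  fixes T :: "(real ^ 'n) set" and J :: "'k set"
  defines "K \<equiv> {c. \<exists>u. u \<noteq> 0 \<and> (\<forall>t\<in>T. rpairing t u = 0) \<and>
      (\<forall>j\<in>J. (\<exists>a\<in>\<A> j - {a\<^sub>0 j}. pairing (E (j, a)) u \<noteq> 0) \<and> row c j u = 0)}"
  shows "\<exists>F :: ((('k \<times> (int ^ 'n)) + (real ^ 'n)) set \<times>
        ('k \<times> (int ^ 'n) \<Rightarrow> (('k \<times> (int ^ 'n)) + (real ^ 'n) \<Rightarrow> complex) \<Rightarrow> complex)) set.
    finite F \<and> (\<forall>(X, g)\<in>F. finite X \<and> card X + card J + dim T + 1 = card (Y UNIV) + CARD('n) \<and>
      (\<forall>y\<in>Y UNIV. polyfun X (g y))) \<and>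
    K \<subseteq> (\<Union>(X, g)\<in>F. {c. \<exists>z. \<forall>y\<in>Y UNIV. c y = g y z})"
proof -
  obtain \<beta> where \<beta>: "finite \<beta>" "card \<beta> + dim T = CARD('n)"
    "\<And>u. (\<forall>t\<in>T. rpairing t u = 0) \<Longrightarrow> \<exists>\<kappa>. u = (\<chi> j. \<Sum>b\<in>\<beta>. \<kappa> b * of_real (b $ j))"
    using annihilator_basis[of T] by blast
  define U :: "real ^ 'n \<Rightarrow> (('k \<times> (int ^ 'n)) + (real ^ 'n) \<Rightarrow> complex) \<Rightarrow> complex ^ 'n" where
    "U = (\<lambda>b1 z. \<chi> j. \<Sum>b\<in>\<beta>. (if b = b1 then 1 else z (Inr b)) * of_real (b $ j))"
  define p where "p = (\<lambda>b1 y z. pairing (E y) (U b1 z))"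
  define g where "g = (\<lambda>\<alpha> b1 (y :: 'k \<times> (int ^ 'n)) z.
     if fst y \<notin> J then z (Inl y)
     else if snd y = \<alpha> (fst y) then - (\<Sum>a\<in>\<A> (fst y) - {a\<^sub>0 (fst y)} - {\<alpha> (fst y)}. p b1 (fst y, a) z * z (Inl (fst y, a)))
     else p b1 (fst y, \<alpha> (fst y)) z * z (Inl y))"
  define X where "X = (\<lambda>\<alpha> b1. Inl ` (Y UNIV - (\<lambda>j. (j, \<alpha> j)) ` J) \<union> Inr ` (\<beta> - {b1}) :: (('k \<times> (int ^ 'n)) + (real ^ 'n)) set)"
  define R where "R = (PiE J (\<lambda>j. \<A> j - {a\<^sub>0 j})) \<times> \<beta>"
  define F where "F = (\<lambda>(\<alpha>, b1). (X \<alpha> b1, g \<alpha> b1)) ` R"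
  have 1: "finite F" unfolding F_def R_def by (intro finite_imageI finite_cartesian_product finite_PiE \<beta>) (auto simp: fin)
  have 2: "finite (X \<alpha> b1)" "card (X \<alpha> b1) + card J + dim T + 1 = card (Y UNIV) + CARD('n)"
    "\<forall>y\<in>Y UNIV. polyfun (X \<alpha> b1) (g \<alpha> b1 y)" if "(\<alpha>, b1) \<in> R" for \<alpha> b1
  proof -
    have \<alpha>: "\<And>j. j \<in> J \<Longrightarrow> \<alpha> j \<in> \<A> j - {a\<^sub>0 j}" and b1: "b1 \<in> \<beta>"
      using that by (auto simp: R_def PiE_iff)
    show "finite (X \<alpha> b1)" using \<beta>(1) by (simp add: X_def)
    have sub: "(\<lambda>j. (j, \<alpha> j)) ` J \<subseteq> Y UNIV" using \<alpha> by (auto simp: rel_index_def)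
    have "card ((\<lambda>j. (j, \<alpha> j)) ` J) = card J" by (rule card_image) (auto simp: inj_on_def)
    then have "card (Y UNIV - (\<lambda>j. (j, \<alpha> j)) ` J) + card J = card (Y UNIV)"
      using card_Diff_subset[OF _ sub] card_mono[OF _ sub] by simp
    moreover have "card (X \<alpha> b1) = card (Y UNIV - (\<lambda>j. (j, \<alpha> j)) ` J) + card (\<beta> - {b1})"
      unfolding X_def using \<beta>(1) by (subst card_Un_disjoint) (auto simp: card_image)
    moreover have "card (\<beta> - {b1}) + 1 = card \<beta>" using \<beta>(1) b1 by (metis Suc_eq_plus1 card_Suc_Diff1)
    ultimately show "card (X \<alpha> b1) + card J + dim T + 1 = card (Y UNIV) + CARD('n)" using \<beta>(2) by linarith
    have pU: "polyfun (X \<alpha> b1) (\<lambda>z. U b1 z $ j)" for j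
    proof -
      have "polyfun (X \<alpha> b1) (\<lambda>z. if b = b1 then 1 else z (Inr b))" if "b \<in> \<beta>" for b
        using that by (cases "b = b1") (auto simp: X_def intro: polyfun_intros)
      then show ?thesis unfolding U_def vec_lambda_beta by (intro polyfun_sum polyfun.mult polyfun.const)
    qed
    have pp: "polyfun (X \<alpha> b1) (p b1 y)" for y
      unfolding p_def pairing_def by (intro polyfun_sum polyfun.mult polyfun.const pU)
    have var: "polyfun (X \<alpha> b1) (\<lambda>z. z (Inl (i, a)))" if "a \<in> \<A> i - {a\<^sub>0 i}" "i \<notin> J \<or> a \<noteq> \<alpha> i" for i a
      using that by (intro polyfun.var) (auto simp: X_def rel_index_def)
    show "\<forall>y\<in>Y UNIV. polyfun (X \<alpha> b1) (g \<alpha> b1 y)"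
    proof
      fix y assume "y \<in> Y UNIV"
      then obtain i a where y: "y = (i, a)" "a \<in> \<A> i - {a\<^sub>0 i}" by (auto simp: rel_index_def)
      consider "i \<notin> J" | "i \<in> J" "a = \<alpha> i" | "i \<in> J" "a \<noteq> \<alpha> i" by blast
      then show "polyfun (X \<alpha> b1) (g \<alpha> b1 y)"
      proof cases
        case 1 then show ?thesis using var[of a i] y by (simp add: g_def)
      next
        case 2
        have "polyfun (X \<alpha> b1) (\<lambda>z. - (\<Sum>a\<in>\<A> i - {a\<^sub>0 i} - {\<alpha> i}. p b1 (i, a) z * z (Inl (i, a))))"
          by (intro polyfun_uminus polyfun_sum polyfun.mult pp var) auto
        then show ?thesis using 2 by (simp add: g_def y)
      next
        case 3
        have "polyfun (X \<alpha> b1) (\<lambda>z. p b1 (i, \<alpha> i) z * z (Inl (i, a)))"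
          by (intro polyfun.mult pp var) (use 3 y in auto)
        then show ?thesis using 3 by (simp add: g_def y)
      qed
    qed
  qed
  have 3: "\<exists>(X, g)\<in>F. \<exists>z. \<forall>y\<in>Y UNIV. c y = g y z" if c: "c \<in> K" for c
  proof -
    obtain u where u: "u \<noteq> 0" "\<forall>t\<in>T. rpairing t u = 0"
      "\<And>j. j \<in> J \<Longrightarrow> \<exists>a\<in>\<A> j - {a\<^sub>0 j}. pairing (E (j, a)) u \<noteq> 0" "\<And>j. j \<in> J \<Longrightarrow> row c j u = 0"
      using c unfolding K_def by blast
    obtain \<kappa> where \<kappa>: "u = (\<chi> j. \<Sum>b\<in>\<beta>. \<kappa> b * of_real (b $ j))" using \<beta>(3) u(2) by blast
    have "\<exists>b1\<in>\<beta>. \<kappa> b1 \<noteq> 0"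
    proof (rule ccontr)
      assume "\<not> ?thesis"
      then have "u = 0" by (simp add: \<kappa> vec_eq_iff)
      with u(1) show False by simp
    qed
    then obtain b1 where b1: "b1 \<in> \<beta>" "\<kappa> b1 \<noteq> 0" by blast
    have "\<exists>\<alpha>. \<forall>j\<in>J. \<alpha> j \<in> \<A> j - {a\<^sub>0 j} \<and> pairing (E (j, \<alpha> j)) u \<noteq> 0"
      by (rule bchoice) (use u(3) in blast)
    then obtain \<alpha>' where \<alpha>': "\<And>j. j \<in> J \<Longrightarrow> \<alpha>' j \<in> \<A> j - {a\<^sub>0 j} \<and> pairing (E (j, \<alpha>' j)) u \<noteq> 0" by blast
    define \<alpha> where "\<alpha> = restrict \<alpha>' J"
    have \<alpha>: "\<alpha> \<in> PiE J (\<lambda>j. \<A> j - {a\<^sub>0 j})" "\<And>j. j \<in> J \<Longrightarrow> pairing (E (j, \<alpha> j)) u \<noteq> 0"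
      using \<alpha>' by (auto simp: \<alpha>_def)
    define u' where "u' = (1 / \<kappa> b1) *s u"
    have u': "pairing (E y) u' = pairing (E y) u / \<kappa> b1" for y by (simp add: u'_def pairing_scale)
    have nz: "pairing (E (j, \<alpha> j)) u' \<noteq> 0" if "j \<in> J" for j using \<alpha>(2)[OF that] b1 by (simp add: u')
    define z where "z = (\<lambda>v. case v of Inr b \<Rightarrow> \<kappa> b / \<kappa> b1
       | Inl y \<Rightarrow> if fst y \<in> J then c y / pairing (E (fst y, \<alpha> (fst y))) u' else c y)"
    have "(if b = b1 then 1 else z (Inr b)) = \<kappa> b / \<kappa> b1" for b using b1 by (simp add: z_def)
    then have "U b1 z = u'"
      by (simp add: U_def u'_def \<kappa> vec_eq_iff sum_distrib_left)
    then have pz: "p b1 y z = pairing (E y) u'" for y by (simp add: p_def)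
    have zJ: "z (Inl (i, b)) = c (i, b) / pairing (E (i, \<alpha> i)) u'" if "i \<in> J" for i b
      using that by (simp add: z_def)
    have "c y = g \<alpha> b1 y z" if y: "y \<in> Y UNIV" for y
    proof -
      obtain i a where ia: "y = (i, a)" "a \<in> \<A> i - {a\<^sub>0 i}" using y by (auto simp: rel_index_def)
      consider "i \<notin> J" | "i \<in> J" "a = \<alpha> i" | "i \<in> J" "a \<noteq> \<alpha> i" by blast
      then show ?thesis
      proof cases
        case 1 then show ?thesis by (simp add: g_def z_def ia)
      next
        case 2
        have "0 = row c i u'" using u(4)[OF 2(1)] by (simp add: row_def u' flip: sum_divide_distrib)
        also have "\<dots> = c (i, a) * pairing (E (i, a)) u' + (\<Sum>b\<in>\<A> i - {a\<^sub>0 i} - {a}. c (i, b) * pairing (E (i, b)) u')"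
          unfolding row_def using ia by (intro sum.remove) (auto simp: fin)
        finally have "c (i, a) = - (\<Sum>b\<in>\<A> i - {a\<^sub>0 i} - {a}. c (i, b) * pairing (E (i, b)) u') / pairing (E (i, a)) u'"
          using nz[OF 2(1)] 2 by (simp add: eq_neg_iff_add_eq_0 field_simps)
        also have "\<dots> = - (\<Sum>b\<in>\<A> i - {a\<^sub>0 i} - {a}. pairing (E (i, b)) u' * (c (i, b) / pairing (E (i, a)) u'))"
          by (simp add: sum_divide_distrib mult.commute)
        finally show ?thesis using 2 by (simp add: g_def ia pz zJ)
      next
        case 3
        then show ?thesis using nz[OF 3(1)] by (simp add: g_def ia pz zJ)
      qed
    qed
    then have "\<exists>z. \<forall>y\<in>Y UNIV. c y = g \<alpha> b1 y z" by blast
    moreover have "(X \<alpha> b1, g \<alpha> b1) \<in> F"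
      unfolding F_def R_def by (rule image_eqI[of _ _ "(\<alpha>, b1)"]) (use \<alpha>(1) b1(1) in auto)
    ultimately show ?thesis by (intro bexI[of _ "(X \<alpha> b1, g \<alpha> b1)"]) auto
  qed
  have "\<forall>(X, g)\<in>F. finite X \<and> card X + card J + dim T + 1 = card (Y UNIV) + CARD('n) \<and> (\<forall>y\<in>Y UNIV. polyfun X (g y))"
    using 2 by (auto simp: F_def)
  moreover have "K \<subseteq> (\<Union>(X, g)\<in>F. {c. \<exists>z. \<forall>y\<in>Y UNIV. c y = g y z})"
  proof
    fix c assume "c \<in> K"
    from 3[OF this] obtain p where p: "p \<in> F" "case p of (X, g) \<Rightarrow> \<exists>z. \<forall>y\<in>Y UNIV. c y = g y z" ..
    show "c \<in> (\<Union>(X, g)\<in>F. {c. \<exists>z. \<forall>y\<in>Y UNIV. c y = g y z})"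
      by (rule UN_I[OF p(1)]) (use p(2) in \<open>simp add: case_prod_unfold\<close>)
  qed
  ultimately show ?thesis using 1 by (intro exI[of _ F] conjI)
qed

definition singular :: "('k \<times> (int ^ 'n) \<Rightarrow> complex) \<Rightarrow> bool" where
  "singular c \<longleftrightarrow> (\<exists>u. u \<noteq> 0 \<and> (\<forall>i. row c i u = 0))"

text \<open>The parametrisations have \<open>card (Y UNIV) - 1 + card (- J) - dim T\<close>
  variables, hence codimension at least two under the strict inequality and at least one under the
  weak one.\<close>

lemma thin_right_kernel:
  assumes "card (- J) < dim T \<or> card (- J) \<le> dim T \<and> w = (\<lambda>_. 0)"
  shows "thin (Y UNIV) w {c. \<exists>u. u \<noteq> 0 \<and> (\<forall>t\<in>T. rpairing t u = 0) \<and>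
      (\<forall>j\<in>J. (\<exists>a\<in>\<A> j - {a\<^sub>0 j}. pairing (E (j, a)) u \<noteq> 0) \<and> row c j u = 0)}" (is "thin _ _ ?K")
proof -
  obtain F :: "((('k \<times> (int ^ 'n)) + (real ^ 'n)) set \<times>
        ('k \<times> (int ^ 'n) \<Rightarrow> (('k \<times> (int ^ 'n)) + (real ^ 'n) \<Rightarrow> complex) \<Rightarrow> complex)) set"
    where F: "finite F" "\<forall>(X, g)\<in>F. finite X \<and> card X + card J + dim T + 1 = card (Y UNIV) + CARD('n) \<and>
      (\<forall>y\<in>Y UNIV. polyfun X (g y))" "?K \<subseteq> (\<Union>(X, g)\<in>F. {c. \<exists>z. \<forall>y\<in>Y UNIV. c y = g y z})"
    using right_kernel_param[where T = T and J = J] by (elim exE conjE)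
  have J: "card J + card (- J) = CARD('n)"
    using card_Un_disjoint[of J "- J"] CARD_eq by (simp add: Compl_partition)
  have "thin (Y UNIV) w (\<Union>p\<in>F. {c. \<exists>z. \<forall>y\<in>Y UNIV. c y = snd p y z})"
  proof (rule thin_UN[OF F(1)])
    fix p assume p: "p \<in> F"
    then have *: "finite (fst p)" "card (fst p) + card J + dim T + 1 = card (Y UNIV) + CARD('n)"
      "\<And>y. y \<in> Y UNIV \<Longrightarrow> polyfun (fst p) (snd p y)" using F(2) by (auto simp: case_prod_unfold)
    have "card (fst p) + 1 < card (Y UNIV) \<or> card (fst p) < card (Y UNIV) \<and> w = (\<lambda>_. 0)"
      using assms *(2) J by linarith
    then show "thin (Y UNIV) w {c. \<exists>z. \<forall>y\<in>Y UNIV. c y = snd p y z}"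
      by (intro thin_image[OF *(1) finite_Y *(3)])
  qed
  then show ?thesis by (rule thin_subset) (use F(3) in \<open>auto simp: case_prod_unfold\<close>)
qed

text \<open>Rows whose edges are all annihilated by \<open>u\<close> vanish for every
  \<open>c\<close> and constrain only \<open>u\<close>; each remaining row can be solved for one
  coefficient.\<close>

lemma rows_split:
  fixes u :: "complex ^ 'n"
  defines "I \<equiv> {i. \<forall>a\<in>\<A> i - {a\<^sub>0 i}. pairing (E (i, a)) u = 0}"
  assumes "\<And>i. row c i u = 0"
  shows "(\<forall>t\<in>(\<lambda>y. rvec (E y)) ` Y I. rpairing t u = 0) \<and>
    (\<forall>j\<in>- I. (\<exists>a\<in>\<A> j - {a\<^sub>0 j}. pairing (E (j, a)) u \<noteq> 0) \<and> row c j u = 0)"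
  using assms(2) by (auto simp: I_def rel_index_def pairing_eq_rpairing)

text \<open>Singular coefficients lie in the finitely many strata \<open>?K I\<close>, where
  \<open>I\<close> records the rows killed identically. By \<open>card I <= rank_of I\<close> each
  stratum satisfies a nonzero equation, so they cannot cover everything.\<close>

lemma ex_nonsingular: "\<exists>w. \<not> singular w"
proof (rule ccontr)
  let ?T = "\<lambda>I. (\<lambda>y. rvec (E y)) ` Y I"
  let ?K = "\<lambda>I. {c. \<exists>u. u \<noteq> 0 \<and> (\<forall>t\<in>?T I. rpairing t u = 0) \<and>
      (\<forall>j\<in>- I. (\<exists>a\<in>\<A> j - {a\<^sub>0 j}. pairing (E (j, a)) u \<noteq> 0) \<and> row c j u = 0)}"
  assume "\<not> ?thesis"
  then have sing: "singular c" for c by blast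
  have "thin (Y UNIV) (\<lambda>_. 0) (\<Union>I\<in>UNIV. ?K I)"
  proof (rule thin_UN)
    fix I
    have "card (- (- I)) \<le> dim (?T I)" using card_le_rank[of I] by (simp add: rank_of_def)
    then show "thin (Y UNIV) (\<lambda>_. 0) (?K I)" by (intro thin_right_kernel) simp
  qed simp
  then obtain P where P: "polyfun (Y UNIV) P \<and> (\<exists>c. P c \<noteq> 0) \<and> (\<forall>c\<in>(\<Union>I\<in>UNIV. ?K I). P c = 0) \<and>
     (\<forall>c t. P (\<lambda>y. c y + t * 0) = P c)"
    unfolding thin_def ..
  then obtain c where c: "P c \<noteq> 0" by blast
  obtain u where u: "u \<noteq> 0" "\<And>i. row c i u = 0" using sing[of c] unfolding singular_def by blast
  define I where "I = {i. \<forall>a\<in>\<A> i - {a\<^sub>0 i}. pairing (E (i, a)) u = 0}"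
  have "c \<in> ?K I" using rows_split[OF u(2)] u(1) unfolding I_def by blast
  then have "c \<in> (\<Union>I\<in>UNIV. ?K I)" by (rule UN_I[OF UNIV_I])
  moreover from P have "\<forall>c\<in>(\<Union>I\<in>UNIV. ?K I). P c = 0" by (elim conjE)
  ultimately show False using c by (metis (no_types, lifting))
qed

text \<open>The additional codimension comes from positive defect for nonempty proper
  \<open>I\<close> and from \<open>x\<close> itself for empty \<open>I\<close>; for
  \<open>I = UNIV\<close> the spanning edges would force \<open>u = 0\<close>.\<close>

lemma thin_kernel_orthogonal:
  assumes "x \<noteq> 0"
  shows "thin (Y UNIV) w {c. \<exists>u. u \<noteq> 0 \<and> pairing x u = 0 \<and> (\<forall>i. row c i u = 0)}" (is "thin _ _ ?S")
proof -
  let ?T = "\<lambda>I. insert (rvec x) ((\<lambda>y. rvec (E y)) ` Y I)"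
  let ?K = "\<lambda>I. {c. \<exists>u. u \<noteq> 0 \<and> (\<forall>t\<in>?T I. rpairing t u = 0) \<and>
      (\<forall>j\<in>- I. (\<exists>a\<in>\<A> j - {a\<^sub>0 j}. pairing (E (j, a)) u \<noteq> 0) \<and> row c j u = 0)}"
  have "thin (Y UNIV) w (\<Union>I\<in>- {UNIV}. ?K I)"
  proof (rule thin_UN)
    fix I :: "'k set" assume I: "I \<in> - {UNIV}"
    have "card I < dim (?T I)"
    proof (cases "I = {}")
      case True
      have "dim {rvec x} = 1" using assms by (simp add: dim_singleton)
      then show ?thesis using True dim_subset[of "{rvec x}" "?T I"] by simp
    next
      case False
      then have "card I < rank_of I" using card_less_rank I by blast
      also have "rank_of I \<le> dim (?T I)" unfolding rank_of_def by (rule dim_subset) blast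
      finally show ?thesis .
    qed
    then show "thin (Y UNIV) w (?K I)" by (intro thin_right_kernel) simp
  qed simp
  then show ?thesis
  proof (rule thin_subset)
    show "?S \<subseteq> (\<Union>I\<in>- {UNIV}. ?K I)"
    proof
      fix c assume "c \<in> ?S"
      then obtain u where u: "u \<noteq> 0" "pairing x u = 0" "\<And>i. row c i u = 0" by blast
      define I where "I = {i. \<forall>a\<in>\<A> i - {a\<^sub>0 i}. pairing (E (i, a)) u = 0}"
      have "I \<noteq> UNIV"
      proof
        assume "I = UNIV"
        then have "u = 0" by (intro pairing_E_eq_0) (auto simp: I_def rel_index_def)
        with u(1) show False by simp
      qed
      moreover have "c \<in> ?K I"
        using rows_split[OF u(3)] u(1,2) by (auto simp: I_def pairing_eq_rpairing)
      ultimately show "c \<in> (\<Union>I\<in>- {UNIV}. ?K I)" by (intro UN_I[of I]) simp_all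
    qed
  qed
qed

text \<open>Weighting the coefficients by \<open>l\<close> turns the relation between rows into a
  relation between the edges in \<open>Y I\<close>, which determines the \<open>rank_of I\<close>
  weighted coefficients on a basis. With \<open>l\<close> normalised at \<open>i1\<close> only
  \<open>card I - 1\<close> parameters are added, so the codimension is at least
  \<open>rank_of I - card I + 1 >= 2\<close>. The variables \<open>Inr i\<close> stand for
  \<open>1 / l i\<close>, to keep the map polynomial.\<close>

lemma thin_left_kernel_support:
  assumes I: "I \<noteq> {}" "I \<noteq> UNIV"
  shows "thin (Y UNIV) w {c. \<exists>l. (\<forall>i. l i \<noteq> 0 \<longleftrightarrow> i \<in> I) \<and> (\<forall>u. (\<Sum>i\<in>UNIV. l i * row c i u) = 0)}"
    (is "thin _ _ ?S")
proof -
  obtain B M where B: "B \<subseteq> Y I" "inj_on (\<lambda>y. rvec (E y)) B" "independent ((\<lambda>y. rvec (E y)) ` B)"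
    "card B = rank_of I" and M: "\<forall>y\<in>Y I. rvec (E y) = (\<Sum>b\<in>B. M y b *\<^sub>R rvec (E b))"
    using ex_indexed_basis[OF finite_Y[of I], of "\<lambda>y. rvec (E y)"] unfolding rank_of_def by blast
  have finB: "finite B" using B(1) finite_subset[OF _ finite_Y] by blast
  obtain i1 where i1: "i1 \<in> I" using I by blast
  define \<mu> :: "'k \<Rightarrow> (('k \<times> (int ^ 'n)) + 'k \<Rightarrow> complex) \<Rightarrow> complex" where
    "\<mu> = (\<lambda>i z. if i = i1 then 1 else z (Inr i))"
  define g where "g = (\<lambda>y z. if fst y \<notin> I then z (Inl y)
     else if y \<in> B then \<mu> (fst y) z * - (\<Sum>y'\<in>Y I - B. of_real (M y' y) * z (Inl y'))
     else \<mu> (fst y) z * z (Inl y))"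
  define X where "X = Inl ` (Y UNIV - B) \<union> Inr ` (I - {i1})"
  have BY: "B \<subseteq> Y UNIV" using B(1) Y_mono[of I UNIV] by blast
  have pmu: "polyfun X (\<mu> i)" if "i \<in> I" for i
    using that by (cases "i = i1") (auto simp: \<mu>_def X_def intro: polyfun_intros)
  have poly: "polyfun X (g y)" if y: "y \<in> Y UNIV" for y
  proof -
    have var: "polyfun X (\<lambda>z. z (Inl y'))" if "y' \<in> Y UNIV - B" for y'
      using that by (intro polyfun.var) (auto simp: X_def)
    consider "fst y \<notin> I" | "fst y \<in> I" "y \<in> B" | "fst y \<in> I" "y \<notin> B" by blast
    then show ?thesis
    proof cases
      case 1
      then have "y \<notin> B" using B(1) by (auto simp: rel_index_def)
      then show ?thesis using 1 var[of y] y by (simp add: g_def)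
    next
      case 2
      have "polyfun X (\<lambda>z. \<mu> (fst y) z * - (\<Sum>y'\<in>Y I - B. of_real (M y' y) * z (Inl y')))"
        using Y_mono[of I UNIV]
        by (intro polyfun.mult polyfun_uminus polyfun_sum polyfun.const pmu 2 var) blast
      then show ?thesis using 2 by (simp add: g_def)
    next
      case 3
      have "polyfun X (\<lambda>z. \<mu> (fst y) z * z (Inl y))"
        by (intro polyfun.mult pmu 3 var) (use 3 y in auto)
      then show ?thesis using 3 by (simp add: g_def)
    qed
  qed
  have "card X = card (Y UNIV - B) + card (I - {i1})"
    unfolding X_def by (subst card_Un_disjoint) (auto simp: card_image)
  moreover have "card (Y UNIV - B) + card B = card (Y UNIV)"
    using card_Diff_subset[OF finB BY] card_mono[OF finite_Y BY] by simp
  moreover have "card (I - {i1}) + 1 = card I" using i1 by (metis Suc_eq_plus1 card_Suc_Diff1 finite)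
  ultimately have "card X + 1 < card (Y UNIV)" using card_less_rank[OF I] B(4) by linarith
  then have "thin (Y UNIV) w {c. \<exists>z. \<forall>y\<in>Y UNIV. c y = g y z}"
    by (intro thin_image[OF _ finite_Y poly]) (auto simp: X_def)
  then show ?thesis
  proof (rule thin_subset)
    show "?S \<subseteq> {c. \<exists>z. \<forall>y\<in>Y UNIV. c y = g y z}"
    proof
      fix c assume "c \<in> ?S"
      then obtain l where l: "\<And>i. l i \<noteq> 0 \<longleftrightarrow> i \<in> I" "\<And>u. (\<Sum>i\<in>UNIV. l i * row c i u) = 0" by blast
      define l' where "l' = (\<lambda>i. l i / l i1)"
      have l': "\<And>i. l' i \<noteq> 0 \<longleftrightarrow> i \<in> I" "l' i1 = 1" "(\<Sum>i\<in>UNIV. l' i * row c i u) = 0" for u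
        using l i1 by (auto simp: l'_def simp flip: sum_divide_distrib)
      define q where "q = (\<lambda>y. l' (fst y) * c y)"
      define z where "z = (\<lambda>v. case v of Inr i \<Rightarrow> 1 / l' i | Inl y \<Rightarrow> if fst y \<in> I then q y else c y)"
      have q0: "(\<Sum>y\<in>Y I. q y * pairing (E y) u) = 0" for u
      proof -
        have "(\<Sum>y\<in>Y I. q y * pairing (E y) u) = (\<Sum>i\<in>I. l' i * row c i u)"
          unfolding rel_index_def row_def q_def
          by (simp add: sum.Sigma fin sum_distrib_left mult_ac case_prod_unfold)
        also have "\<dots> = (\<Sum>i\<in>UNIV. l' i * row c i u)"
          by (rule sum.mono_neutral_left) (use l'(1) in auto)
        finally show ?thesis using l'(3) by simp
      qed
      have "q b + (\<Sum>y\<in>Y I - B. of_real (M y b) * q y) = 0" if b: "b \<in> B" for b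
      proof (rule independent_rpairing[OF finB B(2,3) _ b])
        fix u
        have "0 = (\<Sum>y\<in>B. q y * pairing (E y) u) + (\<Sum>y\<in>Y I - B. q y * pairing (E y) u)"
          using q0[of u] sum.subset_diff[OF B(1) finite_Y, of "\<lambda>y. q y * pairing (E y) u"] by (simp add: add.commute)
        also have "(\<Sum>y\<in>Y I - B. q y * pairing (E y) u)
            = (\<Sum>y\<in>Y I - B. \<Sum>b\<in>B. of_real (M y b) * q y * rpairing (rvec (E b)) u)"
        proof (rule sum.cong)
          fix y assume "y \<in> Y I - B"
          then have "pairing (E y) u = (\<Sum>b\<in>B. of_real (M y b) * rpairing (rvec (E b)) u)"
            using M rpairing_sum_scaleR[of "M y" "\<lambda>b. rvec (E b)" B u] by (simp add: pairing_eq_rpairing)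
          then show "q y * pairing (E y) u = (\<Sum>b\<in>B. of_real (M y b) * q y * rpairing (rvec (E b)) u)"
            by (simp add: sum_distrib_left mult_ac)
        qed simp
        also have "\<dots> = (\<Sum>b\<in>B. \<Sum>y\<in>Y I - B. of_real (M y b) * q y * rpairing (rvec (E b)) u)"
          by (rule sum.swap)
        finally show "(\<Sum>b\<in>B. (q b + (\<Sum>y\<in>Y I - B. of_real (M y b) * q y)) * rpairing (rvec (E b)) u) = 0"
          by (simp add: ring_distribs sum.distrib sum_distrib_right pairing_eq_rpairing)
      qed
      then have qB: "q b = - (\<Sum>y\<in>Y I - B. of_real (M y b) * q y)" if "b \<in> B" for b
        using that by (simp add: eq_neg_iff_add_eq_0)
      have mu: "\<mu> i z = 1 / l' i" for i using l'(2) by (simp add: \<mu>_def z_def)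
      have zq: "z (Inl y) = q y" if "y \<in> Y I" for y using that by (auto simp: z_def rel_index_def)
      have "c y = g y z" if y: "y \<in> Y UNIV" for y
      proof -
        have c: "c y = 1 / l' (fst y) * q y" if "fst y \<in> I" using l'(1) that by (simp add: q_def)
        consider "fst y \<notin> I" | "fst y \<in> I" "y \<in> B" | "fst y \<in> I" "y \<notin> B" by blast
        then show ?thesis
        proof cases
          case 1 then show ?thesis by (simp add: g_def z_def)
        next
          case 2
          have "g y z = 1 / l' (fst y) * - (\<Sum>y'\<in>Y I - B. of_real (M y' y) * q y')"
            using 2 by (simp add: g_def mu zq)
          then show ?thesis using c[OF 2(1)] qB[OF 2(2)] by simp
        next
          case 3
          have "y \<in> Y I" using 3 y by (auto simp: rel_index_def)
          with 3 show ?thesis using c by (simp add: g_def mu zq)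
        qed
      qed
      then show "c \<in> {c. \<exists>z. \<forall>y\<in>Y UNIV. c y = g y z}" by blast
    qed
  qed
qed

lemma thin_left_kernel:
  "thin (Y UNIV) w {c. \<exists>l i\<^sub>0 i\<^sub>1. l i\<^sub>0 = 0 \<and> l i\<^sub>1 \<noteq> 0 \<and> (\<forall>u. (\<Sum>i\<in>UNIV. l i * row c i u) = 0)}"
    (is "thin _ _ ?S")
proof -
  let ?K = "\<lambda>I. {c. \<exists>l. (\<forall>i. l i \<noteq> 0 \<longleftrightarrow> i \<in> I) \<and> (\<forall>u. (\<Sum>i\<in>UNIV. l i * row c i u) = 0)}"
  have "thin (Y UNIV) w (\<Union>I\<in>- {{}, UNIV}. ?K I)"
    by (rule thin_UN) (auto intro: thin_left_kernel_support)
  then show ?thesis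
  proof (rule thin_subset)
    show "?S \<subseteq> (\<Union>I\<in>- {{}, UNIV}. ?K I)"
    proof
      fix c assume "c \<in> ?S"
      then obtain l i\<^sub>0 i\<^sub>1 where l: "l i\<^sub>0 = 0" "l i\<^sub>1 \<noteq> 0" "\<forall>u. (\<Sum>i\<in>UNIV. l i * row c i u) = 0" by blast
      then have "c \<in> ?K {i. l i \<noteq> 0}" "{i. l i \<noteq> 0} \<in> - {{}, UNIV}" by auto
      then show "c \<in> (\<Union>I\<in>- {{}, UNIV}. ?K I)" by (intro UN_I[of "{i. l i \<noteq> 0}"])
    qed
  qed
qed

end

section \<open>Irreducibility and properness of the discriminant\<close>

lemma prod_linear_poly:
  fixes a b :: "'i \<Rightarrow> complex"
  assumes "finite S"
  shows "degree (\<Prod>i\<in>S. [:a i, b i:]) \<le> card S \<and> coeff (\<Prod>i\<in>S. [:a i, b i:]) (card S) = (\<Prod>i\<in>S. b i)"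
  using assms
proof (induction rule: finite_induct)
  case (insert i S)
  let ?q = "\<Prod>i\<in>S. [:a i, b i:]"
  have "coeff ([:a i, b i:] * ?q) (Suc (card S)) = b i * (\<Prod>i\<in>S. b i)"
    using insert by (simp add: coeff_eq_0)
  moreover have "degree ([:a i, b i:] * ?q) \<le> Suc (card S)"
    using degree_mult_le[of "[:a i, b i:]" ?q] insert.IH by (auto split: if_splits)
  ultimately show ?case using insert.hyps by simp
qed simp

lemma det_pencil_poly:
  fixes A B :: "complex ^ 'n::finite ^ 'n"
  shows "\<exists>p. (\<forall>t. poly p t = det (\<chi> i j. A $ i $ j + t * B $ i $ j)) \<and> degree p \<le> CARD('n) \<and> coeff p CARD('n) = det B"
proof (intro exI conjI allI)
  let ?p = "\<Sum>\<sigma> | \<sigma> permutes (UNIV :: 'n set). [:of_int (sign \<sigma>):] * (\<Prod>i\<in>UNIV. [:A $ i $ \<sigma> i, B $ i $ \<sigma> i:])"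
  show "poly ?p t = det (\<chi> i j. A $ i $ j + t * B $ i $ j)" for t
    by (simp add: det_def poly_sum poly_prod)
  show "degree ?p \<le> CARD('n)"
    using prod_linear_poly[of "UNIV :: 'n set"] by (intro degree_sum_le order.trans[OF degree_mult_le]) auto
  show "coeff ?p CARD('n) = det B"
    using prod_linear_poly[of "UNIV :: 'n set"] by (simp add: det_def coeff_sum)
qed

text \<open>With top coefficient b and all n roots of modulus at least \<delta>, the value at 0
  would have modulus at least |b| \<delta>^n. The induction splits off one large root at a
  time.\<close>

lemma ex_small_root:
  fixes p :: "complex poly"
  assumes "degree p \<le> n" "norm (poly p 0) < norm (coeff p n) * \<delta> ^ n" "\<delta> > 0"
  shows "\<exists>z. poly p z = 0 \<and> norm z < \<delta>"
  using assms(1,2)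
proof (induction n arbitrary: p)
  case 0
  then show ?case by (simp add: poly_0_coeff_0)
next
  case (Suc n)
  have "coeff p (Suc n) \<noteq> 0" using Suc.prems(2) norm_ge_zero[of "poly p 0"] by (auto simp del: norm_ge_zero)
  then have "degree p = Suc n" using Suc.prems(1) le_degree[of p "Suc n"] by (intro antisym) auto
  then obtain z where z: "poly p z = 0"
    using fundamental_theorem_of_algebra[of p] constant_degree[of p] by auto
  then obtain q where q: "p = [:- z, 1:] * q" unfolding poly_eq_0_iff_dvd by (auto elim: dvdE)
  show ?case
  proof (cases "norm z < \<delta>")
    case False
    have "q \<noteq> 0" using q \<open>degree p = Suc n\<close> by auto
    then have "degree ([:- z, 1:] * q) = 1 + degree q" by (subst degree_mult_eq) auto
    then have "degree q \<le> n" using \<open>degree p = Suc n\<close> unfolding q by linarith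
    moreover have "coeff p (Suc n) = coeff q n"
      using q \<open>degree q \<le> n\<close> by (simp add: coeff_eq_0)
    moreover have "norm (poly q 0) < norm (coeff q n) * \<delta> ^ n"
    proof -
      have "\<delta> * norm (poly q 0) \<le> norm z * norm (poly q 0)"
        using False by (intro mult_right_mono) auto
      also have "\<dots> = norm (poly p 0)" by (simp add: q norm_mult)
      also have "\<dots> < \<delta> * (norm (coeff q n) * \<delta> ^ n)"
        using Suc.prems(2) \<open>coeff p (Suc n) = coeff q n\<close> by (simp add: mult_ac)
      finally show ?thesis using assms(3) by simp
    qed
    ultimately obtain y where "poly q y = 0" "norm y < \<delta>" using Suc.IH by blast
    then show ?thesis by (auto simp: q)
  qed (use z in blast)
qed

lemma monomial_inverse:
  assumes "x \<in> torus"
  shows "monomial x a * monomial (\<chi> j. inverse (x $ j)) a = 1"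
  using assms unfolding monomial_def torus_def prod.distrib[symmetric]
  by (intro prod.neutral) (simp add: power_int_inverse)

context irreducible_BK
begin

text \<open>An arbitrary matching of equations with coordinates, which makes the Jacobian a square
  matrix over a single index type.\<close>

definition idx :: "'n \<Rightarrow> 'k" where "idx = (SOME e. bij e)"

lemma bij_idx: "bij idx"
proof -
  have "\<exists>e :: 'n \<Rightarrow> 'k. bij e"
    using CARD_eq finite_same_card_bij[of "UNIV :: 'n set" "UNIV :: 'k set"] by auto
  then show ?thesis unfolding idx_def by (rule someI_ex)
qed

definition log_jacobian :: "('k \<times> (int ^ 'n) \<Rightarrow> complex) \<Rightarrow> complex ^ 'n ^ 'n" where
  "log_jacobian c = (\<chi> l j. \<Sum>a\<in>\<A> (idx l) - {a\<^sub>0 (idx l)}. c (idx l, a) * of_int (E (idx l, a) $ j))"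

lemma log_jacobian_mult: "(log_jacobian c *v u) $ l = row c (idx l) u"
  unfolding log_jacobian_def row_def pairing_def matrix_vector_mult_def
  by (simp add: sum_distrib_left sum_distrib_right mult_ac) (rule sum.swap)

lemma log_jacobian_line:
  "log_jacobian (\<lambda>y. c y + t * w y) = (\<chi> i j. log_jacobian c $ i $ j + t * log_jacobian w $ i $ j)"
  by (simp add: log_jacobian_def vec_eq_iff ring_distribs sum.distrib sum_distrib_left mult_ac)

lemma singular_iff_det: "singular c \<longleftrightarrow> det (log_jacobian c) = 0"
proof -
  have "singular c \<longleftrightarrow> (\<exists>u. u \<noteq> 0 \<and> log_jacobian c *v u = 0)"
    unfolding singular_def
    using bij_is_surj[OF bij_idx] by (simp add: vec_eq_iff[of "log_jacobian c *v _"] log_jacobian_mult) (metis surjD)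
  also have "\<dots> \<longleftrightarrow> \<not> invertible (log_jacobian c)"
    by (metis invertible_left_inverse matrix_left_invertible_ker)
  finally show ?thesis by (simp add: invertible_det_nz)
qed

lemma sum_idx: "(\<Sum>l\<in>UNIV. f (idx l)) = (\<Sum>i\<in>UNIV. f i)"
  by (rule sum.reindex_bij_betw[OF bij_idx])

lemma singular_iff_left_kernel:
  "singular c \<longleftrightarrow> (\<exists>l. (\<exists>i. l i \<noteq> 0) \<and> (\<forall>u. (\<Sum>i\<in>UNIV. l i * row c i u) = 0))"
proof -
  have eq: "(\<Sum>j\<in>UNIV. (transpose (log_jacobian c) *v x) $ j * u $ j) = (\<Sum>l\<in>UNIV. x $ l * row c (idx l) u)" for x u
  proof -
    have "(\<Sum>j\<in>UNIV. (transpose (log_jacobian c) *v x) $ j * u $ j)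
        = (\<Sum>j\<in>UNIV. \<Sum>l\<in>UNIV. x $ l * (log_jacobian c $ l $ j * u $ j))"
      by (simp add: matrix_vector_mult_def transpose_def sum_distrib_right sum_distrib_left mult_ac)
    also have "\<dots> = (\<Sum>l\<in>UNIV. \<Sum>j\<in>UNIV. x $ l * (log_jacobian c $ l $ j * u $ j))" by (rule sum.swap)
    finally show ?thesis
      by (simp add: log_jacobian_mult[symmetric] matrix_vector_mult_def sum_distrib_left)
  qed
  have "singular c \<longleftrightarrow> \<not> invertible (transpose (log_jacobian c))"
    by (simp add: singular_iff_det invertible_det_nz)
  also have "\<dots> \<longleftrightarrow> (\<exists>x. x \<noteq> 0 \<and> transpose (log_jacobian c) *v x = 0)"
    by (metis invertible_left_inverse matrix_left_invertible_ker)
  also have "\<dots> \<longleftrightarrow> (\<exists>l. (\<exists>i. l i \<noteq> 0) \<and> (\<forall>u. (\<Sum>i\<in>UNIV. l i * row c i u) = 0))"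
  proof
    assume "\<exists>x. x \<noteq> 0 \<and> transpose (log_jacobian c) *v x = 0"
    then obtain x where x: "x \<noteq> 0" "transpose (log_jacobian c) *v x = 0" by blast
    define l where "l = (\<lambda>i. x $ inv idx i)"
    have l: "l (idx k) = x $ k" for k using bij_is_inj[OF bij_idx] by (simp add: l_def)
    obtain k where "x $ k \<noteq> 0" using x(1) by (auto simp: vec_eq_iff)
    then have "\<exists>i. l i \<noteq> 0" using l by metis
    moreover have "(\<Sum>i\<in>UNIV. l i * row c i u) = 0" for u
      using eq[where x = x and u = u] x(2) sum_idx[of "\<lambda>i. l i * row c i u"] by (simp add: l)
    ultimately show "\<exists>l. (\<exists>i. l i \<noteq> 0) \<and> (\<forall>u. (\<Sum>i\<in>UNIV. l i * row c i u) = 0)" by blast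
  next
    assume "\<exists>l. (\<exists>i. l i \<noteq> 0) \<and> (\<forall>u. (\<Sum>i\<in>UNIV. l i * row c i u) = 0)"
    then obtain l i where l: "l i \<noteq> 0" "\<And>u. (\<Sum>i\<in>UNIV. l i * row c i u) = 0" by blast
    define x where "x = (\<chi> k. l (idx k))"
    obtain k where "i = idx k" using bij_is_surj[OF bij_idx] by (metis surjD)
    then have "x \<noteq> 0" using l(1) by (auto simp: x_def vec_eq_iff)
    moreover have "(transpose (log_jacobian c) *v x) $ j = 0" for j
    proof -
      have "(\<Sum>j'\<in>UNIV. (transpose (log_jacobian c) *v x) $ j' * axis j 1 $ j') = 0"
        using eq[where x = x and u = "axis j 1"] l(2)[of "axis j 1"] sum_idx[of "\<lambda>i. l i * row c i (axis j 1)"]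
        by (simp add: x_def)
      then show ?thesis by (simp add: axis_def if_distrib cong: if_cong)
    qed
    ultimately show "\<exists>x. x \<noteq> 0 \<and> transpose (log_jacobian c) *v x = 0"
      by (intro exI[of _ x]) (simp add: vec_eq_iff)
  qed
  finally show ?thesis .
qed

text \<open>
  Along a line in a nonsingular direction \<open>w\<close> the determinant is a polynomial of full degree with
  constant leading coefficient, so a zero of it persists under small perturbations.
\<close>

lemma ex_singular_outside_thin:
  assumes c: "singular c" and w: "\<not> singular w" and B: "thin (Y UNIV) w B"
    and P: "polyfun (Y UNIV) P" "P c \<noteq> 0"
  shows "\<exists>c'. singular c' \<and> c' \<notin> B \<and> P c' \<noteq> 0"
proof -
  obtain R where "polyfun (Y UNIV) R \<and> (\<exists>c. R c \<noteq> 0) \<and> (\<forall>c\<in>B. R c = 0) \<and> (\<forall>c t. R (\<lambda>y. c y + t * w y) = R c)"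
    using B unfolding thin_def ..
  then have R: "polyfun (Y UNIV) R" "\<exists>c. R c \<noteq> 0" "\<forall>c\<in>B. R c = 0" "\<And>c t. R (\<lambda>y. c y + t * w y) = R c"
    by simp_all
  obtain b where b: "R b \<noteq> 0" using R(2) by blast
  \<comment> \<open>Perturbation in two steps: a small multiple \<epsilon> of \<open>d\<close> makes
    \<open>R\<close> nonzero, then a small multiple \<open>t\<close> of \<open>w\<close> restores
    singularity without changing \<open>R\<close>.\<close>
  define d where "d = (\<lambda>y. b y - c y)"
  define L where "L = (\<lambda>\<epsilon> y. c y + \<epsilon> * d y)"
  obtain r where r: "\<And>\<epsilon>. R (L \<epsilon>) = poly r \<epsilon>" using polyfun_line[OF R(1), of c d] by (auto simp: L_def)
  have "L 1 = b" by (simp add: L_def d_def)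
  then have "r \<noteq> 0" using r[of 1] b by auto
  have "((\<lambda>x. P (\<lambda>y. c y + fst x * d y + snd x * w y)) \<longlongrightarrow> P c) (at (0 :: complex \<times> complex))"
  proof (rule polyfun_tendsto[OF P(1)])
    fix y
    have "((\<lambda>x. c y + fst x * d y + snd x * w y) \<longlongrightarrow> c y + fst (0 :: complex \<times> complex) * d y + snd (0 :: complex \<times> complex) * w y) (at 0)"
      by (intro tendsto_intros)
    then show "((\<lambda>x. c y + fst x * d y + snd x * w y) \<longlongrightarrow> c y) (at (0 :: complex \<times> complex))" by simp
  qed
  then have "\<forall>\<^sub>F x in at (0 :: complex \<times> complex). P (\<lambda>y. c y + fst x * d y + snd x * w y) \<noteq> 0"
    using P(2) by (rule tendsto_imp_eventually_ne)
  then obtain \<delta> where \<delta>: "\<delta> > 0"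
    "\<And>x. x \<noteq> 0 \<Longrightarrow> dist x 0 < \<delta> \<Longrightarrow> P (\<lambda>y. c y + fst x * d y + snd x * w y) \<noteq> 0"
    unfolding eventually_at by auto
  have near: "P (\<lambda>y. L \<epsilon> y + t * w y) \<noteq> 0" if "norm \<epsilon> < \<delta> / 2" "norm t < \<delta> / 2" for \<epsilon> t
  proof (cases "(\<epsilon>, t) = (0 :: complex \<times> complex)")
    case True
    then show ?thesis using P(2) by (simp add: L_def zero_prod_def)
  next
    case False
    have "norm (\<epsilon>, t) \<le> norm \<epsilon> + norm t" by (rule norm_Pair_le)
    then show ?thesis using \<delta>(2)[of "(\<epsilon>, t)"] that False by (simp add: L_def)
  qed
  \<comment> \<open>The threshold of \<open>ex_small_root\<close>: a determinant below
    \<open>W\<close> at \<open>L \<epsilon>\<close> has a root \<open>t\<close> of modulus less than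
    \<open>\<delta> / 2\<close> on the line in direction \<open>w\<close>.\<close>
  define W where "W = norm (det (log_jacobian w)) * (\<delta> / 2) ^ CARD('n)"
  have "W > 0" using w \<delta>(1) by (simp add: W_def singular_iff_det)
  obtain q where q: "\<And>t. poly q t = det (\<chi> i j. log_jacobian c $ i $ j + t * log_jacobian d $ i $ j)"
    using det_pencil_poly[of "log_jacobian c" "log_jacobian d"] by blast
  then have q: "poly q \<epsilon> = det (log_jacobian (L \<epsilon>))" for \<epsilon> by (simp add: L_def log_jacobian_line)
  have "poly q 0 = 0" using q[of 0] c by (simp add: L_def singular_iff_det)
  have "\<forall>\<^sub>F \<epsilon> in at 0. norm (poly q \<epsilon>) < W"
  proof -
    have "((\<lambda>\<epsilon>. norm (poly q \<epsilon>)) \<longlongrightarrow> norm (poly q 0)) (at 0)" by (intro tendsto_intros)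
    with \<open>poly q 0 = 0\<close> \<open>W > 0\<close> show ?thesis using order_tendstoD(2) by fastforce
  qed
  moreover have "\<forall>\<^sub>F \<epsilon> in at 0. norm (\<epsilon> :: complex) < \<delta> / 2"
    unfolding eventually_at using \<delta>(1) by (intro exI[of _ "\<delta> / 2"]) auto
  moreover have "\<forall>\<^sub>F \<epsilon> in at 0. poly r \<epsilon> \<noteq> 0"
  proof -
    have "finite {\<epsilon>. poly r \<epsilon> = 0}" by (rule poly_roots_finite[OF \<open>r \<noteq> 0\<close>])
    then have "\<forall>\<^sub>F \<epsilon> in at 0. \<forall>z\<in>{\<epsilon>. poly r \<epsilon> = 0}. \<epsilon> \<noteq> z"
      by (intro eventually_ball_finite) (auto intro: eventually_neq_at_within)
    then show ?thesis by (rule eventually_mono) auto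
  qed
  ultimately have "\<forall>\<^sub>F \<epsilon> in at 0. norm (poly q \<epsilon>) < W \<and> norm \<epsilon> < \<delta> / 2 \<and> poly r \<epsilon> \<noteq> 0"
    by eventually_elim simp
  then obtain \<epsilon> where \<epsilon>: "norm (poly q \<epsilon>) < W" "norm \<epsilon> < \<delta> / 2" "poly r \<epsilon> \<noteq> 0"
    using eventually_happens'[of "at (0::complex)"] by auto
  obtain p where p: "\<And>t. poly p t = det (log_jacobian (\<lambda>y. L \<epsilon> y + t * w y))"
    "degree p \<le> CARD('n)" "coeff p CARD('n) = det (log_jacobian w)"
    using det_pencil_poly[of "log_jacobian (L \<epsilon>)" "log_jacobian w"] by (auto simp: log_jacobian_line)
  have "norm (poly p 0) < norm (coeff p CARD('n)) * (\<delta> / 2) ^ CARD('n)"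
    using \<epsilon>(1) by (simp add: p(1,3) W_def q)
  then obtain t where t: "poly p t = 0" "norm t < \<delta> / 2"
    using ex_small_root[OF p(2), of "\<delta> / 2"] \<delta>(1) by auto
  have "singular (\<lambda>y. L \<epsilon> y + t * w y)" using t(1) by (simp add: p(1) singular_iff_det)
  moreover have "R (\<lambda>y. L \<epsilon> y + t * w y) \<noteq> 0" using \<epsilon>(3) by (simp add: R(4) r)
  then have "(\<lambda>y. L \<epsilon> y + t * w y) \<notin> B" using R(3) by blast
  ultimately show ?thesis using near[OF \<epsilon>(2) t(2)] by blast
qed

text \<open>The unique extension of coefficients on \<open>Y UNIV\<close> to a system vanishing at \<open>(1, \<dots>, 1)\<close>.\<close>

definition extend :: "('k \<times> (int ^ 'n) \<Rightarrow> complex) \<Rightarrow> 'k \<times> (int ^ 'n) \<Rightarrow> complex" where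
  "extend c = (\<lambda>(i, a). if a = a\<^sub>0 i then - (\<Sum>b\<in>\<A> i - {a\<^sub>0 i}. c (i, b)) else c (i, a))"

lemma sum_remove_base: "(\<Sum>a\<in>\<A> i. f a) = f (a\<^sub>0 i) + (\<Sum>a\<in>\<A> i - {a\<^sub>0 i}. f a)"
  by (rule sum.remove) (auto simp: fin base)

lemma sum_extend: "(\<Sum>a\<in>\<A> i. extend c (i, a)) = 0"
  unfolding sum_remove_base by (simp add: extend_def)

lemma row_extend: "row (extend c) i u = row c i u"
  by (simp add: row_def extend_def)

lemma extend_eq:
  assumes "(\<Sum>a\<in>\<A> i. c (i, a)) = 0"
  shows "extend c (i, a) = c (i, a)"
  using assms unfolding sum_remove_base by (simp add: extend_def neg_eq_iff_add_eq_0 add.commute)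

lemma row_alt:
  assumes "(\<Sum>a\<in>\<A> i. c (i, a)) = 0"
  shows "(\<Sum>a\<in>\<A> i. c (i, a) * pairing a u) = row c i u"
proof -
  have "row c i u = (\<Sum>a\<in>\<A> i. c (i, a) * pairing (E (i, a)) u)"
    unfolding row_def sum_remove_base[of _ i] by (simp add: edge_def)
  also have "\<dots> = (\<Sum>a\<in>\<A> i. c (i, a) * pairing a u) - (\<Sum>a\<in>\<A> i. c (i, a)) * pairing (a\<^sub>0 i) u"
    by (simp add: edge_def pairing_diff_left ring_distribs sum_subtractf sum_distrib_right)
  finally show ?thesis using assms by simp
qed

lemma polyfun_extend: "(i, a) \<in> \<Omega> \<Longrightarrow> polyfun (Y UNIV) (\<lambda>c. extend c (i, a))"
  by (cases "a = a\<^sub>0 i") (auto simp: extend_def rel_index_def intro!: polyfun_intros)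

text \<open>Translating the root by \<open>y\<close> and rescaling the equations keep degeneracy.
  The factors \<open>m i\<close> may be zero, so that whole lines of factors are admissible
  later.\<close>

lemma degenerate_coeffsI:
  assumes "\<And>i. (\<Sum>a\<in>\<A> i. c (i, a)) = 0" "singular c" "y \<in> torus"
    "\<And>i a. a \<in> \<A> i \<Longrightarrow> c' (i, a) = m i * monomial y a * c (i, a)"
  shows "degenerate_coeffs \<A> c'"
proof -
  obtain u where u: "u \<noteq> 0" "\<And>i. row c i u = 0" using assms(2) by (auto simp: singular_def)
  define x where "x = (\<chi> j. inverse (y $ j))"
  have "x \<in> torus" using assms(3) by (simp add: torus_def x_def)
  have *: "c' (i, a) * monomial x a = m i * c (i, a)" if "a \<in> \<A> i" for i a
    using monomial_inverse[OF assms(3), of a] by (simp add: assms(4)[OF that] x_def mult_ac)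
  have "(\<Sum>a\<in>\<A> i. c' (i, a) * monomial x a) = 0" for i
    using assms(1)[of i] by (simp add: * flip: sum_distrib_left)
  moreover have "(\<Sum>a\<in>\<A> i. c' (i, a) * monomial x a * pairing a u) = 0" for i
    using row_alt[OF assms(1), of i u] u(2)[of i] by (simp add: * mult.assoc flip: sum_distrib_left)
  ultimately show ?thesis using \<open>x \<in> torus\<close> u(1) unfolding degenerate_coeffs_def by blast
qed

lemma degenerate_coeffsE:
  assumes "degenerate_coeffs \<A> c'"
  obtains c y where "\<And>i. (\<Sum>a\<in>\<A> i. c (i, a)) = 0" "singular c" "y \<in> torus"
    "\<And>i a. c' (i, a) = monomial y a * c (i, a)"
proof -
  obtain x u where x: "x \<in> torus" "\<And>i. (\<Sum>a\<in>\<A> i. c' (i, a) * monomial x a) = 0" "u \<noteq> 0"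
    "\<And>i. (\<Sum>a\<in>\<A> i. c' (i, a) * monomial x a * pairing a u) = 0"
    using assms by (auto simp: degenerate_coeffs_def)
  define c where "c = (\<lambda>(i, a). c' (i, a) * monomial x a)"
  define y where "y = (\<chi> j. inverse (x $ j))"
  have s: "(\<Sum>a\<in>\<A> i. c (i, a)) = 0" for i using x(2) by (simp add: c_def)
  have "row c i u = 0" for i using row_alt[OF s, of i u] x(4)[of i] by (simp add: c_def)
  then have "singular c" using x(3) by (auto simp: singular_def)
  moreover have "y \<in> torus" using x(1) by (simp add: torus_def y_def)
  moreover have "c' (i, a) = monomial y a * c (i, a)" for i a
    using monomial_inverse[OF x(1), of a] by (simp add: c_def y_def mult_ac)
  ultimately show ?thesis using s that by blast
qed

text \<open>
  The linear space \<open>S\<close>: all \<open>f\<^sub>i\<close> vanish at \<open>(1, \<dots>, 1)\<close> and \<open>\<Sum> f\<^sub>i\<close> is critical there.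
\<close>

definition balanced :: "('k \<times> (int ^ 'n) \<Rightarrow> complex) \<Rightarrow> bool" where
  "balanced s \<longleftrightarrow> (\<forall>i. (\<Sum>a\<in>\<A> i. s (i, a)) = 0) \<and> (\<forall>u. (\<Sum>i\<in>UNIV. \<Sum>a\<in>\<A> i. s (i, a) * pairing a u) = 0)"

lemma balanced_row: "balanced s \<Longrightarrow> (\<Sum>i\<in>UNIV. row s i u) = 0"
  unfolding balanced_def using row_alt[of s] by simp

lemma balancedI:
  assumes "\<And>i. (\<Sum>a\<in>\<A> i. s (i, a)) = 0" "\<And>u. (\<Sum>i\<in>UNIV. row s i u) = 0"
  shows "balanced s"
  unfolding balanced_def using row_alt[OF assms(1)] assms by simp

lemma balanced_singular: "balanced s \<Longrightarrow> singular s"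
  unfolding singular_iff_left_kernel by (intro exI[of _ "\<lambda>_. 1"]) (simp add: balanced_row)

lemma balanced_line:
  assumes "balanced s" "balanced h"
  shows "balanced (\<lambda>v. s v + t * h v)"
proof -
  have "(\<Sum>a\<in>\<A> i. s (i, a) + t * h (i, a)) = (\<Sum>a\<in>\<A> i. s (i, a)) + t * (\<Sum>a\<in>\<A> i. h (i, a))" for i
    by (simp add: sum.distrib sum_distrib_left)
  moreover have "(\<Sum>i\<in>UNIV. \<Sum>a\<in>\<A> i. (s (i, a) + t * h (i, a)) * pairing a u)
     = (\<Sum>i\<in>UNIV. \<Sum>a\<in>\<A> i. s (i, a) * pairing a u) + t * (\<Sum>i\<in>UNIV. \<Sum>a\<in>\<A> i. h (i, a) * pairing a u)" for u
    by (simp add: sum.distrib sum_distrib_left ring_distribs mult_ac)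
  ultimately show ?thesis using assms by (simp add: balanced_def)
qed

text \<open>A left kernel vector without zero entries is absorbed into the equations, after which
  all entries 1 form a left kernel vector; this is balancedness.\<close>

lemma ex_balanced_rescaling:
  assumes "singular c" "c \<notin> {c. \<exists>l i\<^sub>0 i\<^sub>1. l i\<^sub>0 = 0 \<and> l i\<^sub>1 \<noteq> 0 \<and> (\<forall>u. (\<Sum>i\<in>UNIV. l i * row c i u) = 0)}"
  shows "\<exists>l. (\<forall>i. l i \<noteq> 0) \<and> balanced (\<lambda>(i, a). l i * extend c (i, a))"
proof -
  obtain l i where l: "l i \<noteq> 0" "\<And>u. (\<Sum>i\<in>UNIV. l i * row c i u) = 0"
    using assms(1) unfolding singular_iff_left_kernel by blast
  then have nz: "\<And>i. l i \<noteq> 0" using assms(2) by blast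
  have "balanced (\<lambda>(i, a). l i * extend c (i, a))"
  proof (rule balancedI)
    show "(\<Sum>a\<in>\<A> i. case (i, a) of (i, a) \<Rightarrow> l i * extend c (i, a)) = 0" for i
      using sum_extend[of c i] by (simp flip: sum_distrib_left)
    have "row (\<lambda>(i, a). l i * extend c (i, a)) i u = l i * row c i u" for i u
      unfolding row_extend[symmetric, of c] by (simp add: row_def sum_distrib_left mult_ac)
    then show "(\<Sum>i\<in>UNIV. row (\<lambda>(i, a). l i * extend c (i, a)) i u) = 0" for u using l(2) by simp
  qed
  with nz show ?thesis by blast
qed

text \<open>A density statement: after translation to the unit point, the singular coefficients are
  moved off the thin set where some left kernel vector has a zero entry, without making
  \<open>P\<close> vanish.\<close>

lemma ex_balanced_point:
  assumes "degenerate_coeffs \<A> c\<^sub>1" "polyfun \<Omega> P" "P c\<^sub>1 \<noteq> 0"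
  obtains s y m where "balanced s" "y \<in> torus" "P (\<lambda>(i, a). m i * monomial y a * s (i, a)) \<noteq> 0"
proof -
  obtain c y where c: "\<And>i. (\<Sum>a\<in>\<A> i. c (i, a)) = 0" "singular c" and y: "y \<in> torus"
    and c1: "\<And>i a. c\<^sub>1 (i, a) = monomial y a * c (i, a)"
    using degenerate_coeffsE[OF assms(1)] by blast
  let ?P = "\<lambda>c. P (\<lambda>(i, a). monomial y a * extend c (i, a))"
  have "polyfun (Y UNIV) (\<lambda>c. case v of (i, a) \<Rightarrow> monomial y a * extend c (i, a))" if "v \<in> \<Omega>" for v
    using that by (cases v) (auto intro!: polyfun.mult polyfun.const polyfun_extend)
  then have P: "polyfun (Y UNIV) ?P" by (rule polyfun_compose[OF assms(2)])
  have "?P c = P c\<^sub>1" by (rule polyfun_cong[OF assms(2)]) (auto simp: c1 extend_eq[OF c(1)])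
  with assms(3) have "?P c \<noteq> 0" by simp
  obtain w where w: "\<not> singular w" using ex_nonsingular by blast
  obtain c' where c': "singular c'" "?P c' \<noteq> 0"
    "c' \<notin> {c. \<exists>l i\<^sub>0 i\<^sub>1. l i\<^sub>0 = 0 \<and> l i\<^sub>1 \<noteq> 0 \<and> (\<forall>u. (\<Sum>i\<in>UNIV. l i * row c i u) = 0)}"
    using ex_singular_outside_thin[OF c(2) w thin_left_kernel P \<open>?P c \<noteq> 0\<close>] by blast
  obtain l where l: "\<And>i. l i \<noteq> 0" "balanced (\<lambda>(i, a). l i * extend c' (i, a))"
    using ex_balanced_rescaling[OF c'(1,3)] by blast
  have "(\<lambda>(i, a). 1 / l i * monomial y a * (case (i, a) of (i, a) \<Rightarrow> l i * extend c' (i, a)))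
      = (\<lambda>(i, a). monomial y a * extend c' (i, a))"
    using l(1) by (auto simp: fun_eq_iff)
  with c'(2) that[OF l(2) y, of "\<lambda>i. 1 / l i"] show ?thesis by simp
qed

text \<open>Clears the negative exponents, so that monomials become polynomials in the torus
  coordinates; the common factor this introduces can be absorbed into the coefficients.\<close>

definition shift :: "'n \<Rightarrow> nat" where
  "shift j = nat (Max (insert 0 ((\<lambda>v. - (snd v $ j)) ` \<Omega>)))"

lemma shift_ge: "(i, a) \<in> \<Omega> \<Longrightarrow> a $ j + int (shift j) \<ge> 0"
proof -
  assume "(i, a) \<in> \<Omega>"
  then have "- (a $ j) \<le> Max (insert 0 ((\<lambda>v. - (snd v $ j)) ` \<Omega>))"
    by (intro Max_ge) (auto intro!: rev_image_eqI[of "(i, a)"])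
  then show ?thesis by (simp add: shift_def)
qed

lemma shifted_monomial:
  assumes "(i, a) \<in> \<Omega>" "y \<in> torus"
  shows "(\<Prod>j\<in>UNIV. y $ j ^ nat (a $ j + int (shift j))) = (\<Prod>j\<in>UNIV. y $ j ^ shift j) * monomial y a"
  unfolding monomial_def prod.distrib[symmetric]
proof (rule prod.cong)
  fix j
  have "y $ j ^ nat (a $ j + int (shift j)) = y $ j powi (a $ j + int (shift j))"
    using shift_ge[OF assms(1), of j] by (simp add: power_int_def)
  then show "y $ j ^ nat (a $ j + int (shift j)) = y $ j ^ shift j * y $ j powi (a $ j)"
    using assms(2) by (simp add: torus_def power_int_add)
qed simp

text \<open>Balanced systems, torus points and multipliers are all joined by line segments, because
  the first and the last form linear spaces and the torus is the complement of hyperplanes. The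
  resulting polynomial curve is degenerate at almost all times, and univariate polynomials have no
  zero divisors.\<close>

lemma degenerate_coeffs_prime:
  assumes P: "polyfun \<Omega> P" and Q: "polyfun \<Omega> Q"
    and PQ: "\<And>c. degenerate_coeffs \<A> c \<Longrightarrow> P c * Q c = 0"
  shows "(\<forall>c. degenerate_coeffs \<A> c \<longrightarrow> P c = 0) \<or> (\<forall>c. degenerate_coeffs \<A> c \<longrightarrow> Q c = 0)"
proof (rule ccontr)
  assume "\<not> ?thesis"
  then obtain c1 c2 where c: "degenerate_coeffs \<A> c1" "P c1 \<noteq> 0" "degenerate_coeffs \<A> c2" "Q c2 \<noteq> 0" by blast
  obtain s1 y1 m1 where
    1: "balanced s1" "y1 \<in> torus" "P (\<lambda>(i, a). m1 i * monomial y1 a * s1 (i, a)) \<noteq> 0"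
    using ex_balanced_point[OF c(1) P c(2)] .
  obtain s2 y2 m2 where
    2: "balanced s2" "y2 \<in> torus" "Q (\<lambda>(i, a). m2 i * monomial y2 a * s2 (i, a)) \<noteq> 0"
    using ex_balanced_point[OF c(3) Q c(4)] .
  define N where "N = (\<lambda>y :: complex ^ 'n. \<Prod>j\<in>UNIV. y $ j ^ shift j)"
  have N: "N y \<noteq> 0" if "y \<in> torus" for y using that by (simp add: N_def torus_def)
  \<comment> \<open>The common factor \<open>N\<close> caused by the exponent shift is compensated
    in the multipliers at both ends of the curve.\<close>
  define m1' where "m1' = (\<lambda>i. m1 i / N y1)"
  define m2' where "m2' = (\<lambda>i. m2 i / N y2)"
  define y where "y = (\<lambda>t. \<chi> j. y1 $ j + t * (y2 $ j - y1 $ j))"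
  define s where "s = (\<lambda>t v. s1 v + t * (s2 v - s1 v))"
  define m where "m = (\<lambda>t i. m1' i + t * (m2' i - m1' i))"
  define q where "q = (\<lambda>(i, a). [:m1' i, m2' i - m1' i:] *
     (\<Prod>j\<in>UNIV. [:y1 $ j, y2 $ j - y1 $ j:] ^ nat (a $ j + int (shift j))) *
     [:s1 (i, a), s2 (i, a) - s1 (i, a):])"
  have q: "poly (q (i, a)) t = (m t i * N (y t)) * monomial (y t) a * s t (i, a)"
    if "(i, a) \<in> \<Omega>" "y t \<in> torus" for i a t
  proof -
    have "poly (q (i, a)) t = m t i * (\<Prod>j\<in>UNIV. y t $ j ^ nat (a $ j + int (shift j))) * s t (i, a)"
      unfolding q_def prod.case poly_mult poly_prod poly_power by (simp add: m_def s_def y_def)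
    then show ?thesis by (simp add: shifted_monomial[OF that] N_def mult.assoc)
  qed
  have bal: "balanced (s t)" for t
    using balanced_line[OF 1(1) balanced_line[OF 2(1) 1(1), of "-1"], of t] by (simp add: s_def)
  have deg: "degenerate_coeffs \<A> (\<lambda>v. poly (q v) t)" if t: "y t \<in> torus" for t
  proof (rule degenerate_coeffsI[OF _ balanced_singular[OF bal[of t]] t])
    show "(\<Sum>a\<in>\<A> i. s t (i, a)) = 0" for i using bal[of t] by (simp add: balanced_def)
    show "poly (q (i, a)) t = (m t i * N (y t)) * monomial (y t) a * s t (i, a)" if "a \<in> \<A> i" for i a
      using q[OF _ t] that by simp
  qed
  obtain p where "\<forall>t. P (\<lambda>v. poly (q v) t) = poly p t" using polyfun_curve[OF P, of q] ..
  then have p: "P (\<lambda>v. poly (q v) t) = poly p t" for t ..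
  obtain r where "\<forall>t. Q (\<lambda>v. poly (q v) t) = poly r t" using polyfun_curve[OF Q, of q] ..
  then have r: "Q (\<lambda>v. poly (q v) t) = poly r t" for t ..
  \<comment> \<open>The zeros of \<open>h\<close> are the finitely many times at which the line of
    torus points leaves the torus.\<close>
  define h where "h = (\<Prod>j\<in>UNIV. [:y1 $ j, y2 $ j - y1 $ j:])"
  have h: "poly h t \<noteq> 0 \<longleftrightarrow> y t \<in> torus" for t
    by (simp add: h_def poly_prod torus_def y_def)
  have "poly (p * r * h) t = 0" for t
    using PQ[OF deg[of t]] h[of t] by (auto simp: p r)
  then have "p * r * h = 0" using poly_all_0_iff_0 by blast
  moreover have y01: "y 0 = y1" "y 1 = y2" by (simp_all add: y_def vec_eq_iff)
  then have "poly h 0 \<noteq> 0" using h 1(2) by simp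
  moreover have "poly p 0 \<noteq> 0"
  proof -
    have "P (\<lambda>v. poly (q v) 0) = P (\<lambda>(i, a). m1 i * monomial y1 a * s1 (i, a))"
      by (rule polyfun_cong[OF P]) (use q[of _ _ 0] N 1(2) y01 in \<open>auto simp: m_def m1'_def s_def\<close>)
    with p[of 0] 1(3) show ?thesis by simp
  qed
  moreover have "poly r 1 \<noteq> 0"
  proof -
    have "Q (\<lambda>v. poly (q v) 1) = Q (\<lambda>(i, a). m2 i * monomial y2 a * s2 (i, a))"
      by (rule polyfun_cong[OF Q]) (use q[of _ _ 1] N 2(2) y01 in \<open>auto simp: m_def m2'_def s_def\<close>)
    with r[of 1] 2(3) show ?thesis by simp
  qed
  ultimately show False by auto
qed

lemma card_\<Omega>: "card \<Omega> = card (Y UNIV) + CARD('k)"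
proof -
  have "\<Omega> = Y UNIV \<union> range (\<lambda>i. (i, a\<^sub>0 i))" using base by (auto simp: rel_index_def support_set_def)
  moreover have "Y UNIV \<inter> range (\<lambda>i. (i, a\<^sub>0 i)) = {}" by (auto simp: rel_index_def)
  moreover have "card (range (\<lambda>i. (i, a\<^sub>0 i))) = CARD('k)" by (rule card_image) (auto simp: inj_on_def)
  ultimately show ?thesis by (simp add: card_Un_disjoint)
qed

text \<open>The root adds \<open>CARD('n)\<close> parameters to those of
  \<open>right_kernel_param\<close> with \<open>J = - I\<close>, and passing from
  \<open>Y UNIV\<close> to the full support adds equally many coordinates. By
  \<open>card I <= rank_of I\<close> at least one dimension is still missing.\<close>

lemma thin_degenerate_coeffs: "thin \<Omega> (\<lambda>_. 0) {c. degenerate_coeffs \<A> c}"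
proof -
  let ?T = "\<lambda>I. (\<lambda>y. rvec (E y)) ` Y I"
  let ?K = "\<lambda>I. {c. \<exists>u. u \<noteq> 0 \<and> (\<forall>t\<in>?T I. rpairing t u = 0) \<and>
      (\<forall>j\<in>- I. (\<exists>a\<in>\<A> j - {a\<^sub>0 j}. pairing (E (j, a)) u \<noteq> 0) \<and> row c j u = 0)}"
  let ?D = "\<lambda>I. {c'. \<exists>c y. c \<in> ?K I \<and> y \<in> torus \<and> (\<forall>(i, a)\<in>\<Omega>. c' (i, a) = (\<Prod>j\<in>UNIV. y $ j ^ nat (a $ j + int (shift j))) * extend c (i, a))}"
  have thin: "thin \<Omega> (\<lambda>_. 0) (?D I)" for I
  proof -
    obtain F :: "((('k \<times> (int ^ 'n)) + (real ^ 'n)) set \<times>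
          ('k \<times> (int ^ 'n) \<Rightarrow> (('k \<times> (int ^ 'n)) + (real ^ 'n) \<Rightarrow> complex) \<Rightarrow> complex)) set"
      where F: "finite F" "\<forall>(X, g)\<in>F. finite X \<and> card X + card (- I) + dim (?T I) + 1 = card (Y UNIV) + CARD('n) \<and>
        (\<forall>y\<in>Y UNIV. polyfun X (g y))" "?K I \<subseteq> (\<Union>(X, g)\<in>F. {c. \<exists>z. \<forall>y\<in>Y UNIV. c y = g y z})"
      using right_kernel_param[where T = "?T I" and J = "- I"] by (elim exE conjE)
    define G where "G = (\<lambda>(g :: 'k \<times> (int ^ 'n) \<Rightarrow> (('k \<times> (int ^ 'n)) + (real ^ 'n) \<Rightarrow> complex) \<Rightarrow> complex) v z.
       (\<Prod>j\<in>UNIV. z (Inr j) ^ nat (snd v $ j + int (shift j))) * extend (\<lambda>y. g y (\<lambda>x. z (Inl x))) v)"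
    have "thin \<Omega> (\<lambda>_. 0) (\<Union>p\<in>F. {c. \<exists>z. \<forall>v\<in>\<Omega>. c v = G (snd p) v z})"
    proof (rule thin_UN[OF F(1)])
      fix p assume p: "p \<in> F"
      then have *: "finite (fst p)" "card (fst p) + card (- I) + dim (?T I) + 1 = card (Y UNIV) + CARD('n)"
        "\<And>y. y \<in> Y UNIV \<Longrightarrow> polyfun (fst p) (snd p y)" using F(2) by (auto simp: case_prod_unfold)
      define X where "X = Inl ` fst p \<union> Inr ` (UNIV :: 'n set)"
      have X: "finite X" using *(1) by (simp add: X_def)
      have "card X = card (fst p) + CARD('n)"
        unfolding X_def using *(1) by (subst card_Un_disjoint) (auto simp: card_image)
      moreover have "card (- I) + card I = CARD('n)"
        using card_Un_disjoint[of I "- I"] CARD_eq by (simp add: Compl_partition)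
      ultimately have less: "card X < card \<Omega>"
        using *(2) card_le_rank[of I] by (simp add: card_\<Omega> CARD_eq rank_of_def)
      have "polyfun X (G (snd p) v)" if v: "v \<in> \<Omega>" for v
      proof -
        have "polyfun X (\<lambda>z. snd p y (\<lambda>x. z (Inl x)))" if "y \<in> Y UNIV" for y
          by (rule polyfun_compose[OF *(3)[OF that]]) (auto simp: X_def intro: polyfun.var)
        then have "polyfun X (\<lambda>z. extend (\<lambda>y. snd p y (\<lambda>x. z (Inl x))) v)"
          using polyfun_compose[OF polyfun_extend[of "fst v" "snd v"], of X "\<lambda>y z. snd p y (\<lambda>x. z (Inl x))"] v by simp
        moreover have "polyfun X (\<lambda>z. z (Inr j))" for j by (rule polyfun.var) (simp add: X_def)
        ultimately have "polyfun X (\<lambda>z. (\<Prod>j\<in>UNIV. z (Inr j) ^ nat (snd v $ j + int (shift j))) *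
            extend (\<lambda>y. snd p y (\<lambda>x. z (Inl x))) v)"
          by (intro polyfun.mult polyfun_prod polyfun_power)
        then show ?thesis by (simp add: G_def)
      qed
      then show "thin \<Omega> (\<lambda>_. 0) {c. \<exists>z. \<forall>v\<in>\<Omega>. c v = G (snd p) v z}"
        using less by (intro thin_image[OF X finite_\<Omega>]) auto
    qed
    then show ?thesis
    proof (rule thin_subset)
      show "?D I \<subseteq> (\<Union>p\<in>F. {c. \<exists>z. \<forall>v\<in>\<Omega>. c v = G (snd p) v z})"
      proof
        fix c' assume "c' \<in> ?D I"
        then have "\<exists>c y. c \<in> ?K I \<and> y \<in> torus \<and>
          (\<forall>(i, a)\<in>\<Omega>. c' (i, a) = (\<Prod>j\<in>UNIV. y $ j ^ nat (a $ j + int (shift j))) * extend c (i, a))"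
          by (rule CollectD)
        then obtain c where "\<exists>y. c \<in> ?K I \<and> y \<in> torus \<and>
          (\<forall>(i, a)\<in>\<Omega>. c' (i, a) = (\<Prod>j\<in>UNIV. y $ j ^ nat (a $ j + int (shift j))) * extend c (i, a))" ..
        then obtain y where cy: "c \<in> ?K I \<and> y \<in> torus \<and>
          (\<forall>(i, a)\<in>\<Omega>. c' (i, a) = (\<Prod>j\<in>UNIV. y $ j ^ nat (a $ j + int (shift j))) * extend c (i, a))" ..
        note c = cy[THEN conjunct1] and c' = cy[THEN conjunct2, THEN conjunct2]
        obtain p where p: "p \<in> F" "c \<in> (case p of (X, g) \<Rightarrow> {c. \<exists>z. \<forall>y\<in>Y UNIV. c y = g y z})"
          using subsetD[OF F(3) c] by (elim UN_E)
        then obtain z where z: "\<forall>y\<in>Y UNIV. c y = snd p y z" by (auto simp: case_prod_unfold)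
        have "extend (\<lambda>v. snd p v z) v = extend c v" if "v \<in> \<Omega>" for v
          using polyfun_cong[OF polyfun_extend[of "fst v" "snd v"], of "\<lambda>v. snd p v z" c] z that by simp
        then have "\<forall>v\<in>\<Omega>. c' v = G (snd p) v (\<lambda>x. case x of Inl x \<Rightarrow> z x | Inr j \<Rightarrow> y $ j)"
          using c' by (auto simp: G_def)
        then show "c' \<in> (\<Union>p\<in>F. {c. \<exists>z. \<forall>v\<in>\<Omega>. c v = G (snd p) v z})"
          by (intro UN_I[OF p(1)]) auto
      qed
    qed
  qed
  have "thin \<Omega> (\<lambda>_. 0) (\<Union>I\<in>UNIV. ?D I)"
    by (rule thin_UN) (use thin in auto)
  then show ?thesis
  proof (rule thin_subset)
    show "{c. degenerate_coeffs \<A> c} \<subseteq> (\<Union>I\<in>UNIV. ?D I)"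
    proof
      fix c' assume "c' \<in> {c. degenerate_coeffs \<A> c}"
      then obtain c y where c: "\<And>i. (\<Sum>a\<in>\<A> i. c (i, a)) = 0" "singular c" and y: "y \<in> torus"
        and c': "\<And>i a. c' (i, a) = monomial y a * c (i, a)"
        using degenerate_coeffsE by blast
      define N where "N = (\<Prod>j\<in>UNIV. y $ j ^ shift j)"
      have N: "N \<noteq> 0" using y by (simp add: N_def torus_def)
      define d where "d = (\<lambda>v. c v / N)"
      have d0: "(\<Sum>a\<in>\<A> i. d (i, a)) = 0" for i using c(1)[of i] by (simp add: d_def flip: sum_divide_distrib)
      obtain u where u: "u \<noteq> 0" "\<And>i. row c i u = 0" using c(2) unfolding singular_def by blast
      have ud: "row d i u = 0" for i using u(2)[of i] by (simp add: row_def d_def flip: sum_divide_distrib)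
      define I where "I = {i. \<forall>a\<in>\<A> i - {a\<^sub>0 i}. pairing (E (i, a)) u = 0}"
      have dK: "d \<in> ?K I" using rows_split[OF ud] u(1) unfolding I_def by blast
      have c'd: "\<forall>(i, a)\<in>\<Omega>. c' (i, a) = (\<Prod>j\<in>UNIV. y $ j ^ nat (a $ j + int (shift j))) * extend d (i, a)"
      proof -
        have "extend d (i, a) = c (i, a) / N" for i a unfolding extend_eq[OF d0] by (simp add: d_def)
        then show ?thesis using N y by (auto simp: shifted_monomial c' N_def[symmetric])
      qed
      have "c' \<in> ?D I"
        by (rule CollectI, rule exI[of _ d], rule exI[of _ y], intro conjI, rule dK, rule y, rule c'd)
      then show "c' \<in> (\<Union>I\<in>UNIV. ?D I)" by (rule UN_I[OF UNIV_I])
    qed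
  qed
qed

end

section \<open>Projecting the discriminant along a coordinate\<close>

lemma bounded_linear_pairing: "bounded_linear (pairing a)"
proof -
  have "linear (pairing a)"
    by (rule linearI) (simp_all add: pairing_def ring_distribs sum.distrib scaleR_sum_right)
  then show ?thesis by (simp add: linear_conv_bounded_linear)
qed

lemma monomial_exp: "monomial (\<chi> j. exp (z $ j)) a = exp (pairing a z)"
  by (simp add: monomial_def pairing_def exp_sum exp_power_int)

lemma has_derivative_vec_lambda:
  fixes f :: "'k::finite \<Rightarrow> 'a::real_normed_vector \<Rightarrow> 'b::euclidean_space"
  assumes "\<And>i. (f i has_derivative f' i) (at x)"
  shows "((\<lambda>x. \<chi> i. f i x) has_derivative (\<lambda>d. \<chi> i. f' i d)) (at x)"
proof -
  have "((\<lambda>x. (\<chi> i. f i x) \<bullet> b) has_derivative (\<lambda>d. (\<chi> i. f' i d) \<bullet> b)) (at x)"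
    if b: "b \<in> Basis" for b :: "'b ^ 'k"
  proof -
    obtain i c where "b = axis i c" using b by (auto simp: Basis_vec_def)
    then show ?thesis using has_derivative_inner_left[OF assms[of i], of c] by (simp add: inner_axis)
  qed
  then show ?thesis using has_derivative_componentwise_within by blast
qed

lemma linear_inj_right_inverse:
  fixes f :: "'a::euclidean_space \<Rightarrow> 'b::euclidean_space"
  assumes "linear f" "\<And>x. f x = 0 \<Longrightarrow> x = 0" "DIM('a) = DIM('b)"
  shows "\<exists>g. bounded_linear g \<and> f \<circ> g = id"
proof -
  have "inj f" using assms(1,2) by (simp add: linear_injective_0)
  then have "dim (range f) = dim (UNIV :: 'b set)"
    using dim_image_eq[OF assms(1), of UNIV] assms(3) by simp
  then have "span (range f) = UNIV" by (simp add: dim_eq_full)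
  moreover have "span (range f) = range f"
    using assms(1) by (simp add: linear_subspace_image span_eq_iff)
  ultimately have "surj f" by simp
  then obtain g where "linear g" "f \<circ> g = id" using linear_surjective_right_inverse[OF assms(1)] by blast
  then show ?thesis by (auto simp: linear_conv_bounded_linear)
qed

context irreducible_BK
begin

text \<open>
  At a nondegenerate critical situation the equations "the system degenerates at \<open>exp z\<close> with kernel
  vector \<open>\<eta>\<close>" can be solved for \<open>z\<close>, \<open>\<eta>\<close> and one coefficient \<open>\<tau>\<close> when all other coefficients are
  moved along a line; \<open>\<sigma>\<close> is the parameter of the line.
\<close>

lemma degenerate_coeffs_project_onto:
  assumes bal: "balanced s" and u: "u \<noteq> 0" "\<And>i. row s i u = 0"
    and ker: "\<And>\<eta>. (\<And>i. row s i \<eta> = 0) \<Longrightarrow> \<exists>k. \<eta> = k *s u"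
    and Q: "(\<Sum>i\<in>UNIV. \<Sum>a\<in>\<A> i. s (i, a) * (pairing a u)\<^sup>2) \<noteq> 0"
    and v: "v \<in> \<Omega>" and P: "polyfun (\<Omega> - {v}) P" "\<And>c. degenerate_coeffs \<A> c \<Longrightarrow> P c = 0"
  shows "P c = 0"
proof -
  define h where "h = (\<lambda>w. c w - s w)"
  obtain i\<^sub>0 v\<^sub>0 where v_eq: "v = (i\<^sub>0, v\<^sub>0)" "v\<^sub>0 \<in> \<A> i\<^sub>0" using v by (cases v) auto
  define \<delta> :: "'k \<times> (int ^ 'n) \<Rightarrow> complex" where "\<delta> = (\<lambda>w. if w = v then 1 else 0)"
  obtain j where j: "u $ j \<noteq> 0" using u(1) by (auto simp: vec_eq_iff)
  \<comment> \<open>For \<open>x = (z, \<eta>, \<tau>, \<sigma>)\<close>: the point with parameter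
    \<sigma> on the line from \<open>s\<close> to \<open>c\<close>, with the coefficient at
    \<open>v\<close> corrected by \<tau>.\<close>
  define C where "C = (\<lambda>x :: (complex ^ 'n) \<times> (complex ^ 'n) \<times> complex \<times> complex.
     \<lambda>w. s w + snd (snd (snd x)) * h w + fst (snd (snd x)) * \<delta> w)"
  \<comment> \<open>Zeros of the first two components are degenerate roots \<open>exp z\<close> with
    kernel vector \<eta>. The last two fix the free scale of \<eta> and the position on the line,
    which makes source and target dimensions equal.\<close>
  define G where "G = (\<lambda>x. ((\<chi> i. \<Sum>a\<in>\<A> i. C x (i, a) * exp (pairing a (fst x))) :: complex ^ 'k,
     (\<chi> i. \<Sum>a\<in>\<A> i. C x (i, a) * (exp (pairing a (fst x)) * pairing a (fst (snd x)))) :: complex ^ 'k,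
     fst (snd x) $ j, snd (snd (snd x))))"
  define x0 :: "(complex ^ 'n) \<times> (complex ^ 'n) \<times> complex \<times> complex" where "x0 = (0, u, 0, 0)"
  define dC where "dC = (\<lambda>d :: (complex ^ 'n) \<times> (complex ^ 'n) \<times> complex \<times> complex.
     \<lambda>w. snd (snd (snd d)) * h w + fst (snd (snd d)) * \<delta> w)"
  define G' where "G' = (\<lambda>d. ((\<chi> i. \<Sum>a\<in>\<A> i. dC d (i, a) + s (i, a) * pairing a (fst d)) :: complex ^ 'k,
     (\<chi> i. \<Sum>a\<in>\<A> i. dC d (i, a) * pairing a u + s (i, a) * (pairing a (fst (snd d)) + pairing a u * pairing a (fst d))) :: complex ^ 'k,
     fst (snd d) $ j, snd (snd (snd d))))"
  have s0: "(\<Sum>a\<in>\<A> i. s (i, a)) = 0" for i using bal by (simp add: balanced_def)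
  have sbal: "(\<Sum>i\<in>UNIV. \<Sum>a\<in>\<A> i. s (i, a) * pairing a w) = 0" for w using bal by (simp add: balanced_def)
  have row: "(\<Sum>a\<in>\<A> i. s (i, a) * pairing a w) = row s i w" for i w by (rule row_alt[OF s0])
  have der: "(G has_derivative G') (at x0)"
  proof -
    have dpair: "((\<lambda>x. pairing a (f x)) has_derivative (\<lambda>d. pairing a (f' d))) (at x0)"
      if "(f has_derivative f') (at x0)" for a and f f' :: "_ \<Rightarrow> complex ^ 'n"
      by (rule bounded_linear.has_derivative[OF bounded_linear_pairing that])
    have e: "((\<lambda>x. exp (pairing a (fst x))) has_derivative (\<lambda>d. pairing a (fst d))) (at x0)" for a
    proof -
      have "((\<lambda>x. pairing a (fst x)) has_derivative (\<lambda>d. pairing a (fst d))) (at x0)"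
        by (rule dpair, rule has_derivative_fst, rule has_derivative_ident)
      moreover have "(exp has_derivative (\<lambda>d. exp (pairing a (fst x0)) * d)) (at (pairing a (fst x0)))"
        using DERIV_exp[of "pairing a (fst x0)"] by (simp add: has_field_derivative_def)
      ultimately have "((\<lambda>x. exp (pairing a (fst x))) has_derivative
          (\<lambda>d. exp (pairing a (fst x0)) * pairing a (fst d))) (at x0)"
        by (rule has_derivative_compose)
      then show ?thesis by (simp add: x0_def)
    qed
    have C: "((\<lambda>x. C x w) has_derivative (\<lambda>d. dC d w)) (at x0)" for w
    proof -
      have "((\<lambda>x. s w + snd (snd (snd x)) * h w + fst (snd (snd x)) * \<delta> w) has_derivative
          (\<lambda>d. 0 + snd (snd (snd d)) * h w + fst (snd (snd d)) * \<delta> w)) (at x0)"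
        by (intro has_derivative_add has_derivative_const has_derivative_mult_left
            has_derivative_fst has_derivative_snd has_derivative_ident)
      then show ?thesis by (simp add: C_def dC_def)
    qed
    have eta: "((\<lambda>x. pairing a (fst (snd x))) has_derivative (\<lambda>d. pairing a (fst (snd d)))) (at x0)" for a
      by (rule dpair, rule has_derivative_fst, rule has_derivative_snd, rule has_derivative_ident)
    have C0: "C x0 w = s w" for w by (simp add: C_def x0_def)
    have e0: "pairing a (fst x0) = 0" "fst (snd x0) = u" for a by (simp_all add: x0_def)
    have 1: "((\<lambda>x. C x (i, a) * exp (pairing a (fst x))) has_derivative
        (\<lambda>d. dC d (i, a) + s (i, a) * pairing a (fst d))) (at x0)" for i a
      by (rule has_derivative_eq_rhs[OF has_derivative_mult[OF C e]]) (simp add: C0 e0 fun_eq_iff)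
    have 2: "((\<lambda>x. C x (i, a) * (exp (pairing a (fst x)) * pairing a (fst (snd x)))) has_derivative
        (\<lambda>d. dC d (i, a) * pairing a u + s (i, a) * (pairing a (fst (snd d)) + pairing a u * pairing a (fst d)))) (at x0)" for i a
      by (rule has_derivative_eq_rhs[OF has_derivative_mult[OF C has_derivative_mult[OF e eta]]])
        (simp add: C0 e0 fun_eq_iff mult_ac)
    show ?thesis unfolding G_def G'_def
      by (intro has_derivative_Pair has_derivative_vec_lambda has_derivative_sum 1 2
          bounded_linear.has_derivative[OF bounded_linear_vec_nth]
          has_derivative_fst has_derivative_snd has_derivative_ident)
  qed
  have cont: "continuous_on UNIV G"
    unfolding G_def C_def
    by (intro continuous_intros bounded_linear.continuous_on[OF bounded_linear_pairing])
  have "linear G'" using has_derivative_linear[OF der] .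
  moreover have "d = 0" if d: "G' d = 0" for d
  proof -
    obtain \<xi> \<omega> \<tau> \<sigma> where d_eq: "d = (\<xi>, \<omega>, \<tau>, \<sigma>)" by (cases d) auto
    have \<sigma>: "\<sigma> = 0" and \<omega>j: "\<omega> $ j = 0" using d by (auto simp: G'_def d_eq zero_prod_def)
    have d1: "(\<Sum>a\<in>\<A> i. \<tau> * \<delta> (i, a) + s (i, a) * pairing a \<xi>) = 0" for i
      using d \<sigma> by (auto simp: G'_def dC_def d_eq zero_prod_def vec_eq_iff)
    have d2: "(\<Sum>a\<in>\<A> i. \<tau> * \<delta> (i, a) * pairing a u + s (i, a) * (pairing a \<omega> + pairing a u * pairing a \<xi>)) = 0" for i
      using d \<sigma> by (auto simp: G'_def dC_def d_eq zero_prod_def vec_eq_iff)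
    have \<delta>sum: "(\<Sum>a\<in>\<A> i. \<tau> * \<delta> (i, a)) = (if i = i\<^sub>0 then \<tau> else 0)" for i
      using v_eq fin by (simp add: \<delta>_def if_distrib cong: if_cong)
    \<comment> \<open>Summed over all equations, the terms in \<xi> cancel by balancedness and only
      \<tau> survives.\<close>
    have "0 = (\<Sum>i\<in>UNIV. \<Sum>a\<in>\<A> i. \<tau> * \<delta> (i, a) + s (i, a) * pairing a \<xi>)" using d1 by simp
    also have "\<dots> = \<tau>" by (simp add: sum.distrib sbal \<delta>sum)
    finally have \<tau>: "\<tau> = 0" ..
    have "row s i \<xi> = 0" for i using d1[of i] by (simp add: \<tau> row)
    then obtain k where k: "\<xi> = k *s u" using ker by blast
    \<comment> \<open>The same summation removes \<omega> and leaves \<open>k\<close> times the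
      nonzero Hessian.\<close>
    have "0 = (\<Sum>i\<in>UNIV. \<Sum>a\<in>\<A> i. s (i, a) * (pairing a \<omega> + pairing a u * pairing a \<xi>))"
      using d2 by (simp add: \<tau>)
    also have "\<dots> = (\<Sum>i\<in>UNIV. \<Sum>a\<in>\<A> i. s (i, a) * pairing a \<omega>) + k * (\<Sum>i\<in>UNIV. \<Sum>a\<in>\<A> i. s (i, a) * (pairing a u)\<^sup>2)"
      by (simp add: k pairing_scale ring_distribs sum.distrib sum_distrib_left power2_eq_square mult_ac)
    finally have "k = 0" using Q by (simp add: sbal)
    then have \<xi>: "\<xi> = 0" by (simp add: k)
    have "row s i \<omega> = 0" for i using d2[of i] by (simp add: \<tau> \<xi> row)
    then obtain k' where k': "\<omega> = k' *s u" using ker by blast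
    with \<omega>j j have "k' = 0" by simp
    with k' show ?thesis by (simp add: d_eq \<sigma> \<tau> \<xi> zero_prod_def)
  qed
  moreover have "DIM((complex ^ 'n) \<times> (complex ^ 'n) \<times> complex \<times> complex) =
      DIM((complex ^ 'k) \<times> (complex ^ 'k) \<times> complex \<times> complex)"
    using CARD_eq by simp
  ultimately obtain g' where g': "bounded_linear g'" "G' \<circ> g' = id"
    using linear_inj_right_inverse[of G'] by blast
  have "G x0 \<in> interior (G ` UNIV)"
    by (rule sussmann_open_mapping[OF open_UNIV cont UNIV_I der g']) auto
  then obtain \<epsilon> where \<epsilon>: "\<epsilon> > 0" "ball (G x0) \<epsilon> \<subseteq> range G" unfolding mem_interior by auto
  have Gx0: "G x0 = (0, 0, u $ j, 0)"
    by (simp add: G_def C_def x0_def s0 row u(2) vec_eq_iff)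
  have zero: "P (\<lambda>w. s w + \<sigma> * h w) = 0" if \<sigma>: "norm \<sigma> < \<epsilon>" for \<sigma>
  proof -
    have "dist (G x0) (0, 0, u $ j, \<sigma>) = norm \<sigma>"
      by (simp add: Gx0 dist_Pair_Pair)
    then have "(0, 0, u $ j, \<sigma>) \<in> range G" using \<epsilon>(2) \<sigma> by (auto simp: subset_iff)
    then obtain x where x: "(0, 0, u $ j, \<sigma>) = G x" by (rule rangeE)
    have x1: "(\<Sum>a\<in>\<A> i. C x (i, a) * exp (pairing a (fst x))) = 0" for i
      using x by (auto simp: G_def vec_eq_iff)
    have x2: "(\<Sum>a\<in>\<A> i. C x (i, a) * (exp (pairing a (fst x)) * pairing a (fst (snd x)))) = 0" for i
      using x by (auto simp: G_def vec_eq_iff)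
    have x3: "fst (snd x) \<noteq> 0" "snd (snd (snd x)) = \<sigma>" using x j by (auto simp: G_def)
    have "degenerate_coeffs \<A> (C x)"
      unfolding degenerate_coeffs_def
    proof (intro bexI conjI allI exI)
      show "(\<chi> j. exp (fst x $ j)) \<in> torus" by (simp add: torus_def)
      show "(\<Sum>a\<in>\<A> i. C x (i, a) * monomial (\<chi> j. exp (fst x $ j)) a) = 0" for i
        using x1 by (simp add: monomial_exp)
      show "fst (snd x) \<noteq> 0" by (rule x3)
      show "(\<Sum>a\<in>\<A> i. C x (i, a) * monomial (\<chi> j. exp (fst x $ j)) a * pairing a (fst (snd x))) = 0" for i
        using x2 by (simp add: monomial_exp mult.assoc)
    qed
    then have "P (C x) = 0" by (rule P(2))
    \<comment> \<open>\<open>P\<close> does not involve the coordinate \<open>v\<close>, hence does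
      not see the correction \<tau>.\<close>
    moreover have "P (C x) = P (\<lambda>w. s w + \<sigma> * h w)"
      by (rule polyfun_cong[OF P(1)]) (auto simp: C_def \<delta>_def x3)
    ultimately show ?thesis by simp
  qed
  obtain p where "\<forall>t. P (\<lambda>w. s w + t * h w) = poly p t" using polyfun_line[OF P(1), of s h] ..
  then have p: "P (\<lambda>w. s w + t * h w) = poly p t" for t ..
  have "p = 0"
  proof (rule ccontr)
    assume "p \<noteq> 0"
    then have "finite {t. poly p t = 0}" by (rule poly_roots_finite)
    moreover have "ball 0 \<epsilon> \<subseteq> {t. poly p t = 0}" using zero p by (auto simp: dist_norm)
    ultimately have "finite (ball (0::complex) \<epsilon>)" by (rule finite_subset[rotated])
    then show False using uncountable_ball[OF \<epsilon>(1), of "0 :: complex"] countable_finite by blast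
  qed
  then have "P (\<lambda>w. s w + h w) = 0" using p[of 1] by simp
  then show ?thesis by (simp add: h_def)
qed

end

section \<open>Vanishing Hessians\<close>

lemma field_differentiable_prod:
  fixes f :: "'i \<Rightarrow> complex \<Rightarrow> complex"
  assumes "\<And>i. i \<in> I \<Longrightarrow> f i field_differentiable (at x)"
  shows "(\<lambda>z. \<Prod>i\<in>I. f i z) field_differentiable (at x)"
  using assms by (induction I rule: infinite_finite_induct) (auto intro: field_differentiable_mult)

lemma field_differentiable_det:
  fixes A :: "complex \<Rightarrow> complex ^ 'n::finite ^ 'n"
  assumes "\<And>i j. (\<lambda>z. A z $ i $ j) field_differentiable (at x)"
  shows "(\<lambda>z. det (A z)) field_differentiable (at x)"
  unfolding det_def
  by (intro field_differentiable_sum field_differentiable_mult field_differentiable_const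
      field_differentiable_prod assms)

lemma ex_interpolating_poly:
  fixes f :: "complex \<Rightarrow> complex"
  assumes "finite V"
  shows "\<exists>p. \<forall>x\<in>V. poly p x = f x"
  using assms
proof (induction rule: finite_induct)
  case (insert x V)
  then obtain p where p: "\<forall>y\<in>V. poly p y = f y" by blast
  define q where "q = (\<Prod>y\<in>V. [:- y, 1:])"
  have "poly q x \<noteq> 0" using insert by (auto simp: q_def poly_prod)
  moreover have "poly q y = 0" if "y \<in> V" for y using that insert by (auto simp: q_def poly_prod)
  ultimately have "\<forall>y\<in>insert x V. poly (p + smult ((f x - poly p x) / poly q x) q) y = f y"
    using p by auto
  then show ?case by blast
qed auto

text \<open>
  If \<open>r s\<close> annihilates the linear space \<open>S\<close> and \<open>r s * s\<close> annihilates the annihilator of \<open>S\<close>,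
  differentiating both relations in a direction \<open>h\<close> gives \<open>\<Sum> h * (r s) ^ (k + 1) = 0\<close> from the
  corresponding relation for \<open>k\<close>: the term with the derivative of \<open>r\<close> drops out.
\<close>

lemma powers_annihilate:
  fixes r :: "('v \<Rightarrow> complex) \<Rightarrow> 'v \<Rightarrow> complex"
  assumes line: "\<And>s h t. s \<in> S \<Longrightarrow> h \<in> S \<Longrightarrow> (\<lambda>v. s v + t * h v) \<in> S"
    and K: "\<And>s h. s \<in> S \<Longrightarrow> K s \<Longrightarrow> h \<in> S \<Longrightarrow> \<forall>\<^sub>F \<epsilon> in nhds 0. K (\<lambda>v. s v + \<epsilon> * h v)"
    and r: "\<And>s h. s \<in> S \<Longrightarrow> K s \<Longrightarrow> h \<in> S \<Longrightarrow> (\<Sum>v\<in>\<Omega>. h v * r s v) = 0"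
    and rs: "\<And>s q. s \<in> S \<Longrightarrow> K s \<Longrightarrow> (\<And>h. h \<in> S \<Longrightarrow> (\<Sum>v\<in>\<Omega>. h v * q v) = 0) \<Longrightarrow>
      (\<Sum>v\<in>\<Omega>. r s v * s v * q v) = 0"
    and diff: "\<And>s h v. s \<in> S \<Longrightarrow> K s \<Longrightarrow> h \<in> S \<Longrightarrow>
      (\<lambda>\<epsilon>. r (\<lambda>v. s v + \<epsilon> * h v) v) field_differentiable (at 0)"
    and s: "s \<in> S" "K s" "h \<in> S"
  shows "(\<Sum>v\<in>\<Omega>. h v * r s v ^ Suc k) = 0"
  using s
proof (induction k arbitrary: s h)
  case 0
  then show ?case using r by simp
next
  case (Suc k)
  define R where "R = (\<lambda>\<epsilon>. r (\<lambda>v. s v + \<epsilon> * h v))"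
  define \<rho> where "\<rho> = (\<lambda>v. deriv (\<lambda>\<epsilon>. R \<epsilon> v) 0)"
  have R0: "R 0 = r s" by (simp add: R_def)
  have der: "((\<lambda>\<epsilon>. R \<epsilon> v) has_field_derivative \<rho> v) (at 0)" for v
    using diff[OF Suc.prems, of v] unfolding R_def \<rho>_def by (simp add: field_differentiable_derivI)
  have near: "\<forall>\<^sub>F \<epsilon> in nhds 0. K (\<lambda>v. s v + \<epsilon> * h v)" by (rule K[OF Suc.prems])
  have zero: "D = 0" if "(f has_field_derivative D) (at 0)" "\<forall>\<^sub>F \<epsilon> in nhds 0. f \<epsilon> = 0" for f and D :: complex
  proof -
    have "((\<lambda>_. 0) has_field_derivative D) (at 0)"
      using DERIV_cong_ev[OF refl that(2) refl] that(1) by blast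
    then show ?thesis using DERIV_unique DERIV_const by blast
  qed
  \<comment> \<open>The derivative of the induction hypothesis, with the test vector
    \<open>g\<close> fixed: \<open>(r s)^k \<rho>\<close> annihilates \<open>S\<close>.\<close>
  have 1: "(\<Sum>v\<in>\<Omega>. g v * (r s v ^ k * \<rho> v)) = 0" if g: "g \<in> S" for g
  proof -
    have "((\<lambda>\<epsilon>. \<Sum>v\<in>\<Omega>. g v * R \<epsilon> v ^ Suc k) has_field_derivative
        (\<Sum>v\<in>\<Omega>. g v * (of_nat (Suc k) * (\<rho> v * R 0 v ^ k)))) (at 0)"
      using DERIV_power[OF der, where n = "Suc k"] by (intro DERIV_sum DERIV_cmult) (simp add: mult_ac)
    moreover have "\<forall>\<^sub>F \<epsilon> in nhds 0. (\<Sum>v\<in>\<Omega>. g v * R \<epsilon> v ^ Suc k) = 0"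
      using near unfolding R_def
      by (rule eventually_mono) (use Suc.IH[OF line[OF Suc.prems(1,3)] _ g] in blast)
    ultimately have "(\<Sum>v\<in>\<Omega>. g v * (of_nat (Suc k) * (\<rho> v * R 0 v ^ k))) = 0" by (rule zero)
    also have "(\<Sum>v\<in>\<Omega>. g v * (of_nat (Suc k) * (\<rho> v * R 0 v ^ k)))
        = of_nat (Suc k) * (\<Sum>v\<in>\<Omega>. g v * (r s v ^ k * \<rho> v))"
      by (simp only: R0 sum_distrib_left mult_ac)
    finally show ?thesis by (simp del: of_nat_Suc)
  qed
  \<comment> \<open>The derivative of relation \<open>rs\<close>, with the annihilating factor
    \<open>(r s)^(k + 1)\<close> frozen at \<epsilon> = 0.\<close>
  have 2: "(\<Sum>v\<in>\<Omega>. (\<rho> v * s v + h v * r s v) * r s v ^ Suc k) = 0"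
  proof -
    have "((\<lambda>\<epsilon>. R \<epsilon> v * (s v + \<epsilon> * h v)) has_field_derivative (\<rho> v * s v + h v * r s v)) (at 0)" for v
      by (rule derivative_eq_intros der refl)+ (simp add: R0)
    then have "((\<lambda>\<epsilon>. \<Sum>v\<in>\<Omega>. R \<epsilon> v * (s v + \<epsilon> * h v) * r s v ^ Suc k) has_field_derivative
        (\<Sum>v\<in>\<Omega>. (\<rho> v * s v + h v * r s v) * r s v ^ Suc k)) (at 0)"
      by (intro DERIV_sum DERIV_cmult_right)
    moreover have "\<forall>\<^sub>F \<epsilon> in nhds 0. (\<Sum>v\<in>\<Omega>. R \<epsilon> v * (s v + \<epsilon> * h v) * r s v ^ Suc k) = 0"
      using near unfolding R_def
    proof (rule eventually_mono)
      fix \<epsilon> assume "K (\<lambda>v. s v + \<epsilon> * h v)"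
      from rs[OF line[OF Suc.prems(1,3)] this, where q = "\<lambda>v. r s v ^ Suc k"] Suc.IH[OF Suc.prems(1,2)]
      show "(\<Sum>v\<in>\<Omega>. r (\<lambda>v. s v + \<epsilon> * h v) v * (s v + \<epsilon> * h v) * r s v ^ Suc k) = 0" by blast
    qed
    ultimately show ?thesis by (rule zero)
  qed
  \<comment> \<open>By 1 the function \<open>(r s)^k \<rho>\<close> is itself admissible in
    \<open>rs\<close>; this removes the term of 2 that contains \<rho>.\<close>
  have "(\<Sum>v\<in>\<Omega>. r s v * s v * (r s v ^ k * \<rho> v)) = 0"
    by (rule rs[OF Suc.prems(1,2) 1])
  moreover have "(\<Sum>v\<in>\<Omega>. (\<rho> v * s v + h v * r s v) * r s v ^ Suc k)
      = (\<Sum>v\<in>\<Omega>. r s v * s v * (r s v ^ k * \<rho> v)) + (\<Sum>v\<in>\<Omega>. h v * r s v ^ Suc (Suc k))"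
    by (simp add: algebra_simps sum.distrib)
  ultimately show ?case using 2 by simp
qed

definition dot :: "complex ^ 'n::finite \<Rightarrow> complex ^ 'n \<Rightarrow> complex" where
  "dot x u = (\<Sum>j\<in>UNIV. x $ j * u $ j)"

lemma dot_axis [simp]: "dot (axis j 1) u = u $ j"
  by (simp add: dot_def axis_def if_distribR if_distrib cong: if_cong)

lemma dot_diff_scale: "dot x (a - k *s b) = dot x a - k * dot x b"
  by (simp add: dot_def ring_distribs sum_subtractf sum_distrib_left mult_ac)

lemma matrix_mult_dot: "(M *v u) $ l = dot (M $ l) u"
  by (simp add: dot_def matrix_vector_mult_def)

lemma invertible_kernel: "det M \<noteq> 0 \<Longrightarrow> M *v x = 0 \<Longrightarrow> x = (0 :: complex ^ 'n::finite)"
  by (metis invertible_det_nz invertible_left_inverse matrix_left_invertible_ker)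

context irreducible_BK
begin

lemma sum_\<Omega>: "sum f \<Omega> = (\<Sum>i\<in>UNIV. \<Sum>a\<in>\<A> i. f (i, a))"
  by (simp add: support_set_def sum.Sigma fin)

text \<open>
  The cofactors of row \<open>l\<^sub>1\<close> of the Jacobian of a balanced system form a kernel vector depending
  polynomially on the system.
\<close>

definition bordered :: "'n \<Rightarrow> complex ^ 'n \<Rightarrow> ('k \<times> (int ^ 'n) \<Rightarrow> complex) \<Rightarrow> complex ^ 'n ^ 'n" where
  "bordered l\<^sub>1 x s = (\<chi> l. if l = l\<^sub>1 then x else log_jacobian s $ l)"

definition kernel_vector :: "'n \<Rightarrow> ('k \<times> (int ^ 'n) \<Rightarrow> complex) \<Rightarrow> complex ^ 'n" where
  "kernel_vector l\<^sub>1 s = (\<chi> j. det (bordered l\<^sub>1 (axis j 1) s))"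

lemma det_bordered: "det (bordered l\<^sub>1 x s) = dot x (kernel_vector l\<^sub>1 s)"
proof -
  have "det (bordered l\<^sub>1 x s) = det (\<chi> l. if l = l\<^sub>1 then (\<Sum>j\<in>UNIV. x $ j *s axis j 1) else log_jacobian s $ l)"
    by (subst basis_expansion) (simp add: bordered_def)
  also have "\<dots> = (\<Sum>j\<in>UNIV. det (\<chi> l. if l = l\<^sub>1 then x $ j *s axis j 1 else log_jacobian s $ l))"
    by (rule det_linear_row_sum) simp
  also have "\<dots> = dot x (kernel_vector l\<^sub>1 s)"
    by (simp add: det_row_mul dot_def kernel_vector_def bordered_def)
  finally show ?thesis .
qed

lemma row_dot: "row s (idx l) u = dot (log_jacobian s $ l) u"
  by (simp add: log_jacobian_mult[symmetric] matrix_mult_dot)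

lemma ex_idx: "\<exists>l. i = idx l"
  using bij_is_surj[OF bij_idx] by (metis surjD)

text \<open>Bordering by a row of the Jacobian gives either the singular Jacobian itself or a matrix
  with a repeated row.\<close>

lemma kernel_vector_row:
  assumes "balanced s"
  shows "row s i (kernel_vector l\<^sub>1 s) = 0"
proof -
  obtain l where i: "i = idx l" using ex_idx by blast
  have "det (bordered l\<^sub>1 (log_jacobian s $ l) s) = 0"
  proof (cases "l = l\<^sub>1")
    case True
    then have "bordered l\<^sub>1 (log_jacobian s $ l) s = log_jacobian s" by (simp add: bordered_def vec_eq_iff)
    then show ?thesis using balanced_singular[OF assms] by (simp add: singular_iff_det)
  next
    case False
    then show ?thesis
      by (intro det_identical_rows[of l l\<^sub>1]) (auto simp: Finite_Cartesian_Product.row_def bordered_def vec_eq_iff)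
  qed
  then show ?thesis by (simp add: i row_dot det_bordered)
qed

text \<open>If \<open>p\<close> does not annihilate the kernel vector, the bordered matrix is
  invertible. It kills \<eta> minus the multiple of the kernel vector with the same product with
  \<open>p\<close>.\<close>

lemma kernel_is_line:
  assumes "balanced s" "dot p (kernel_vector l\<^sub>1 s) \<noteq> 0" "\<And>i. row s i \<eta> = 0"
  shows "\<exists>k. \<eta> = k *s kernel_vector l\<^sub>1 s"
proof -
  define u where "u = kernel_vector l\<^sub>1 s"
  define k where "k = dot p \<eta> / dot p u"
  have k: "dot p \<eta> - k * dot p u = 0" using assms(2) by (simp add: k_def u_def)
  have "dot (log_jacobian s $ l) \<eta> - k * dot (log_jacobian s $ l) u = 0" for l
    using assms(3)[of "idx l"] kernel_vector_row[OF assms(1), of "idx l" l\<^sub>1]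
    by (simp add: row_dot u_def)
  with k have "dot (bordered l\<^sub>1 p s $ l) (\<eta> - k *s u) = 0" for l
    unfolding dot_diff_scale by (cases "l = l\<^sub>1") (simp_all add: bordered_def)
  then have "bordered l\<^sub>1 p s *v (\<eta> - k *s u) = 0"
    by (subst vec_eq_iff) (simp add: matrix_mult_dot)
  moreover have "det (bordered l\<^sub>1 p s) \<noteq> 0" using assms(2) by (simp add: det_bordered)
  ultimately have "\<eta> - k *s u = 0" by (rule invertible_kernel[rotated])
  then show ?thesis unfolding u_def by (intro exI[of _ k]) simp
qed

text \<open>The second derivative at the unit point of the sum of all equations along the
  one-parameter subgroup generated by the kernel vector.\<close>

definition hessian :: "'n \<Rightarrow> ('k \<times> (int ^ 'n) \<Rightarrow> complex) \<Rightarrow> complex" where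
  "hessian l\<^sub>1 s = (\<Sum>i\<in>UNIV. \<Sum>a\<in>\<A> i. s (i, a) * (pairing a (kernel_vector l\<^sub>1 s))\<^sup>2)"

text \<open>
  \<open>tangent\<close> is the function \<open>r\<close> from the introduction; the multipliers are the coefficients in the
  expansion of \<open>moment\<close> in the rows of \<open>bordered\<close>, by Cramer's rule.
\<close>

definition moment :: "'n \<Rightarrow> ('k \<times> (int ^ 'n) \<Rightarrow> complex) \<Rightarrow> complex ^ 'n" where
  "moment l\<^sub>1 s = (\<chi> j. \<Sum>i\<in>UNIV. \<Sum>a\<in>\<A> i. s (i, a) * pairing a (kernel_vector l\<^sub>1 s) * of_int (a $ j))"

definition multiplier :: "'n \<Rightarrow> complex ^ 'n \<Rightarrow> ('k \<times> (int ^ 'n) \<Rightarrow> complex) \<Rightarrow> 'n \<Rightarrow> complex" where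
  "multiplier l\<^sub>1 p s k =
     det (\<chi> i j. if j = k then moment l\<^sub>1 s $ i else transpose (bordered l\<^sub>1 p s) $ i $ j) / det (bordered l\<^sub>1 p s)"

definition tangent :: "'n \<Rightarrow> complex ^ 'n \<Rightarrow> ('k \<times> (int ^ 'n) \<Rightarrow> complex) \<Rightarrow> 'k \<times> (int ^ 'n) \<Rightarrow> complex" where
  "tangent l\<^sub>1 p s v = pairing (snd v) (kernel_vector l\<^sub>1 s) - multiplier l\<^sub>1 p s (inv idx (fst v))"

lemma dot_moment: "dot (moment l\<^sub>1 s) w = (\<Sum>i\<in>UNIV. \<Sum>a\<in>\<A> i. s (i, a) * pairing a (kernel_vector l\<^sub>1 s) * pairing a w)"
proof -
  have "dot (moment l\<^sub>1 s) w = (\<Sum>j\<in>UNIV. \<Sum>i\<in>UNIV. \<Sum>a\<in>\<A> i. s (i, a) * pairing a (kernel_vector l\<^sub>1 s) * (of_int (a $ j) * w $ j))"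
    by (simp add: dot_def moment_def sum_distrib_right mult.assoc)
  also have "\<dots> = (\<Sum>i\<in>UNIV. \<Sum>j\<in>UNIV. \<Sum>a\<in>\<A> i. s (i, a) * pairing a (kernel_vector l\<^sub>1 s) * (of_int (a $ j) * w $ j))"
    by (rule sum.swap)
  also have "\<dots> = (\<Sum>i\<in>UNIV. \<Sum>a\<in>\<A> i. \<Sum>j\<in>UNIV. s (i, a) * pairing a (kernel_vector l\<^sub>1 s) * (of_int (a $ j) * w $ j))"
    by (intro sum.cong sum.swap refl)
  finally show ?thesis by (simp add: pairing_def sum_distrib_left)
qed

lemma multiplier_solves:
  assumes "dot p (kernel_vector l\<^sub>1 s) \<noteq> 0"
  shows "(\<Sum>l\<in>UNIV. multiplier l\<^sub>1 p s l * dot (bordered l\<^sub>1 p s $ l) w) = dot (moment l\<^sub>1 s) w"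
proof -
  let ?M = "bordered l\<^sub>1 p s"
  have "transpose ?M *v (\<chi> k. multiplier l\<^sub>1 p s k) = moment l\<^sub>1 s"
    using cramer[of "transpose ?M" "\<chi> k. multiplier l\<^sub>1 p s k" "moment l\<^sub>1 s"] assms
    by (simp add: multiplier_def det_bordered)
  then have "moment l\<^sub>1 s $ j = (transpose ?M *v (\<chi> k. multiplier l\<^sub>1 p s k)) $ j" for j by simp
  then have "moment l\<^sub>1 s $ j = (\<Sum>l\<in>UNIV. multiplier l\<^sub>1 p s l * ?M $ l $ j)" for j
    by (simp add: matrix_vector_mult_def transpose_def mult.commute)
  then have "dot (moment l\<^sub>1 s) w = (\<Sum>j\<in>UNIV. \<Sum>l\<in>UNIV. multiplier l\<^sub>1 p s l * (?M $ l $ j * w $ j))"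
    by (simp add: dot_def sum_distrib_right mult.assoc)
  also have "\<dots> = (\<Sum>l\<in>UNIV. \<Sum>j\<in>UNIV. multiplier l\<^sub>1 p s l * (?M $ l $ j * w $ j))" by (rule sum.swap)
  finally show ?thesis by (simp add: dot_def sum_distrib_left)
qed

text \<open>Evaluating Cramer's expansion at the kernel vector kills all rows but the border
  \<open>p\<close>, whose coefficient is therefore a multiple of the Hessian. If the Hessian
  vanishes, \<open>moment\<close> is a combination of Jacobian rows alone.\<close>

lemma multiplier_solves_rows:
  assumes "balanced s" "dot p (kernel_vector l\<^sub>1 s) \<noteq> 0" "hessian l\<^sub>1 s = 0"
  shows "(\<Sum>l\<in>UNIV. multiplier l\<^sub>1 p s l * row s (idx l) w) = dot (moment l\<^sub>1 s) w"
proof -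
  let ?u = "kernel_vector l\<^sub>1 s" and ?m = "multiplier l\<^sub>1 p s"
  have "?m l * dot (bordered l\<^sub>1 p s $ l) ?u = (if l = l\<^sub>1 then ?m l\<^sub>1 * dot p ?u else 0)" for l
    using kernel_vector_row[OF assms(1), of "idx l" l\<^sub>1] by (simp add: bordered_def row_dot)
  then have "?m l\<^sub>1 * dot p ?u = (\<Sum>l\<in>UNIV. ?m l * dot (bordered l\<^sub>1 p s $ l) ?u)" by (simp only: sum.delta) simp
  also have "\<dots> = dot (moment l\<^sub>1 s) ?u" by (rule multiplier_solves[OF assms(2)])
  also have "\<dots> = hessian l\<^sub>1 s" by (simp add: dot_moment hessian_def power2_eq_square mult.assoc)
  finally have m1: "?m l\<^sub>1 = 0" using assms(2,3) by simp
  have "(\<Sum>l\<in>UNIV. ?m l * row s (idx l) w) = (\<Sum>l\<in>UNIV. ?m l * dot (bordered l\<^sub>1 p s $ l) w)"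
    by (rule sum.cong) (auto simp: m1 row_dot bordered_def)
  then show ?thesis using multiplier_solves[OF assms(2), of w] by simp
qed

lemma inv_idx [simp]: "inv idx (idx l) = l"
  using bij_is_inj[OF bij_idx] by simp

lemma tangent_annihilates:
  assumes "balanced h"
  shows "(\<Sum>v\<in>\<Omega>. h v * tangent l\<^sub>1 p s v) = 0"
proof -
  have "(\<Sum>v\<in>\<Omega>. h v * tangent l\<^sub>1 p s v) = (\<Sum>i\<in>UNIV. \<Sum>a\<in>\<A> i. h (i, a) * pairing a (kernel_vector l\<^sub>1 s))
     - (\<Sum>i\<in>UNIV. (\<Sum>a\<in>\<A> i. h (i, a)) * multiplier l\<^sub>1 p s (inv idx i))"
    by (simp add: sum_\<Omega> tangent_def ring_distribs sum_subtractf sum_distrib_right)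
  then show ?thesis using assms by (simp add: balanced_def)
qed

text \<open>Multiplication by \<open>tangent\<close> is an infinitesimal translation along the
  kernel vector combined with rescalings of the equations: the kernel relation keeps the values at
  the unit point zero, and the multipliers cancel the change of the gradient.\<close>

lemma tangent_mult_balanced:
  assumes "balanced s" "dot p (kernel_vector l\<^sub>1 s) \<noteq> 0" "hessian l\<^sub>1 s = 0"
  shows "balanced (\<lambda>v. tangent l\<^sub>1 p s v * s v)"
proof -
  let ?u = "kernel_vector l\<^sub>1 s" and ?m = "multiplier l\<^sub>1 p s"
  have s0: "(\<Sum>a\<in>\<A> i. s (i, a)) = 0" for i using assms(1) by (simp add: balanced_def)
  have 1: "(\<Sum>a\<in>\<A> i. tangent l\<^sub>1 p s (i, a) * s (i, a)) = 0" for i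
  proof -
    have "(\<Sum>a\<in>\<A> i. tangent l\<^sub>1 p s (i, a) * s (i, a))
        = (\<Sum>a\<in>\<A> i. s (i, a) * pairing a ?u) - (\<Sum>a\<in>\<A> i. s (i, a)) * ?m (inv idx i)"
      by (simp add: tangent_def ring_distribs sum_subtractf sum_distrib_right mult.commute)
    then show ?thesis using kernel_vector_row[OF assms(1), of i l\<^sub>1] row_alt[OF s0, of i ?u] by (simp add: s0)
  qed
  have 2: "(\<Sum>i\<in>UNIV. \<Sum>a\<in>\<A> i. tangent l\<^sub>1 p s (i, a) * s (i, a) * pairing a w) = 0" for w
  proof -
    have "(\<Sum>i\<in>UNIV. \<Sum>a\<in>\<A> i. tangent l\<^sub>1 p s (i, a) * s (i, a) * pairing a w)
       = dot (moment l\<^sub>1 s) w - (\<Sum>i\<in>UNIV. ?m (inv idx i) * (\<Sum>a\<in>\<A> i. s (i, a) * pairing a w))"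
      unfolding dot_moment
      by (simp add: tangent_def ring_distribs sum_subtractf sum_distrib_left mult_ac)
    also have "(\<Sum>i\<in>UNIV. ?m (inv idx i) * (\<Sum>a\<in>\<A> i. s (i, a) * pairing a w))
       = (\<Sum>l\<in>UNIV. ?m l * row s (idx l) w)"
      by (simp add: row_alt[OF s0] flip: sum_idx)
    finally show ?thesis using multiplier_solves_rows[OF assms, of w] by simp
  qed
  show ?thesis using 1 2 by (simp add: balanced_def)
qed

lemma tangent_differentiable:
  assumes "dot p (kernel_vector l\<^sub>1 s) \<noteq> 0"
  shows "(\<lambda>\<epsilon>. tangent l\<^sub>1 p (\<lambda>v. s v + \<epsilon> * h v) v) field_differentiable (at 0)"
    and "(\<lambda>\<epsilon>. dot p (kernel_vector l\<^sub>1 (\<lambda>v. s v + \<epsilon> * h v))) field_differentiable (at 0)"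
proof -
  let ?s = "\<lambda>\<epsilon> v. s v + \<epsilon> * h v"
  note fd = field_differentiable_add field_differentiable_diff field_differentiable_mult field_differentiable_const
    field_differentiable_ident field_differentiable_sum
  have V: "(\<lambda>\<epsilon>. bordered l\<^sub>1 x (?s \<epsilon>) $ i $ j) field_differentiable (at 0)" for x i j
    by (cases "i = l\<^sub>1") (simp_all add: bordered_def log_jacobian_line fd)
  have k: "(\<lambda>\<epsilon>. kernel_vector l\<^sub>1 (?s \<epsilon>) $ j) field_differentiable (at 0)" for j
    unfolding kernel_vector_def vec_lambda_beta by (intro field_differentiable_det V)
  show "(\<lambda>\<epsilon>. dot p (kernel_vector l\<^sub>1 (?s \<epsilon>))) field_differentiable (at 0)"
    unfolding dot_def by (intro fd k)
  have pk: "(\<lambda>\<epsilon>. pairing a (kernel_vector l\<^sub>1 (?s \<epsilon>))) field_differentiable (at 0)" for a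
    unfolding pairing_def by (intro fd k)
  have m: "(\<lambda>\<epsilon>. moment l\<^sub>1 (?s \<epsilon>) $ j) field_differentiable (at 0)" for j
    unfolding moment_def vec_lambda_beta by (intro fd pk)
  have "(\<lambda>\<epsilon>. multiplier l\<^sub>1 p (?s \<epsilon>) k) field_differentiable (at 0)" for k
    unfolding multiplier_def
  proof (intro field_differentiable_divide field_differentiable_det V)
    show "(\<lambda>\<epsilon>. (\<chi> i j. if j = k then moment l\<^sub>1 (?s \<epsilon>) $ i else transpose (bordered l\<^sub>1 p (?s \<epsilon>)) $ i $ j) $ i $ j) field_differentiable (at 0)" for i j
      using m V by (cases "j = k") (simp_all add: transpose_def)
    show "det (bordered l\<^sub>1 p (?s 0)) \<noteq> 0" using assms by (simp add: det_bordered)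
  qed
  then show "(\<lambda>\<epsilon>. tangent l\<^sub>1 p (?s \<epsilon>) v) field_differentiable (at 0)"
    unfolding tangent_def by (intro fd pk)
qed

text \<open>On the finite set of values of \<open>tangent\<close> every function agrees with a
  polynomial, so the statement for powers suffices.\<close>

lemma function_of_tangent_annihilates:
  assumes hess: "\<And>s. balanced s \<Longrightarrow> hessian l\<^sub>1 s = 0"
    and s: "balanced s" "dot p (kernel_vector l\<^sub>1 s) \<noteq> 0" and h: "balanced h"
  shows "(\<Sum>v\<in>\<Omega>. h v * f (tangent l\<^sub>1 p s v)) = 0"
proof -
  let ?r = "tangent l\<^sub>1 p s"
  have pow: "(\<Sum>v\<in>\<Omega>. h v * ?r v ^ Suc k) = 0" for k
  proof (rule powers_annihilate[where S = "{s. balanced s}" and K = "\<lambda>s. dot p (kernel_vector l\<^sub>1 s) \<noteq> 0"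
        and r = "tangent l\<^sub>1 p"])
    fix s h :: "'k \<times> (int ^ 'n) \<Rightarrow> complex" and t
    assume "s \<in> {s. balanced s}" "h \<in> {s. balanced s}"
    then show "(\<lambda>v. s v + t * h v) \<in> {s. balanced s}" using balanced_line by simp
  next
    fix s h :: "'k \<times> (int ^ 'n) \<Rightarrow> complex"
    assume *: "dot p (kernel_vector l\<^sub>1 s) \<noteq> 0"
    define f where "f = (\<lambda>\<epsilon>. dot p (kernel_vector l\<^sub>1 (\<lambda>v. s v + \<epsilon> * h v)))"
    have "isCont f 0"
      unfolding f_def by (rule field_differentiable_imp_continuous_at[OF tangent_differentiable(2)[OF *]])
    then have "(f \<longlongrightarrow> f 0) (nhds 0)" by (simp add: isCont_def tendsto_at_iff_tendsto_nhds)
    then have "\<forall>\<^sub>F \<epsilon> in nhds 0. f \<epsilon> \<noteq> 0"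
      by (rule tendsto_imp_eventually_ne) (use * in \<open>simp add: f_def\<close>)
    then show "\<forall>\<^sub>F \<epsilon> in nhds 0. dot p (kernel_vector l\<^sub>1 (\<lambda>v. s v + \<epsilon> * h v)) \<noteq> 0" by (simp only: f_def)
  next
    fix s q :: "'k \<times> (int ^ 'n) \<Rightarrow> complex"
    assume s: "s \<in> {s. balanced s}" "dot p (kernel_vector l\<^sub>1 s) \<noteq> 0"
      and q: "\<And>h. h \<in> {s. balanced s} \<Longrightarrow> (\<Sum>v\<in>\<Omega>. h v * q v) = 0"
    have "balanced (\<lambda>v. tangent l\<^sub>1 p s v * s v)" using s hess by (intro tangent_mult_balanced) auto
    then show "(\<Sum>v\<in>\<Omega>. tangent l\<^sub>1 p s v * s v * q v) = 0" using q by blast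
  qed (use s h tangent_annihilates tangent_differentiable(1) in auto)
  have pow: "(\<Sum>v\<in>\<Omega>. h v * ?r v ^ k) = 0" for k
  proof (cases k)
    case 0
    then show ?thesis using h by (simp add: sum_\<Omega> balanced_def)
  qed (use pow in simp)
  obtain q where q: "\<forall>x\<in>?r ` \<Omega>. poly q x = f x"
    using ex_interpolating_poly[of "?r ` \<Omega>"] by auto
  have "(\<Sum>v\<in>\<Omega>. h v * f (?r v)) = (\<Sum>v\<in>\<Omega>. h v * poly q (?r v))"
    by (rule sum.cong) (use q in auto)
  also have "\<dots> = (\<Sum>v\<in>\<Omega>. \<Sum>k\<le>degree q. coeff q k * (h v * ?r v ^ k))"
    by (simp add: poly_altdef sum_distrib_left mult_ac)
  also have "\<dots> = (\<Sum>k\<le>degree q. \<Sum>v\<in>\<Omega>. coeff q k * (h v * ?r v ^ k))" by (rule sum.swap)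
  also have "\<dots> = 0" by (simp add: pow flip: sum_distrib_left)
  finally show ?thesis .
qed

text \<open>Every linear relation between edges is a balanced test vector. The differences of
  \<open>q\<close> thus satisfy all relations between edges and extend linearly from a basis of
  edges to a functional \<theta>.\<close>

lemma annihilator_of_balanced:
  assumes q: "\<And>h. balanced h \<Longrightarrow> (\<Sum>v\<in>\<Omega>. h v * q v) = 0"
  shows "\<exists>\<theta>. \<forall>y\<in>Y UNIV. pairing (E y) \<theta> = q y - q (fst y, a\<^sub>0 (fst y))"
proof -
  obtain B M where B: "B \<subseteq> Y UNIV" "inj_on (\<lambda>y. rvec (E y)) B" "independent ((\<lambda>y. rvec (E y)) ` B)"
    and M: "\<forall>y\<in>Y UNIV. rvec (E y) = (\<Sum>b\<in>B. M y b *\<^sub>R rvec (E b))"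
    using ex_indexed_basis[OF finite_Y[of UNIV], of "\<lambda>y. rvec (E y)"] by blast
  have finB: "finite B" using B(1) finite_subset[OF _ finite_Y] by blast
  define d where "d = (\<lambda>y. q y - q (fst y, a\<^sub>0 (fst y)))"
  have ext: "(\<Sum>v\<in>\<Omega>. extend c v * q v) = (\<Sum>y\<in>Y UNIV. c y * d y)" for c
  proof -
    have "(\<Sum>v\<in>\<Omega>. extend c v * q v) = (\<Sum>i\<in>UNIV. \<Sum>a\<in>\<A> i - {a\<^sub>0 i}. c (i, a) * d (i, a))"
      unfolding sum_\<Omega>
    proof (rule sum.cong)
      fix i
      show "(\<Sum>a\<in>\<A> i. extend c (i, a) * q (i, a)) = (\<Sum>a\<in>\<A> i - {a\<^sub>0 i}. c (i, a) * d (i, a))"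
        unfolding sum_remove_base
        by (simp add: extend_def d_def ring_distribs sum_subtractf sum_distrib_right sum_distrib_left mult_ac)
    qed simp
    also have "\<dots> = (\<Sum>y\<in>Y UNIV. c y * d y)" by (simp add: rel_index_def sum.Sigma fin)
    finally show ?thesis .
  qed
  have rows: "(\<Sum>i\<in>UNIV. row c i u) = (\<Sum>y\<in>Y UNIV. c y * pairing (E y) u)" for c u
    by (simp add: rel_index_def row_def sum.Sigma fin)
  have dM: "d y = (\<Sum>b\<in>B. of_real (M y b) * d b)" if y: "y \<in> Y UNIV" for y
  proof -
    \<comment> \<open>The relation that expresses the edge \<open>y\<close> in terms of the basis
      \<open>B\<close>.\<close>
    define c where "c = (\<lambda>y'. (if y' = y then 1 else 0) - (if y' \<in> B then complex_of_real (M y y') else 0))"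
    have c: "(\<Sum>y\<in>Y UNIV. c y * g y) = g y - (\<Sum>b\<in>B. of_real (M y b) * g b)" for g
    proof -
      have "(\<Sum>y'\<in>Y UNIV. (if y' \<in> B then complex_of_real (M y y') else 0) * g y') = (\<Sum>b\<in>B. of_real (M y b) * g b)"
        by (rule sum.mono_neutral_cong_right) (use B(1) in auto)
      then show ?thesis
        using y by (simp add: c_def left_diff_distrib sum_subtractf if_distrib[of "\<lambda>x. x * _"] cong: if_cong)
    qed
    have "balanced (extend c)"
    proof (rule balancedI)
      show "(\<Sum>i\<in>UNIV. row (extend c) i u) = 0" for u
        using bspec[OF M y] rpairing_sum_scaleR[of "M y" "\<lambda>b. rvec (E b)" B u]
        by (simp add: row_extend rows c pairing_eq_rpairing)
    qed (rule sum_extend)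
    then show ?thesis using q[of "extend c"] by (simp add: ext c)
  qed
  obtain g where g: "linear g" "\<forall>x\<in>(\<lambda>y. rvec (E y)) ` B. g x = d (the_inv_into B (\<lambda>y. rvec (E y)) x)"
    using linear_independent_extend[OF B(3), of "\<lambda>x. d (the_inv_into B (\<lambda>y. rvec (E y)) x)"]
    by (elim exE conjE)
  have gb: "g (rvec (E b)) = d b" if "b \<in> B" for b
    using g(2) that the_inv_into_f_f[OF B(2)] by simp
  have gg: "rpairing t (\<chi> j. g (axis j 1)) = g t" for t
  proof -
    have "t = (\<Sum>j\<in>UNIV. t $ j *\<^sub>R axis j 1)"
      using basis_expansion[of t] by (simp add: scalar_mult_eq_scaleR)
    from arg_cong[OF this, of g] have "g t = (\<Sum>j\<in>UNIV. t $ j *\<^sub>R g (axis j 1))"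
      by (simp add: linear_sum[OF g(1)] linear_scale[OF g(1)])
    then show ?thesis by (simp add: rpairing_def scaleR_conv_of_real)
  qed
  have "pairing (E y) (\<chi> j. g (axis j 1)) = d y" if y: "y \<in> Y UNIV" for y
  proof -
    have "rpairing (\<Sum>b\<in>B. M y b *\<^sub>R rvec (E b)) (\<chi> j. g (axis j 1)) = d y"
      unfolding rpairing_sum_scaleR dM[OF y] by (simp add: gg gb)
    then show ?thesis using bspec[OF M y] by (simp add: pairing_eq_rpairing)
  qed
  then show ?thesis unfolding d_def by blast
qed

end

section \<open>Linear tuples\<close>

lemma pairing_sum_left: "pairing (\<Sum>i\<in>I. f i) u = (\<Sum>i\<in>I. pairing (f i) u)"
  unfolding pairing_def by (subst sum.swap) (simp add: sum_component sum_distrib_right)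

lemma pairing_scale_left: "pairing (k *s a) u = of_int k * pairing a u"
  by (simp add: pairing_def sum_distrib_left mult_ac)

context irreducible_BK
begin

lemma pairing_E_ext:
  assumes "\<And>y. y \<in> Y UNIV \<Longrightarrow> pairing (E y) u = pairing (E y) w"
  shows "u = w"
proof -
  have "u - w = 0" by (rule pairing_E_eq_0) (simp add: pairing_diff assms)
  then show ?thesis by simp
qed

lemma E_nonzero: "y \<in> Y I \<Longrightarrow> E y \<noteq> 0"
  by (auto simp: rel_index_def edge_def)

text \<open>Lattice statements can be checked on edges, since a difference inside
  \<open>\<A> i\<close> is a difference of two edges from the base point or zero.\<close>

lemma spanning_induct [case_names zero edge diff]:
  assumes "P 0" "\<And>y. y \<in> Y UNIV \<Longrightarrow> P (E y)" "\<And>x y. P x \<Longrightarrow> P y \<Longrightarrow> P (x - y)"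
  shows "P x"
proof -
  have vertex: "P (a - a\<^sub>0 i)" if "a \<in> \<A> i" for i a
    using assms(1) assms(2)[of "(i, a)"] that by (cases "a = a\<^sub>0 i") (auto simp: rel_index_def edge_def)
  have "x \<in> tuple_span \<A> UNIV" by (simp add: spanning)
  then show ?thesis
    unfolding tuple_span_def
  proof (induction rule: group_closure.induct)
    case (base s)
    show ?case
    proof (cases "s = 0")
      case False
      with base obtain a a' i where s: "s = a - a'" "a \<in> \<A> i" "a' \<in> \<A> i" by blast
      have "P ((a - a\<^sub>0 i) - (a' - a\<^sub>0 i))" by (rule assms(3)[OF vertex[OF s(2)] vertex[OF s(3)]])
      with s show ?thesis by simp
    qed (simp add: assms(1))
  qed (use assms in auto)
qed

text \<open>Starting from the zero coefficients, which are singular, one moves off finitely many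
  thin sets at once: left kernel vectors with a zero entry, and kernel vectors orthogonal to some
  \<open>x \<in> X\<close>.\<close>

lemma ex_generic_balanced:
  assumes "finite X" "0 \<notin> X"
  shows "\<exists>s p. balanced s \<and> dot p (kernel_vector l\<^sub>1 s) \<noteq> 0 \<and> (\<forall>x\<in>X. pairing x (kernel_vector l\<^sub>1 s) \<noteq> 0)"
proof -
  let ?L = "{c. \<exists>l i\<^sub>0 i\<^sub>1. l i\<^sub>0 = 0 \<and> l i\<^sub>1 \<noteq> 0 \<and> (\<forall>u. (\<Sum>i\<in>UNIV. l i * row c i u) = 0)}"
  let ?K = "\<lambda>x. {c. \<exists>u. u \<noteq> 0 \<and> pairing x u = 0 \<and> (\<forall>i. row c i u = 0)}"
  let ?B = "\<lambda>q. case q of None \<Rightarrow> ?L | Some x \<Rightarrow> ?K x"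
  obtain w where w: "\<not> singular w" using ex_nonsingular by blast
  define U where "U = (\<Union>q\<in>insert None (Some ` X). ?B q)"
  have thin: "thin (Y UNIV) w U"
    unfolding U_def
  proof (rule thin_UN)
    fix q assume "q \<in> insert None (Some ` X)"
    then consider "q = None" | x where "q = Some x" "x \<noteq> 0" using assms(2) by auto
    then show "thin (Y UNIV) w (?B q)"
    proof cases
      case 1
      then show ?thesis using thin_left_kernel by (simp only: option.case)
    next
      case (2 x)
      then show ?thesis using thin_kernel_orthogonal by (simp only: option.case)
    qed
  qed (use assms(1) in auto)
  have "singular (\<lambda>_. 0)"
    unfolding singular_def by (rule exI[of _ "axis undefined 1"]) (simp add: row_def)
  from ex_singular_outside_thin[OF this w thin polyfun.const[of _ 1]]
  obtain c where c: "singular c" "c \<notin> U" by auto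
  have cL: "c \<notin> ?L" using c(2) by (simp add: U_def)
  have cK: "c \<notin> ?K x" if "x \<in> X" for x using c(2) that by (simp add: U_def)
  obtain l where l: "\<And>i. l i \<noteq> 0" "balanced (\<lambda>(i, a). l i * extend c (i, a))"
    using ex_balanced_rescaling[OF c(1) cL] by blast
  define s where "s = (\<lambda>(i, a). l i * extend c (i, a))"
  have s: "balanced s" using l(2) by (simp add: s_def)
  have rs: "row s i u = l i * row c i u" for i u
    unfolding row_extend[symmetric, of c] by (simp add: row_def s_def sum_distrib_left mult_ac)
  obtain u where u: "u \<noteq> 0" "\<And>i. row c i u = 0" using c(1) unfolding singular_def by blast
  \<comment> \<open>\<open>dot\<close> is bilinear, so the conjugate of \<open>u\<close> is needed
    to obtain the positive number |u|^2.\<close>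
  define p where "p = (\<chi> j. cnj (u $ j))"
  have pu: "dot p u \<noteq> 0"
  proof -
    have "dot p u = of_real (\<Sum>j\<in>UNIV. (norm (u $ j))\<^sup>2)"
      unfolding dot_def p_def vec_lambda_beta of_real_sum complex_norm_square by (simp only: mult.commute)
    moreover have "(\<Sum>j\<in>UNIV. (norm (u $ j))\<^sup>2) \<noteq> 0"
      using u(1) by (simp add: sum_nonneg_eq_0_iff vec_eq_iff)
    ultimately show ?thesis by (metis of_real_eq_0_iff)
  qed
  let ?M = "bordered l\<^sub>1 p s"
  \<comment> \<open>Evaluated at \<open>u\<close>, a relation between the bordered rows loses its
    coefficient at \<open>p\<close>. It then rescales to a left kernel vector of \<open>c\<close>
    with a zero entry, which genericity excludes.\<close>
  have "det ?M \<noteq> 0"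
  proof
    assume "det ?M = 0"
    then have "\<not> invertible (transpose ?M)" by (simp add: invertible_det_nz)
    then obtain x where x: "transpose ?M *v x = 0" "x \<noteq> 0"
      by (metis invertible_left_inverse matrix_left_invertible_ker)
    have rel: "(\<Sum>k\<in>UNIV. x $ k * dot (?M $ k) w) = 0" for w
    proof -
      have "(\<Sum>k\<in>UNIV. x $ k * dot (?M $ k) w) = dot (transpose ?M *v x) w"
        unfolding dot_def matrix_vector_mult_def transpose_def
        by (simp add: sum_distrib_left sum_distrib_right mult_ac) (rule sum.swap)
      then show ?thesis unfolding x(1) by (simp add: dot_def)
    qed
    have rows: "dot (?M $ k) w = (if k = l\<^sub>1 then dot p w else row s (idx k) w)" for k w
      by (simp add: bordered_def row_dot)
    have "(\<Sum>k\<in>UNIV. x $ k * dot (?M $ k) u) = (\<Sum>k\<in>UNIV. if k = l\<^sub>1 then x $ l\<^sub>1 * dot p u else 0)"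
      by (rule sum.cong) (auto simp: rows rs u(2))
    then have x1: "x $ l\<^sub>1 = 0" using rel[of u] pu by simp
    define l' where "l' = (\<lambda>i. x $ inv idx i * l i)"
    have "(\<Sum>i\<in>UNIV. l' i * row c i w) = 0" for w
    proof -
      have "(\<Sum>i\<in>UNIV. l' i * row c i w) = (\<Sum>k\<in>UNIV. x $ k * row s (idx k) w)"
        by (simp add: l'_def rs mult.assoc flip: sum_idx)
      also have "\<dots> = (\<Sum>k\<in>UNIV. x $ k * dot (?M $ k) w)"
        by (rule sum.cong) (auto simp: rows x1)
      finally show ?thesis using rel by simp
    qed
    moreover have "l' (idx l\<^sub>1) = 0" by (simp add: l'_def x1)
    moreover obtain k where "x $ k \<noteq> 0" using x(2) by (auto simp: vec_eq_iff)
    then have "l' (idx k) \<noteq> 0" using l(1) by (simp add: l'_def)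
    ultimately show False using cL by blast
  qed
  then have 1: "dot p (kernel_vector l\<^sub>1 s) \<noteq> 0" by (simp add: det_bordered)
  then have nz: "kernel_vector l\<^sub>1 s \<noteq> 0" by (auto simp: dot_def)
  have "row c i (kernel_vector l\<^sub>1 s) = 0" for i
    using kernel_vector_row[OF s, of i l\<^sub>1] l(1)[of i] by (simp add: rs)
  then have "\<forall>x\<in>X. pairing x (kernel_vector l\<^sub>1 s) \<noteq> 0" using nz cK by blast
  with s 1 show ?thesis by blast
qed

text \<open>
  If all Hessians vanish, every indicator function of a level set of \<open>tangent\<close> is induced by a
  functional \<open>\<theta>\<close> on the lattice. For a generic balanced system these functionals separate points, and
  the levels turn into the vertices of a unimodular simplex.
\<close>

lemma linear_of_hessian_zero:
  assumes hess: "\<And>s. balanced s \<Longrightarrow> hessian l\<^sub>1 s = 0"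
  shows "linear_tuple \<A>"
proof -
  let ?ind = "\<lambda>\<sigma> v. if v \<in> \<sigma> then 1 else 0 :: complex"
  define good where "good = (\<lambda>\<sigma> \<theta>. \<forall>y\<in>Y UNIV. pairing (E y) \<theta> = ?ind \<sigma> y - ?ind \<sigma> (fst y, a\<^sub>0 (fst y)))"
  \<comment> \<open>The functionals are fixed for all subsets of the support before \<open>s\<close>
    is chosen, because the set \<open>X\<close> to be avoided must not depend on
    \<open>s\<close>.\<close>
  define \<Theta> where "\<Theta> = (\<lambda>\<sigma>. SOME \<theta>. good \<sigma> \<theta>)"
  define bad where "bad = (\<lambda>\<K> x. x \<noteq> 0 \<and> (\<forall>\<sigma>\<in>\<K>. pairing x (\<Theta> \<sigma>) = 0))"
  \<comment> \<open>One witness for each of the finitely many families that fail to separate points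
    keeps \<open>X\<close> finite; the edges make the kernel vector nonzero on every edge.\<close>
  define X where "X = (\<lambda>\<K>. SOME x. bad \<K> x) ` {\<K> \<in> Pow (Pow \<Omega>). \<exists>x. bad \<K> x} \<union> E ` Y UNIV"
  have "finite X" by (simp add: X_def)
  moreover have "0 \<notin> X"
  proof -
    have "(SOME x. bad \<K> x) \<noteq> 0" if "\<exists>x. bad \<K> x" for \<K>
      using someI_ex[OF that] by (simp add: bad_def)
    then show ?thesis using E_nonzero by (force simp: X_def)
  qed
  ultimately obtain s p where s: "balanced s" "dot p (kernel_vector l\<^sub>1 s) \<noteq> 0"
    and gen: "\<forall>x\<in>X. pairing x (kernel_vector l\<^sub>1 s) \<noteq> 0"
    using ex_generic_balanced by blast
  define r where "r = tangent l\<^sub>1 p s"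
  define u where "u = kernel_vector l\<^sub>1 s"
  have ru: "pairing (E y) u = r y - r (fst y, a\<^sub>0 (fst y))" for y
    by (simp add: r_def u_def tangent_def edge_def pairing_diff_left)
  have func: "\<exists>\<theta>. \<forall>y\<in>Y UNIV. pairing (E y) \<theta> = f (r y) - f (r (fst y, a\<^sub>0 (fst y)))" for f
    by (rule annihilator_of_balanced) (unfold r_def, rule function_of_tangent_annihilates[OF hess s])
  define V where "V = r ` \<Omega>"
  have finV: "finite V" by (simp add: V_def)
  define lev where "lev = (\<lambda>\<rho>. {v \<in> \<Omega>. r v = \<rho>})"
  define \<psi> where "\<psi> = (\<lambda>x \<rho>. pairing x (\<Theta> (lev \<rho>)))"
  have \<Omega>0: "(fst y, a\<^sub>0 (fst y)) \<in> \<Omega>" for y :: "'k \<times> (int ^ 'n)" by (simp add: base)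
  have Y\<Omega>: "y \<in> \<Omega>" if "y \<in> Y UNIV" for y using that by (auto simp: rel_index_def)
  have \<psi>E: "\<psi> (E y) \<rho> = (if r y = \<rho> then 1 else 0) - (if r (fst y, a\<^sub>0 (fst y)) = \<rho> then 1 else 0)"
    if "y \<in> Y UNIV" for y \<rho>
  proof -
    have "\<exists>\<theta>. good (lev \<rho>) \<theta>"
      using func[of "\<lambda>x. if x = \<rho> then 1 else 0"] Y\<Omega> \<Omega>0 by (simp add: good_def lev_def)
    then have "good (lev \<rho>) (\<Theta> (lev \<rho>))" unfolding \<Theta>_def by (rule someI_ex)
    then show ?thesis using that Y\<Omega> \<Omega>0 by (simp add: good_def lev_def \<psi>_def)
  qed
  have \<psi>_diff: "\<psi> (x - y) \<rho> = \<psi> x \<rho> - \<psi> y \<rho>" for x y \<rho> by (simp add: \<psi>_def pairing_diff_left)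
  have \<psi>_0 [simp]: "\<psi> 0 \<rho> = 0" for \<rho> by (simp add: \<psi>_def)
  have \<psi>_edge: "\<psi> (a - a\<^sub>0 i) \<rho> = (if r (i, a) = \<rho> then 1 else 0) - (if r (i, a\<^sub>0 i) = \<rho> then 1 else 0)"
    if "a \<in> \<A> i" for i a \<rho>
    using \<psi>E[of "(i, a)" \<rho>] that by (cases "a = a\<^sub>0 i") (auto simp: rel_index_def edge_def)
  \<comment> \<open>The values on edges are -1, 0 or 1, and the edges generate the lattice.\<close>
  have \<psi>_int: "\<psi> x \<rho> \<in> \<int>" for x \<rho>
    by (induction x rule: spanning_induct) (auto simp: \<psi>E \<psi>_diff)
  have \<psi>_sum: "(\<Sum>\<rho>\<in>V. \<psi> x \<rho>) = 0" for x
  proof (induction x rule: spanning_induct)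
    case (edge y)
    have "r y \<in> V" "r (fst y, a\<^sub>0 (fst y)) \<in> V" using Y\<Omega>[OF edge] \<Omega>0 by (auto simp: V_def)
    then show ?case using finV by (simp add: \<psi>E[OF edge] sum_subtractf)
  qed (simp_all add: \<psi>_diff sum_subtractf)
  \<comment> \<open>The kernel vector \<open>u\<close> is the combination of the level functionals
    weighted by their levels. If these missed some nonzero \<open>x\<close>, the witness stored in
    \<open>X\<close> would be orthogonal to \<open>u\<close>.\<close>
  have \<psi>_inj: "x = 0" if x: "\<And>\<rho>. \<rho> \<in> V \<Longrightarrow> \<psi> x \<rho> = 0" for x
  proof (rule ccontr)
    assume "x \<noteq> 0"
    then have bx: "bad (lev ` V) x" using x by (simp add: bad_def \<psi>_def)
    define z where "z = (SOME x. bad (lev ` V) x)"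
    have bz: "bad (lev ` V) z" unfolding z_def using bx by (rule someI)
    have "lev ` V \<in> Pow (Pow \<Omega>)" by (auto simp: lev_def)
    then have "z \<in> X" using bx unfolding X_def z_def by blast
    then have "pairing z u \<noteq> 0" using gen by (simp add: u_def)
    moreover have "u = (\<Sum>\<rho>\<in>V. \<rho> *s \<Theta> (lev \<rho>))"
    proof (rule pairing_E_ext)
      fix y assume y: "y \<in> Y UNIV"
      have "r y \<in> V" "r (fst y, a\<^sub>0 (fst y)) \<in> V" using Y\<Omega>[OF y] \<Omega>0 by (auto simp: V_def)
      have "pairing (E y) (\<Sum>\<rho>\<in>V. \<rho> *s \<Theta> (lev \<rho>)) = (\<Sum>\<rho>\<in>V. \<rho> * \<psi> (E y) \<rho>)"
        by (simp add: pairing_sum pairing_scale \<psi>_def)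
      also have "\<dots> = (\<Sum>\<rho>\<in>V. (if r y = \<rho> then \<rho> else 0)) - (\<Sum>\<rho>\<in>V. (if r (fst y, a\<^sub>0 (fst y)) = \<rho> then \<rho> else 0))"
        unfolding sum_subtractf[symmetric] by (rule sum.cong) (auto simp: \<psi>E[OF y])
      also have "\<dots> = r y - r (fst y, a\<^sub>0 (fst y))"
        using finV \<open>r y \<in> V\<close> \<open>r (fst y, a\<^sub>0 (fst y)) \<in> V\<close> by simp
      finally show "pairing (E y) u = pairing (E y) (\<Sum>\<rho>\<in>V. \<rho> *s \<Theta> (lev \<rho>))" by (simp add: ru)
    qed
    then have "pairing z u = (\<Sum>\<rho>\<in>V. \<rho> * pairing z (\<Theta> (lev \<rho>)))"
      by (simp add: pairing_sum pairing_scale)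
    then have "pairing z u = 0" using bz by (simp add: bad_def)
    ultimately show False by simp
  qed
  \<comment> \<open>Levels are joined when they meet a common \<open>\<A> i\<close>. Cutting
    \<open>r\<close> off outside a union \<open>C\<close> of components gives a functional that
    kills all rows, hence a multiple of \<open>u\<close>; the factor would be 1 on edges over
    \<open>C\<close> and 0 on the others.\<close>
  have connected: "C = V" if C: "C \<subseteq> V" "C \<noteq> {}"
    and closed: "\<And>i a a'. a \<in> \<A> i \<Longrightarrow> a' \<in> \<A> i \<Longrightarrow> r (i, a) \<in> C \<Longrightarrow> r (i, a') \<in> C" for C
  proof (rule ccontr)
    assume "C \<noteq> V"
    then obtain v where "v \<in> \<Omega>" "r v \<notin> C" using C(1) unfolding V_def by blast
    then obtain j b where j: "b \<in> \<A> j" "r (j, b) \<notin> C" by (cases v) auto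
    obtain v' where "v' \<in> \<Omega>" "r v' \<in> C" using C unfolding V_def by blast
    then obtain i a where i: "a \<in> \<A> i" "r (i, a) \<in> C" by (cases v') auto
    define f where "f = (\<lambda>\<rho>. if \<rho> \<in> C then \<rho> else 0)"
    obtain \<theta> where "\<forall>y\<in>Y UNIV. pairing (E y) \<theta> = f (r y) - f (r (fst y, a\<^sub>0 (fst y)))"
      using func[of f] by blast
    then have \<theta>: "pairing (E (k, b)) \<theta> = (if r (k, a\<^sub>0 k) \<in> C then pairing (E (k, b)) u else 0)"
      if "b \<in> \<A> k - {a\<^sub>0 k}" for k b
      using that closed[of b k "a\<^sub>0 k"] closed[of "a\<^sub>0 k" k b] base
      by (auto simp: rel_index_def f_def ru)
    have "row s k \<theta> = (if r (k, a\<^sub>0 k) \<in> C then row s k u else 0)" for k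
      unfolding row_def by (simp add: \<theta>)
    then have "row s k \<theta> = 0" for k using kernel_vector_row[OF s(1), of k l\<^sub>1] by (simp add: u_def)
    then obtain t where t: "\<theta> = t *s u" using kernel_is_line[OF s] unfolding u_def by blast
    have ex: "\<exists>b. b \<in> \<A> k - {a\<^sub>0 k}" for k
    proof -
      have "0 < rank_of {k}" using card_le_rank[of "{k}"] by simp
      then have "Y {k} \<noteq> {}" by (auto simp: rank_of_def)
      then show ?thesis by (auto simp: rel_index_def)
    qed
    have pu: "pairing (E (k, b)) u \<noteq> 0" if "b \<in> \<A> k - {a\<^sub>0 k}" for k b
      using gen that by (auto simp: X_def u_def rel_index_def)
    have "t = 1"
    proof -
      obtain b where b: "b \<in> \<A> i - {a\<^sub>0 i}" using ex by blast
      have "r (i, a\<^sub>0 i) \<in> C" using closed[OF i(1) base i(2)] .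
      then show ?thesis using \<theta>[OF b] pu[OF b] by (simp add: t pairing_scale)
    qed
    moreover have "t = 0"
    proof -
      obtain b' where b': "b' \<in> \<A> j - {a\<^sub>0 j}" using ex by blast
      have "r (j, a\<^sub>0 j) \<notin> C" using closed[OF base j(1)] j(2) by blast
      then show ?thesis using \<theta>[OF b'] pu[OF b'] by (simp add: t pairing_scale)
    qed
    ultimately show False by simp
  qed
  obtain \<rho>0 where \<rho>0: "\<rho>0 \<in> V" using \<Omega>0[of undefined] unfolding V_def by blast
  \<comment> \<open>\<open>x\<close> realises the difference of the unit vectors at \<rho> and
    \<open>\<rho>0\<close> in level coordinates. By connectedness every level is reached from
    \<open>\<rho>0\<close> through differences inside the sets.\<close>
  define vert where "vert = (\<lambda>x \<rho>. \<forall>\<rho>'\<in>V. \<psi> x \<rho>' = (if \<rho>' = \<rho> then 1 else 0) - (if \<rho>' = \<rho>0 then 1 else 0))"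
  have "{\<rho> \<in> V. \<exists>x. vert x \<rho>} = V"
  proof (rule connected)
    have "vert 0 \<rho>0" by (simp add: vert_def)
    then show "{\<rho> \<in> V. \<exists>x. vert x \<rho>} \<noteq> {}" using \<rho>0 by blast
    fix i a a' assume a: "a \<in> \<A> i" "a' \<in> \<A> i" "r (i, a) \<in> {\<rho> \<in> V. \<exists>x. vert x \<rho>}"
    then obtain x where x: "vert x (r (i, a))" by blast
    have "vert (x - ((a - a\<^sub>0 i) - (a' - a\<^sub>0 i))) (r (i, a'))"
      unfolding vert_def \<psi>_diff using x a by (auto simp: vert_def \<psi>_edge simp flip: \<psi>_diff)
    moreover have "r (i, a') \<in> V" using a by (auto simp: V_def)
    ultimately show "r (i, a') \<in> {\<rho> \<in> V. \<exists>x. vert x \<rho>}" by blast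
  qed blast
  then have "\<forall>\<rho>\<in>V. \<exists>x. vert x \<rho>" by blast
  then obtain x where x: "\<And>\<rho>. \<rho> \<in> V \<Longrightarrow> vert (x \<rho>) \<rho>" by metis
  \<comment> \<open>All level coordinates sum to zero, so the one at \<open>\<rho>0\<close> is
    dropped; the rest are dual to the vectors \<open>x \<rho>\<close>, which form a lattice
    basis.\<close>
  define K where "K = V - {\<rho>0}"
  have xK: "\<psi> (x \<rho>) \<rho>' = (if \<rho>' = \<rho> then 1 else 0)" if "\<rho> \<in> V" "\<rho>' \<in> K" for \<rho> \<rho>'
    using x[OF that(1)] that(2) by (simp add: vert_def K_def)
  have x0: "\<psi> (x \<rho>0) \<rho> = 0" if "\<rho> \<in> V" for \<rho>
    using x[OF \<rho>0] that by (auto simp: vert_def)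
  have inj: "y = z" if yz: "\<And>\<rho>. \<rho> \<in> K \<Longrightarrow> \<psi> y \<rho> = \<psi> z \<rho>" for y z
  proof -
    have *: "(\<Sum>\<rho>\<in>V. \<psi> (y - z) \<rho>) = \<psi> (y - z) \<rho>0 + (\<Sum>\<rho>\<in>K. \<psi> (y - z) \<rho>)"
      unfolding K_def by (rule sum.remove[OF finV \<rho>0])
    have "(\<Sum>\<rho>\<in>K. \<psi> (y - z) \<rho>) = 0" by (rule sum.neutral) (simp add: \<psi>_diff yz)
    with * have "\<psi> (y - z) \<rho>0 = 0" by (simp add: \<psi>_sum)
    moreover have "\<psi> (y - z) \<rho> = 0" if "\<rho> \<in> K" for \<rho> using yz[OF that] by (simp add: \<psi>_diff)
    ultimately have "y - z = 0" by (intro \<psi>_inj) (auto simp: K_def)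
    then show ?thesis by simp
  qed
  define m where "m = (\<lambda>y \<rho>. \<lfloor>Re (\<psi> y \<rho>)\<rfloor>)"
  have m: "of_int (m y \<rho>) = \<psi> y \<rho>" for y \<rho>
    using \<psi>_int[of y \<rho>] by (auto simp: m_def Ints_def)
  have finK: "finite K" using finV by (simp add: K_def)
  have \<psi>_comb: "\<psi> (\<Sum>\<rho>\<in>K. k \<rho> *s x \<rho>) \<rho>' = of_int (k \<rho>')" if "\<rho>' \<in> K" for k \<rho>'
  proof -
    have "\<psi> (\<Sum>\<rho>\<in>K. k \<rho> *s x \<rho>) \<rho>' = (\<Sum>\<rho>\<in>K. of_int (k \<rho>) * \<psi> (x \<rho>) \<rho>')"
      by (simp add: \<psi>_def pairing_sum_left pairing_scale_left)
    also have "\<dots> = (\<Sum>\<rho>\<in>K. if \<rho>' = \<rho> then of_int (k \<rho>') else 0)"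
      by (rule sum.cong) (use xK that in \<open>auto simp: K_def\<close>)
    finally show ?thesis using finK that by simp
  qed
  have comb: "y = (\<Sum>\<rho>\<in>K. m y \<rho> *s x \<rho>)" for y
    by (rule inj) (simp add: \<psi>_comb m)
  have cardK: "card K = CARD('n)"
  proof -
    have injx: "inj_on (\<lambda>\<rho>. rvec (x \<rho>)) K"
    proof (rule inj_onI)
      fix \<rho> \<rho>' assume *: "\<rho> \<in> K" "\<rho>' \<in> K" "rvec (x \<rho>) = rvec (x \<rho>')"
      then have "rvec (x \<rho> - x \<rho>') = 0" by (simp add: rvec_diff)
      then have "x \<rho> = x \<rho>'" by simp
      then show "\<rho> = \<rho>'" using xK[of \<rho> \<rho>] xK[of \<rho>' \<rho>] * by (auto simp: K_def split: if_splits)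
    qed
    have "independent ((\<lambda>\<rho>. rvec (x \<rho>)) ` K)"
    proof (rule independent_if_scalars_zero)
      show "finite ((\<lambda>\<rho>. rvec (x \<rho>)) ` K)" using finK by simp
      fix f :: "real ^ 'n \<Rightarrow> real" and z
      assume f: "(\<Sum>z\<in>(\<lambda>\<rho>. rvec (x \<rho>)) ` K. f z *\<^sub>R z) = 0" and "z \<in> (\<lambda>\<rho>. rvec (x \<rho>)) ` K"
      then obtain \<rho> where \<rho>: "\<rho> \<in> K" "z = rvec (x \<rho>)" by blast
      have "(\<Sum>\<rho>\<in>K. f (rvec (x \<rho>)) *\<^sub>R rvec (x \<rho>)) = 0" using f by (simp add: sum.reindex[OF injx])
      then have "(\<Sum>\<rho>'\<in>K. of_real (f (rvec (x \<rho>'))) * \<psi> (x \<rho>') \<rho>) = 0"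
        using rpairing_sum_scaleR[of "\<lambda>\<rho>. f (rvec (x \<rho>))" "\<lambda>\<rho>. rvec (x \<rho>)" K "\<Theta> (lev \<rho>)"]
        by (simp add: \<psi>_def pairing_eq_rpairing rpairing_def)
      also have "(\<Sum>\<rho>'\<in>K. of_real (f (rvec (x \<rho>'))) * \<psi> (x \<rho>') \<rho>)
          = (\<Sum>\<rho>'\<in>K. if \<rho> = \<rho>' then of_real (f (rvec (x \<rho>))) else 0 :: complex)"
        by (rule sum.cong) (use xK \<rho>(1) in \<open>auto simp: K_def\<close>)
      finally show "f z = 0" using finK \<rho> by simp
    qed
    moreover have "UNIV \<subseteq> span ((\<lambda>\<rho>. rvec (x \<rho>)) ` K)"
    proof -
      have "rvec y \<in> span ((\<lambda>\<rho>. rvec (x \<rho>)) ` K)" for y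
      proof -
        have "rvec y = (\<Sum>\<rho>\<in>K. real_of_int (m y \<rho>) *\<^sub>R rvec (x \<rho>))"
          by (subst comb) (simp add: rvec_def vec_eq_iff sum_component)
        then show ?thesis by (simp add: span_sum span_scale span_base)
      qed
      moreover have "axis j 1 = rvec (axis j 1)" for j :: 'n
        by (simp add: rvec_def axis_def vec_eq_iff)
      ultimately have "(Basis :: (real ^ 'n) set) \<subseteq> span ((\<lambda>\<rho>. rvec (x \<rho>)) ` K)"
        by (auto simp: Basis_vec_def)
      from span_mono[OF this] show ?thesis unfolding span_span span_Basis .
    qed
    ultimately have "card ((\<lambda>\<rho>. rvec (x \<rho>)) ` K) = CARD('n)"
      using basis_card_eq_dim[of "(\<lambda>\<rho>. rvec (x \<rho>)) ` K" UNIV] by simp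
    then show ?thesis using card_image[OF injx] by simp
  qed
  obtain \<beta> :: "'n \<Rightarrow> complex" where \<beta>: "bij_betw \<beta> UNIV K"
    using finite_same_card_bij[of "UNIV :: 'n set" K] cardK finK by auto
  define \<phi> where "\<phi> = (\<lambda>y. \<chi> j. m y (\<beta> j))"
  have \<beta>K: "\<beta> j \<in> K" for j using \<beta> by (auto simp: bij_betw_def)
  have K\<beta>: "\<exists>j. \<rho> = \<beta> j" if "\<rho> \<in> K" for \<rho> using \<beta> that by (auto simp: bij_betw_def)
  have \<psi>_add: "\<psi> (y + z) \<rho> = \<psi> y \<rho> + \<psi> z \<rho>" for y z \<rho> by (simp add: \<psi>_def pairing_add_left)
  have "Modules.additive \<phi>"
  proof
    fix y z
    have "complex_of_int (m (y + z) \<rho>) = of_int (m y \<rho> + m z \<rho>)" for \<rho> by (simp add: m \<psi>_add)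
    then have "m (y + z) \<rho> = m y \<rho> + m z \<rho>" for \<rho> by (metis of_int_eq_iff)
    then show "\<phi> (y + z) = \<phi> y + \<phi> z" by (simp add: \<phi>_def vec_eq_iff)
  qed
  moreover have "bij \<phi>"
  proof (rule bijI)
    show "inj \<phi>"
    proof (rule injI)
      fix y z assume "\<phi> y = \<phi> z"
      then have *: "m y (\<beta> j) = m z (\<beta> j)" for j by (simp add: \<phi>_def vec_eq_iff)
      have "\<psi> y \<rho> = \<psi> z \<rho>" if "\<rho> \<in> K" for \<rho>
        using K\<beta>[OF that] * by (metis m)
      then show "y = z" by (rule inj)
    qed
    show "surj \<phi>"
    proof (rule surjI)
      fix z :: "int ^ 'n"
      define y where "y = (\<Sum>\<rho>\<in>K. z $ inv_into UNIV \<beta> \<rho> *s x \<rho>)"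
      have "complex_of_int (m y (\<beta> j)) = of_int (z $ j)" for j
        using \<psi>_comb[OF \<beta>K[of j], of "\<lambda>\<rho>. z $ inv_into UNIV \<beta> \<rho>"] \<beta>
        by (simp add: m y_def bij_betw_def inv_f_f)
      then show "\<phi> (\<Sum>\<rho>\<in>K. z $ inv_into UNIV \<beta> \<rho> *s x \<rho>) = z"
        unfolding y_def[symmetric] by (simp add: \<phi>_def vec_eq_iff)
    qed
  qed
  \<comment> \<open>The translation moves \<open>a\<^sub>0 i\<close> to the vertex of its level, so
    every \<open>a\<close> lands on the vertex of its own level; the vertex of
    \<open>\<rho>0\<close> is the origin.\<close>
  moreover have "\<phi> ` ((+) (x (r (i, a\<^sub>0 i)) - a\<^sub>0 i) ` \<A> i) \<subseteq> insert 0 (range (\<lambda>j. axis j 1))" for i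
  proof -
    have "\<phi> (x (r (i, a\<^sub>0 i)) - a\<^sub>0 i + a) \<in> insert 0 (range (\<lambda>j. axis j 1))" if a: "a \<in> \<A> i" for a
    proof -
      have V0: "r (i, a\<^sub>0 i) \<in> V" and Va: "r (i, a) \<in> V" using base a by (auto simp: V_def)
      have "complex_of_int (m (x (r (i, a\<^sub>0 i)) - a\<^sub>0 i + a) (\<beta> j)) = of_int (if r (i, a) = \<beta> j then 1 else 0)" for j
      proof -
        have "\<psi> (x (r (i, a\<^sub>0 i)) - a\<^sub>0 i + a) (\<beta> j) = \<psi> (x (r (i, a\<^sub>0 i))) (\<beta> j) + \<psi> (a - a\<^sub>0 i) (\<beta> j)"
          by (simp add: \<psi>_add \<psi>_diff)
        then show ?thesis
          unfolding m xK[OF V0 \<beta>K[of j]] \<psi>_edge[OF a] by auto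
      qed
      then have mj: "m (x (r (i, a\<^sub>0 i)) - a\<^sub>0 i + a) (\<beta> j) = (if r (i, a) = \<beta> j then 1 else 0)" for j
        by (metis of_int_eq_iff)
      show ?thesis
      proof (cases "r (i, a) = \<rho>0")
        case True
        then have "r (i, a) \<noteq> \<beta> j" for j using \<beta>K[of j] by (auto simp: K_def)
        then have "\<phi> (x (r (i, a\<^sub>0 i)) - a\<^sub>0 i + a) = 0" by (simp add: \<phi>_def vec_eq_iff mj)
        then show ?thesis by simp
      next
        case False
        then obtain j where j: "r (i, a) = \<beta> j" using K\<beta>[of "r (i, a)"] Va by (auto simp: K_def)
        have "\<beta> j = \<beta> j' \<longleftrightarrow> j = j'" for j' using \<beta> by (auto simp: bij_betw_def inj_on_def)
        then have "\<phi> (x (r (i, a\<^sub>0 i)) - a\<^sub>0 i + a) = axis j 1"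
          by (auto simp: \<phi>_def vec_eq_iff mj j axis_def)
        then show ?thesis by simp
      qed
    qed
    then show ?thesis by blast
  qed
  ultimately show ?thesis
    unfolding linear_tuple_def
    by (intro exI[of _ "\<lambda>i. x (r (i, a\<^sub>0 i)) - a\<^sub>0 i"] exI[of _ \<phi>]) blast
qed

end

theorem theorem1p3:
  fixes \<A> :: "'k::finite \<Rightarrow> (int ^ 'n::finite) set"
  assumes "\<And>i. finite (\<A> i)"
    and "\<And>i. \<A> i \<noteq> {}"
    and "tuple_span \<A> UNIV = UNIV"
    and "BK_tuple \<A>"
    and "irreducible_tuple \<A>"
    and "\<not> linear_tuple \<A>"
  shows "hypersurface \<A> (discriminant \<A>)"
proof -
  define a\<^sub>0 where "a\<^sub>0 = (\<lambda>i. SOME a. a \<in> \<A> i)"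
  have base: "a\<^sub>0 i \<in> \<A> i" for i unfolding a\<^sub>0_def using assms(2)[of i] by (simp add: some_in_eq)
  interpret irreducible_BK \<A> a\<^sub>0
    by unfold_locales (use assms base in auto)
  obtain s l\<^sub>1 where s: "balanced s" "hessian l\<^sub>1 s \<noteq> 0"
    using linear_of_hessian_zero assms(6) by blast
  define u where "u = kernel_vector l\<^sub>1 s"
  have Q: "(\<Sum>i\<in>UNIV. \<Sum>a\<in>\<A> i. s (i, a) * (pairing a u)\<^sup>2) \<noteq> 0" using s(2) by (simp add: hessian_def u_def)
  have u: "u \<noteq> 0"
  proof
    assume "u = 0"
    with Q show False by simp
  qed
  \<comment> \<open>A nonzero coordinate of the kernel vector supplies the border \<open>p\<close>
    required by \<open>kernel_is_line\<close>.\<close>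
  then obtain j where "dot (axis j 1) (kernel_vector l\<^sub>1 s) \<noteq> 0" by (auto simp: vec_eq_iff u_def)
  note ker = kernel_is_line[OF s(1) this, folded u_def]
  let ?S = "{f \<in> system_space \<A>. \<exists>x. degenerate_root f x}"
  note van = vanishes_on_degenerate_iff[of \<A>, OF CARD_eq assms(1)]
  obtain P\<^sub>0 where "polyfun \<Omega> P\<^sub>0 \<and> (\<exists>c. P\<^sub>0 c \<noteq> 0) \<and> (\<forall>c\<in>{c. degenerate_coeffs \<A> c}. P\<^sub>0 c = 0) \<and>
     (\<forall>c t. P\<^sub>0 (\<lambda>y. c y + t * 0) = P\<^sub>0 c)"
    using thin_degenerate_coeffs unfolding thin_def ..
  then have P0: "polyfun \<Omega> P\<^sub>0" "\<exists>c. P\<^sub>0 c \<noteq> 0" "\<forall>c. degenerate_coeffs \<A> c \<longrightarrow> P\<^sub>0 c = 0" by simp_all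
  obtain c\<^sub>0 where c0: "P\<^sub>0 c\<^sub>0 \<noteq> 0" using P0(2) by blast
  \<comment> \<open>Any coordinate can be eliminated; \<open>undefined\<close> is just some
    equation.\<close>
  have v: "(undefined, a\<^sub>0 undefined) \<in> \<Omega>" by (simp add: base)
  show ?thesis
    unfolding discriminant_def
  proof (rule hypersurface_criterion[OF assms(1) _ _ _ P0(1) c0 _ v])
    show "?S \<subseteq> system_space \<A>" by blast
    show "?S \<noteq> {}"
    proof
      assume "?S = {}"
      \<comment> \<open>On an empty set even the constant polynomial 1 vanishes; transferred to
        coefficients, this contradicts the degeneracy of \<open>s\<close>.\<close>
      then have "\<forall>f\<in>?S. (\<lambda>_. 1) (coefficients f) = 0" by blast
      then have "\<forall>c. degenerate_coeffs \<A> c \<longrightarrow> (\<lambda>_. 1 :: complex) c = 0"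
        using van[OF polyfun.const, of \<Omega> 1] by blast
      moreover have "degenerate_coeffs \<A> s"
      proof (rule degenerate_coeffsI[OF _ balanced_singular[OF s(1)]])
        show "(\<Sum>a\<in>\<A> i. s (i, a)) = 0" for i using s(1) by (simp add: balanced_def)
        show "(\<chi> j. 1) \<in> torus" by (simp add: torus_def)
        show "s (i, a) = 1 * monomial (\<chi> j. 1) a * s (i, a)" for i a by (simp add: monomial_def)
      qed
      ultimately show False by simp
    qed
    show "(\<forall>f\<in>?S. P (coefficients f) = 0) \<or> (\<forall>f\<in>?S. Q (coefficients f) = 0)"
      if "polyfun \<Omega> P" "polyfun \<Omega> Q" "\<forall>f\<in>?S. P (coefficients f) * Q (coefficients f) = 0" for P Q
      using degenerate_coeffs_prime[OF that(1,2)] van[OF polyfun.mult[OF that(1,2)]]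
        van[OF that(1)] van[OF that(2)] that(3) by simp
    show "P\<^sub>0 (coefficients f) = 0" if "f \<in> ?S" for f
      using van[OF P0(1)] P0(3) that by blast
    show "P c = 0" if P: "polyfun (\<Omega> - {(undefined, a\<^sub>0 undefined)}) P" "\<forall>f\<in>?S. P (coefficients f) = 0" for P c
    proof (rule degenerate_coeffs_project_onto[OF s(1) u _ ker Q v P(1)])
      show "row s i u = 0" for i using kernel_vector_row[OF s(1)] by (simp add: u_def)
      show "P c = 0" if "degenerate_coeffs \<A> c" for c
        using van[OF P(1)] P(2) that by blast
    qed
  qed
qed

end
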